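(* Let $s,l\ge1$ and let $A_i^{(r)}(u)\in\mathbb{C}((u))$, $1\le i\le l$, $1\le r\le s$, be non-zero formal Laurent series. Put $T_i^{(r)}(u)=A_i^{(r)}(u)H^{(r)}(u)=\sum_{k\in\mathbb{Z}}T^{(r)}_{i;k}u^k$. For $a_1,\dots,a_l\in\{1,\dots,s\}$ put $$T^{(a_l,\dots,a_1)}(u_1,\dots,u_l)=\prod_{1\le i<j\le l}(u_j-u_i)^{\delta_{a_i,a_j}}\prod_{j=1}^lT_j^{(a_j)}(u_j)=\sum_{\alpha\in\mathbb{Z}^l}T^{(a_l,\dots,a_1)}_\alpha u_1^{\alpha_1}\cdots u_l^{\alpha_l},$$ $$T(u_1,\dots,u_l)=\sum_{a_1,\dots,a_l=1}^s\varepsilon(a_l,\dots,a_1)\,z_{a_1}\cdots z_{a_l}\,T^{(a_l,\dots,a_1)}(u_1,\dots,u_l)=\sum_{\alpha\in\mathbb{Z}^l}T_\alpha u_1^{\alpha_1}\cdots u_l^{\alpha_l}.$$ For given $(a_l,\dots,a_1)$ let $I_r=\{i\in\{1,\dots,l\}\mid a_i=r\}$ and $m_r=|I_r|$. Then: (a) $T^{(a_l,\dots,a_1)}(u_1,\dots,u_l)=\prod_{r=1}^s\det\left[u_i^{j-1}T_i^{(r)}(u_i)\right]_{i\in I_r,\;j=1,\dots,m_r}$ for any choice of $a_i\in\{1,\dots,s\}$, $i=1,\dots,l$. (b) For every $\alpha\in\mathbb{Z}^l$, $T^{(a_l,\dots,a_1)}_\alpha=\prod_{r=1}^s\det\left[T^{(r)}_{i;\,\alpha_i+1-j}\right]_{i\in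 I_r,\;j=1,\dots,m_r}$. (c) For every $\alpha\in\mathbb{Z}^l$ with $T^{(a_l,\dots,a_1)}_\alpha\ne0$, the coefficient $T^{(a_l,\dots,a_1)}_\alpha$ is a tau-function of the $s$-component KP hierarchy; if $A_i^{(r)}(u)\in\mathbb{C}[u,u^{-1}]$ are Laurent polynomials for all $i=1,\dots,l$, $r=1,\dots,s$, it is a polynomial tau-function. (d) For every $\alpha\in\mathbb{Z}^l$ with $T_\alpha\neq0$, the coefficient $T_\alpha$ is a tau-function of the $s$-component KP hierarchy; if $A_i^{(r)}(u)\in\mathbb{C}[u,u^{-1}]$ are Laurent polynomials for all $i=1,\dots,l$, $r=1,\dots,s$, it is a polynomial tau-function. (e) Let $\tau$ be a polynomial tau-function of the $s$-component KP hierarchy. Then there exists (for some $l$) a collection of Laurent polynomials $A_i^{(r)}(u)\in\mathbb{C}[u,u^{-1}]$, $i=1,\dots,l$, $r=1,\dots,s$, such that $\tau$ is the zero-mode (the coefficient $T_{(0,\dots,0)}$) of the Laurent series expansion of $T(u_1,\dots,u_l)$.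
   Context: Determinants indexed by $i\in I_r$ use the increasing order of $I_r$; the empty determinant is $1$. Boson Fock space: $\mathcal{B}^{\otimes s}=\mathbb{C}[z_a,z_a^{-1};p_1^{(a)},p_2^{(a)},\dots;1\le a\le s]$; for $n\in\mathbb{Z}^s$ write $|n|=n_1+\dots+n_s$, $z^n=z_1^{n_1}\cdots z_s^{n_s}$; the charge $m$ component $\mathcal{B}^{\otimes s\,(m)}$ ($m\in\mathbb{Z}$) is the span of $z^{n}f$ with $n\in\mathbb{Z}^s$, $|n|=m$ and $f$ a polynomial in the $p_k^{(a)}$. Put $H^{(a)}(u)=\exp\left(\sum_{n\ge1}\frac{p_n^{(a)}}{n}u^n\right)$, $E^{(a)}(u)=\exp\left(-\sum_{n\ge1}\frac{(-1)^np_n^{(a)}}{n}u^n\right)$, $H^{(a)\perp}(u)=\exp\left(\sum_{n\ge1}\frac{\partial}{\partial p_n^{(a)}}u^{-n}\right)$, $E^{(a)\perp}(u)=\exp\left(-\sum_{n\ge1}(-1)^n\frac{\partial}{\partial p_n^{(a)}}u^{-n}\right)$, $R^{\pm(a)}(u)(z_1^{m_1}\cdots z_s^{m_s}f)=(-1)^{m_1+\dots+m_{a-1}}z_1^{m_1}\cdots z_a^{m_a\pm1}\cdots z_s^{m_s}u^{\pm m_a}f$ for $f$ a polynomial in the $p^{(b)}_k$. Fermions: $\psi^{+(a)}(u)=R^{+(a)}(u)H^{(a)}(u)E^{(a)\perp}(-u)$, $\psi^{-(a)}(u)=R^{-(a)}(u)E^{(a)}(-u)H^{(a)\perp}(u)$,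 and $\psi^{\pm(a)}(u)=\sum_{i\in\mathbb{Z}+1/2}\psi_i^{\pm(a)}u^{-i-1/2}$. A tau-function of charge $m$ of the $s$-component KP hierarchy is a non-zero $\tau$ in the formal completion of $\mathcal{B}^{\otimes s\,(m)}$ with $\Omega(\tau\otimes\tau)=0$, where $\Omega=\sum_{a=1}^s\sum_{k\in\mathbb{Z}+1/2}\psi_k^{+(a)}\otimes\psi_{-k}^{-(a)}$. It is a polynomial tau-function if $\tau=\sum_{n\in\mathbb{Z}^s,|n|=m}z^n f_n$ is a finite sum with $f_n$ polynomials in the $p_k^{(a)}$. The sign $\varepsilon$ on finite sequences of natural numbers is defined recursively by $\varepsilon(a)=1$ and $\varepsilon(a,a_l,\dots,a_1)=(-1)^{\#\{i\mid a_i<a,\,1\le i\le l\}}\varepsilon(a_l,\dots,a_1)$.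
   Formalization: In (e), τ equals the zero-mode T_(0,…,0) only up to a monomial factor z^k with k in Z^s; without it (e) fails, since every coefficient of T has charge l ≥ 1 and non-negative z-exponents, while e.g. z_1^{-1} is a polynomial tau-function. *)

theory Defs
  imports
    "HOL-Library.Poly_Mapping"
    "HOL-Library.Product_Plus"
    "HOL-Library.FuncSet"
    "HOL-Computational_Algebra.Formal_Laurent_Series"
    "Jordan_Normal_Form.Determinant"
begin

section \<open>Formal Laurent series in finitely many commuting variables\<close>

text \<open>
  The variables are \<open>u\<^sub>i\<close> with \<open>i :: nat\<close>. A series is a coefficient function on finitely supported
  integer exponent vectors that involves only finitely many variables and whose exponents are
  bounded below; this makes the Cauchy product a finite sum.
\<close>

definition supp_in :: "nat set \<Rightarrow> int \<Rightarrow> ((nat \<Rightarrow>\<^sub>0 int) \<Rightarrow> 'a::zero) \<Rightarrow> bool" where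
  "supp_in V N F \<longleftrightarrow>
     (\<forall>\<alpha>. F \<alpha> \<noteq> 0 \<longrightarrow> Poly_Mapping.keys \<alpha> \<subseteq> V \<and> (\<forall>i. N \<le> Poly_Mapping.lookup \<alpha> i))"

definition bounded_below_supp :: "((nat \<Rightarrow>\<^sub>0 int) \<Rightarrow> 'a::zero) \<Rightarrow> bool" where
  "bounded_below_supp F \<longleftrightarrow> (\<exists>V N. finite V \<and> supp_in V N F)"

typedef (overloaded) 'a mls = "{F :: (nat \<Rightarrow>\<^sub>0 int) \<Rightarrow> 'a::zero. bounded_below_supp F}"
  morphisms mls_coeff Abs_mls
  by (rule exI[of _ "\<lambda>_. 0"]) (auto simp: bounded_below_supp_def supp_in_def)

setup_lifting type_definition_mls

lemma bounded_below_suppI: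
  assumes "finite V"
    and "\<And>\<alpha>. F \<alpha> \<noteq> 0 \<Longrightarrow> Poly_Mapping.keys \<alpha> \<subseteq> V"
    and "\<And>\<alpha> i. F \<alpha> \<noteq> 0 \<Longrightarrow> N \<le> Poly_Mapping.lookup \<alpha> i"
  shows "bounded_below_supp F"
  using assms unfolding bounded_below_supp_def supp_in_def by blast

lemma bounded_below_supp_box2:
  assumes "bounded_below_supp F" "bounded_below_supp G"
  shows "\<exists>V N. finite V \<and> N \<le> 0 \<and> supp_in V N F \<and> supp_in V N G"
proof -
  from assms(1) obtain V1 N1 where 1: "finite V1"
    "supp_in V1 N1 F"
    unfolding bounded_below_supp_def by blast
  from assms(2) obtain V2 N2 where 2: "finite V2"
    "supp_in V2 N2 G"
    unfolding bounded_below_supp_def by blast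
  let ?N = "min 0 (min N1 N2)"
  have N: "?N \<le> 0" "?N \<le> N1" "?N \<le> N2" by auto
  have "Poly_Mapping.keys \<alpha> \<subseteq> V1 \<union> V2 \<and> (\<forall>i. ?N \<le> Poly_Mapping.lookup \<alpha> i)"
    if "F \<alpha> \<noteq> 0" for \<alpha>
    using 1(2) that order_trans[OF N(2)] unfolding supp_in_def by blast
  moreover have "Poly_Mapping.keys \<alpha> \<subseteq> V1 \<union> V2 \<and> (\<forall>i. ?N \<le> Poly_Mapping.lookup \<alpha> i)"
    if "G \<alpha> \<noteq> 0" for \<alpha>
    using 2(2) that order_trans[OF N(3)] unfolding supp_in_def by blast
  ultimately show ?thesis
    using 1(1) 2(1) N(1) by (intro exI[of _ "V1 \<union> V2"] exI[of _ ?N]) (simp add: supp_in_def)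
qed

lemma finite_exponent_box:
  assumes "finite V"
  shows "finite {\<beta> :: nat \<Rightarrow>\<^sub>0 int. Poly_Mapping.keys \<beta> \<subseteq> V \<and>
           (\<forall>i. M \<le> Poly_Mapping.lookup \<beta> i \<and> M \<le> Poly_Mapping.lookup (\<alpha> - \<beta>) i)}" (is "finite ?D")
proof (rule finite_imageD)
  let ?f = "\<lambda>\<beta> :: nat \<Rightarrow>\<^sub>0 int. restrict (Poly_Mapping.lookup \<beta>) V"
  have "?f ` ?D \<subseteq> (\<Pi>\<^sub>E i\<in>V. {M..Poly_Mapping.lookup \<alpha> i - M})"
    by (auto simp: PiE_def Pi_def lookup_minus algebra_simps)
  then show "finite (?f ` ?D)"
    by (rule finite_subset) (use assms in \<open>auto intro: finite_PiE\<close>)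
  show "inj_on ?f ?D"
  proof (rule inj_onI)
    fix \<beta> \<gamma> :: "nat \<Rightarrow>\<^sub>0 int"
    assume D: "\<beta> \<in> ?D" "\<gamma> \<in> ?D" and eq: "?f \<beta> = ?f \<gamma>"
    show "\<beta> = \<gamma>"
    proof (rule poly_mapping_eqI)
      fix i
      show "Poly_Mapping.lookup \<beta> i = Poly_Mapping.lookup \<gamma> i"
      proof (cases "i \<in> V")
        case True
        then show ?thesis using fun_cong[OF eq, of i] by simp
      next
        case False
        then have "i \<notin> Poly_Mapping.keys \<beta>" "i \<notin> Poly_Mapping.keys \<gamma>" using D by auto
        then show ?thesis by (simp add: in_keys_iff)
      qed
    qed
  qed
qed

definition cauchy_prod ::
  "((nat \<Rightarrow>\<^sub>0 int) \<Rightarrow> 'a) \<Rightarrow> ((nat \<Rightarrow>\<^sub>0 int) \<Rightarrow> 'a) \<Rightarrow> (nat \<Rightarrow>\<^sub>0 int) \<Rightarrow> 'a::semiring_0" where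
  "cauchy_prod F G \<alpha> = Sum_any (\<lambda>\<beta>. F \<beta> * G (\<alpha> - \<beta>))"

lemma finite_cauchy_prod:
  assumes "bounded_below_supp F" "bounded_below_supp G"
  shows "finite {\<beta>. F \<beta> * G (\<alpha> - \<beta>) \<noteq> (0::'a::semiring_0)}"
proof -
  obtain V N where boxVN: "finite V \<and> N \<le> 0 \<and> supp_in V N F \<and> supp_in V N G"
    using bounded_below_supp_box2[OF assms] by blast
  have VN: "finite V" "N \<le> 0"
    "\<And>\<alpha>. F \<alpha> \<noteq> 0 \<Longrightarrow> Poly_Mapping.keys \<alpha> \<subseteq> V"
    "\<And>\<alpha> i. F \<alpha> \<noteq> 0 \<Longrightarrow> N \<le> Poly_Mapping.lookup \<alpha> i"
    "\<And>\<alpha>. G \<alpha> \<noteq> 0 \<Longrightarrow> Poly_Mapping.keys \<alpha> \<subseteq> V"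
    "\<And>\<alpha> i. G \<alpha> \<noteq> 0 \<Longrightarrow> N \<le> Poly_Mapping.lookup \<alpha> i"
    using boxVN unfolding supp_in_def by blast+
  have "F \<beta> \<noteq> 0 \<and> G (\<alpha> - \<beta>) \<noteq> 0" if "F \<beta> * G (\<alpha> - \<beta>) \<noteq> 0" for \<beta>
    using that by auto
  then have "{\<beta>. F \<beta> * G (\<alpha> - \<beta>) \<noteq> 0} \<subseteq> {\<beta>. Poly_Mapping.keys \<beta> \<subseteq> V \<and>
           (\<forall>i. N \<le> Poly_Mapping.lookup \<beta> i \<and> N \<le> Poly_Mapping.lookup (\<alpha> - \<beta>) i)}"
    using VN(3,4,6) by blast
  then show ?thesis
    by (rule finite_subset) (rule finite_exponent_box[OF VN(1)])
qed

lemma cauchy_prod_nonzeroE: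
  assumes "cauchy_prod F G \<alpha> \<noteq> (0::'a::semiring_0)"
  obtains \<beta> where "F \<beta> \<noteq> 0" "G (\<alpha> - \<beta>) \<noteq> 0"
proof -
  obtain \<beta> where "F \<beta> * G (\<alpha> - \<beta>) \<noteq> 0"
    using assms unfolding cauchy_prod_def by (rule Sum_any.not_neutral_obtains_not_neutral)
  then have "F \<beta> \<noteq> 0" "G (\<alpha> - \<beta>) \<noteq> 0" by auto
  then show ?thesis by (rule that)
qed

lemma bounded_below_supp_cauchy_prod:
  assumes "bounded_below_supp F" "bounded_below_supp G"
  shows "bounded_below_supp (cauchy_prod F G :: _ \<Rightarrow> 'a::semiring_0)"
proof -
  obtain V N where boxVN: "finite V \<and> N \<le> 0 \<and> supp_in V N F \<and> supp_in V N G"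
    using bounded_below_supp_box2[OF assms] by blast
  have VN: "finite V" "N \<le> 0"
    "\<And>\<alpha>. F \<alpha> \<noteq> 0 \<Longrightarrow> Poly_Mapping.keys \<alpha> \<subseteq> V"
    "\<And>\<alpha> i. F \<alpha> \<noteq> 0 \<Longrightarrow> N \<le> Poly_Mapping.lookup \<alpha> i"
    "\<And>\<alpha>. G \<alpha> \<noteq> 0 \<Longrightarrow> Poly_Mapping.keys \<alpha> \<subseteq> V"
    "\<And>\<alpha> i. G \<alpha> \<noteq> 0 \<Longrightarrow> N \<le> Poly_Mapping.lookup \<alpha> i"
    using boxVN unfolding supp_in_def by blast+
  show ?thesis
  proof (rule bounded_below_suppI[OF VN(1), where N = "N + N"])
    fix \<alpha> assume "cauchy_prod F G \<alpha> \<noteq> 0"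
    then obtain \<beta> where \<beta>: "F \<beta> \<noteq> 0" "G (\<alpha> - \<beta>) \<noteq> 0" by (rule cauchy_prod_nonzeroE)
    have "Poly_Mapping.keys \<alpha> \<subseteq> Poly_Mapping.keys \<beta> \<union> Poly_Mapping.keys (\<alpha> - \<beta>)"
      using Poly_Mapping.keys_add[of \<beta> "\<alpha> - \<beta>"] by simp
    then show "Poly_Mapping.keys \<alpha> \<subseteq> V" using VN(3)[OF \<beta>(1)] VN(5)[OF \<beta>(2)] by blast
    show "N + N \<le> Poly_Mapping.lookup \<alpha> i" for i
      using VN(4)[OF \<beta>(1), of i] VN(6)[OF \<beta>(2), of i] by (simp add: lookup_minus)
  qed
qed

lemma cauchy_prod_assoc:
  assumes F: "bounded_below_supp F" and G: "bounded_below_supp G" and H: "bounded_below_supp H"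
  shows "cauchy_prod (cauchy_prod F G) H \<alpha> = (cauchy_prod F (cauchy_prod G H) \<alpha> :: 'a::semiring_0)"
proof -
  obtain V1 N1 where box1: "finite V1 \<and> N1 \<le> 0 \<and> supp_in V1 N1 F \<and> supp_in V1 N1 G"
    using bounded_below_supp_box2[OF F G] by blast
  have 1: "finite V1" "N1 \<le> 0"
    "\<And>\<alpha>. F \<alpha> \<noteq> 0 \<Longrightarrow> Poly_Mapping.keys \<alpha> \<subseteq> V1"
    "\<And>\<alpha> i. F \<alpha> \<noteq> 0 \<Longrightarrow> N1 \<le> Poly_Mapping.lookup \<alpha> i"
    "\<And>\<alpha>. G \<alpha> \<noteq> 0 \<Longrightarrow> Poly_Mapping.keys \<alpha> \<subseteq> V1"
    "\<And>\<alpha> i. G \<alpha> \<noteq> 0 \<Longrightarrow> N1 \<le> Poly_Mapping.lookup \<alpha> i"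
    using box1 unfolding supp_in_def by blast+
  obtain V2 N2 where box2: "finite V2 \<and> N2 \<le> 0 \<and> supp_in V2 N2 H"
    using bounded_below_supp_box2[OF H H] by blast
  have 2: "finite V2" "N2 \<le> 0"
    "\<And>\<alpha>. H \<alpha> \<noteq> 0 \<Longrightarrow> Poly_Mapping.keys \<alpha> \<subseteq> V2"
    "\<And>\<alpha> i. H \<alpha> \<noteq> 0 \<Longrightarrow> N2 \<le> Poly_Mapping.lookup \<alpha> i"
    using box2 unfolding supp_in_def by blast+
  define M where "M = N1 + N1 + N2"
  define D where "D = {\<beta> :: nat \<Rightarrow>\<^sub>0 int. Poly_Mapping.keys \<beta> \<subseteq> V1 \<and>
           (\<forall>i. M \<le> Poly_Mapping.lookup \<beta> i \<and> M \<le> Poly_Mapping.lookup (\<alpha> - \<beta>) i)}"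
  have fD: "finite D" unfolding D_def by (rule finite_exponent_box[OF 1(1)])
  have key: "\<gamma> \<in> D \<and> \<beta> \<in> D" if "F \<gamma> \<noteq> 0" "G (\<beta> - \<gamma>) \<noteq> 0" "H (\<alpha> - \<beta>) \<noteq> 0" for \<beta> \<gamma>
  proof -
    have "Poly_Mapping.keys \<beta> \<subseteq> Poly_Mapping.keys \<gamma> \<union> Poly_Mapping.keys (\<beta> - \<gamma>)"
      using Poly_Mapping.keys_add[of \<gamma> "\<beta> - \<gamma>"] by simp
    then have "Poly_Mapping.keys \<gamma> \<subseteq> V1" "Poly_Mapping.keys \<beta> \<subseteq> V1"
      using 1(3)[OF that(1)] 1(5)[OF that(2)] by blast+
    moreover have "M \<le> Poly_Mapping.lookup \<beta> i \<and> M \<le> Poly_Mapping.lookup (\<alpha> - \<beta>) i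
        \<and> M \<le> Poly_Mapping.lookup \<gamma> i \<and> M \<le> Poly_Mapping.lookup (\<alpha> - \<gamma>) i" for i
      using 1(4)[OF that(1), of i] 1(6)[OF that(2), of i] 2(4)[OF that(3), of i] 1(2) 2(2)
      unfolding M_def lookup_minus by linarith
    ultimately show ?thesis unfolding D_def by blast
  qed
  have nz: "a \<noteq> 0 \<and> b \<noteq> 0" if "a * b \<noteq> 0" for a b :: 'a
    using that by auto
  have "cauchy_prod (cauchy_prod F G) H \<alpha> = (\<Sum>\<beta>\<in>D. cauchy_prod F G \<beta> * H (\<alpha> - \<beta>))"
    unfolding cauchy_prod_def[of "cauchy_prod F G"]
  proof (rule Sum_any.expand_superset[OF fD], safe)
    fix \<beta> assume "cauchy_prod F G \<beta> * H (\<alpha> - \<beta>) \<noteq> 0"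
    then have H\<beta>: "H (\<alpha> - \<beta>) \<noteq> 0" and "cauchy_prod F G \<beta> \<noteq> 0" using nz by blast+
    from this(2) obtain \<gamma> where "F \<gamma> \<noteq> 0" "G (\<beta> - \<gamma>) \<noteq> 0" by (rule cauchy_prod_nonzeroE)
    then show "\<beta> \<in> D" using key H\<beta> by blast
  qed
  also have "\<dots> = (\<Sum>\<beta>\<in>D. \<Sum>\<gamma>\<in>D. F \<gamma> * (G (\<beta> - \<gamma>) * H (\<alpha> - \<beta>)))"
  proof (rule sum.cong[OF refl])
    fix \<beta>
    show "cauchy_prod F G \<beta> * H (\<alpha> - \<beta>) = (\<Sum>\<gamma>\<in>D. F \<gamma> * (G (\<beta> - \<gamma>) * H (\<alpha> - \<beta>)))"
    proof (cases "H (\<alpha> - \<beta>) = 0")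
      case False
      have "cauchy_prod F G \<beta> = (\<Sum>\<gamma>\<in>D. F \<gamma> * G (\<beta> - \<gamma>))"
        unfolding cauchy_prod_def
        by (rule Sum_any.expand_superset[OF fD]) (use nz key False in blast)
      then show ?thesis by (simp add: sum_distrib_right mult.assoc)
    qed simp
  qed
  also have "\<dots> = (\<Sum>\<gamma>\<in>D. \<Sum>\<beta>\<in>D. F \<gamma> * (G (\<beta> - \<gamma>) * H (\<alpha> - \<beta>)))"
    by (rule sum.swap)
  also have "\<dots> = (\<Sum>\<gamma>\<in>D. F \<gamma> * cauchy_prod G H (\<alpha> - \<gamma>))"
  proof (rule sum.cong[OF refl])
    fix \<gamma>
    show "(\<Sum>\<beta>\<in>D. F \<gamma> * (G (\<beta> - \<gamma>) * H (\<alpha> - \<beta>))) = F \<gamma> * cauchy_prod G H (\<alpha> - \<gamma>)"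
    proof (cases "F \<gamma> = 0")
      case False
      have "cauchy_prod G H (\<alpha> - \<gamma>) = Sum_any (\<lambda>\<beta>. G (\<beta> - \<gamma>) * H (\<alpha> - \<beta>))"
        unfolding cauchy_prod_def
      proof (rule Sum_any.reindex_cong)
        show "bij (\<lambda>\<beta>. \<beta> - \<gamma>)"
          by (rule bij_betw_byWitness[where f' = "\<lambda>\<beta>. \<beta> + \<gamma>"]) auto
        show "(\<lambda>\<beta>. G \<beta> * H (\<alpha> - \<gamma> - \<beta>)) \<circ> (\<lambda>\<beta>. \<beta> - \<gamma>) = (\<lambda>\<beta>. G (\<beta> - \<gamma>) * H (\<alpha> - \<beta>))"
          by (auto simp: fun_eq_iff algebra_simps)
      qed
      also have "\<dots> = (\<Sum>\<beta>\<in>D. G (\<beta> - \<gamma>) * H (\<alpha> - \<beta>))"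
        by (rule Sum_any.expand_superset[OF fD]) (use nz key False in blast)
      finally show ?thesis by (simp add: sum_distrib_left)
    qed simp
  qed
  also have "\<dots> = cauchy_prod F (cauchy_prod G H) \<alpha>"
    unfolding cauchy_prod_def[of F "cauchy_prod G H"]
  proof (rule Sum_any.expand_superset[OF fD, symmetric], safe)
    fix \<gamma> assume "F \<gamma> * cauchy_prod G H (\<alpha> - \<gamma>) \<noteq> 0"
    then have "F \<gamma> \<noteq> 0" "cauchy_prod G H (\<alpha> - \<gamma>) \<noteq> 0" using nz by blast+
    from this(2) obtain \<delta> where "G \<delta> \<noteq> 0" "H (\<alpha> - \<gamma> - \<delta>) \<noteq> 0" by (rule cauchy_prod_nonzeroE)
    then show "\<gamma> \<in> D"
      using key[OF \<open>F \<gamma> \<noteq> 0\<close>, of "\<gamma> + \<delta>"] by (simp add: diff_diff_eq)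
  qed
  finally show ?thesis .
qed

lemma cauchy_prod_commute:
  "cauchy_prod F G \<alpha> = (cauchy_prod G F \<alpha> :: 'a::comm_semiring_0)"
  unfolding cauchy_prod_def
proof (rule Sum_any.reindex_cong)
  show "bij (\<lambda>\<beta>. \<alpha> - \<beta>)"
    by (rule bij_betw_byWitness[where f' = "\<lambda>\<beta>. \<alpha> - \<beta>"]) auto
  show "(\<lambda>\<beta>. F \<beta> * G (\<alpha> - \<beta>)) \<circ> (\<lambda>\<beta>. \<alpha> - \<beta>) = (\<lambda>\<beta>. G \<beta> * F (\<alpha> - \<beta>))"
    by (auto simp: fun_eq_iff mult.commute)
qed

lemma bounded_below_supp_monom:
  "bounded_below_supp (\<lambda>\<alpha>. if \<alpha> = 0 then c else 0)"
  by (rule bounded_below_suppI[of "{}" _ 0]) (auto split: if_splits)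

lemma bounded_below_supp_add:
  assumes "bounded_below_supp F" "bounded_below_supp G"
    and "\<And>\<alpha>. F \<alpha> = 0 \<Longrightarrow> G \<alpha> = 0 \<Longrightarrow> K \<alpha> = 0"
  shows "bounded_below_supp K"
proof -
  obtain V N where boxVN: "finite V \<and> N \<le> 0 \<and> supp_in V N F \<and> supp_in V N G"
    using bounded_below_supp_box2[OF assms(1,2)] by blast
  have VN: "finite V" "N \<le> 0"
    "\<And>\<alpha>. F \<alpha> \<noteq> 0 \<Longrightarrow> Poly_Mapping.keys \<alpha> \<subseteq> V"
    "\<And>\<alpha> i. F \<alpha> \<noteq> 0 \<Longrightarrow> N \<le> Poly_Mapping.lookup \<alpha> i"
    "\<And>\<alpha>. G \<alpha> \<noteq> 0 \<Longrightarrow> Poly_Mapping.keys \<alpha> \<subseteq> V"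
    "\<And>\<alpha> i. G \<alpha> \<noteq> 0 \<Longrightarrow> N \<le> Poly_Mapping.lookup \<alpha> i"
    using boxVN unfolding supp_in_def by blast+
  show ?thesis
  proof (rule bounded_below_suppI[OF VN(1), where N = N])
    fix \<alpha> assume "K \<alpha> \<noteq> 0"
    then have *: "F \<alpha> \<noteq> 0 \<or> G \<alpha> \<noteq> 0" using assms(3) by blast
    then show "Poly_Mapping.keys \<alpha> \<subseteq> V" using VN(3,5) by blast
    show "N \<le> Poly_Mapping.lookup \<alpha> i" for i using * VN(4,6) by blast
  qed
qed

instantiation mls :: (comm_ring_1) comm_ring_1
begin

lift_definition zero_mls :: "'a mls" is "\<lambda>_. 0"
  by (auto simp: bounded_below_supp_def supp_in_def)

lift_definition one_mls :: "'a mls" is "\<lambda>\<alpha>. if \<alpha> = 0 then 1 else 0"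
  by (rule bounded_below_supp_monom)

lift_definition plus_mls :: "'a mls \<Rightarrow> 'a mls \<Rightarrow> 'a mls" is "\<lambda>F G \<alpha>. F \<alpha> + G \<alpha>"
  by (erule (1) bounded_below_supp_add) simp

lift_definition minus_mls :: "'a mls \<Rightarrow> 'a mls \<Rightarrow> 'a mls" is "\<lambda>F G \<alpha>. F \<alpha> - G \<alpha>"
  by (erule (1) bounded_below_supp_add) simp

lift_definition uminus_mls :: "'a mls \<Rightarrow> 'a mls" is "\<lambda>F \<alpha>. - F \<alpha>"
  by (simp add: bounded_below_supp_def supp_in_def)

lift_definition times_mls :: "'a mls \<Rightarrow> 'a mls \<Rightarrow> 'a mls" is cauchy_prod
  by (rule bounded_below_supp_cauchy_prod)

instance
proof
  fix a b c :: "'a mls"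
  show "a * b * c = a * (b * c)"
    by transfer (auto simp: fun_eq_iff cauchy_prod_assoc)
  show "a * b = b * a"
    by transfer (auto simp: fun_eq_iff cauchy_prod_commute)
  show "1 * a = a"
  proof (transfer, rule ext)
    fix F :: "(nat \<Rightarrow>\<^sub>0 int) \<Rightarrow> 'a" and \<alpha>
    have "cauchy_prod (\<lambda>\<alpha>. if \<alpha> = 0 then 1 else 0) F \<alpha>
        = (\<Sum>\<beta>\<in>{0}. (if \<beta> = 0 then 1 else 0) * F (\<alpha> - \<beta>))"
      unfolding cauchy_prod_def by (rule Sum_any.expand_superset) (auto split: if_splits)
    then show "cauchy_prod (\<lambda>\<alpha>. if \<alpha> = 0 then 1 else 0) F \<alpha> = F \<alpha>" by simp
  qed
  show "(a + b) * c = a * c + b * c"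
  proof (transfer, rule ext)
    fix F G H :: "(nat \<Rightarrow>\<^sub>0 int) \<Rightarrow> 'a" and \<alpha>
    assume "bounded_below_supp F" "bounded_below_supp G" "bounded_below_supp H"
    then show "cauchy_prod (\<lambda>\<alpha>. F \<alpha> + G \<alpha>) H \<alpha> = cauchy_prod F H \<alpha> + cauchy_prod G H \<alpha>"
      unfolding cauchy_prod_def
      by (subst Sum_any.distrib[symmetric]) (auto intro: finite_cauchy_prod simp: distrib_right)
  qed
  show "(0 :: 'a mls) \<noteq> 1"
    by transfer (metis zero_neq_one)
qed (transfer; simp add: fun_eq_iff add_ac)+

end

lift_definition mls_const :: "'a::zero \<Rightarrow> 'a mls" is "\<lambda>c \<alpha>. if \<alpha> = 0 then c else 0"
  by (rule bounded_below_supp_monom)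

lift_definition mls_of_fls :: "nat \<Rightarrow> 'a::zero fls \<Rightarrow> 'a mls" is
  "\<lambda>i F \<alpha>. if Poly_Mapping.keys \<alpha> \<subseteq> {i} then fls_nth F (Poly_Mapping.lookup \<alpha> i) else 0"
proof -
  fix i :: nat and F :: "'a fls"
  obtain N where N: "\<And>n. n < N \<Longrightarrow> fls_nth F n = 0"
    using fls_eq0_below_subdegree by blast
  show "bounded_below_supp (\<lambda>\<alpha>. if Poly_Mapping.keys \<alpha> \<subseteq> {i}
          then fls_nth F (Poly_Mapping.lookup \<alpha> i) else 0)"
  proof (rule bounded_below_suppI[of "{i}" _ "min 0 N"])
    fix \<alpha> :: "nat \<Rightarrow>\<^sub>0 int" and j
    assume nz: "(if Poly_Mapping.keys \<alpha> \<subseteq> {i} then fls_nth F (Poly_Mapping.lookup \<alpha> i) else 0) \<noteq> 0"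
    then have k: "Poly_Mapping.keys \<alpha> \<subseteq> {i}" and f: "fls_nth F (Poly_Mapping.lookup \<alpha> i) \<noteq> 0"
      by (auto split: if_splits)
    show "min 0 N \<le> Poly_Mapping.lookup \<alpha> j"
    proof (cases "j = i")
      case True
      then show ?thesis using N f by (metis linorder_not_less min.coboundedI2)
    next
      case False
      then have "Poly_Mapping.lookup \<alpha> j = 0" using k by (auto simp: in_keys_iff)
      then show ?thesis by simp
    qed
  qed (auto split: if_splits)
qed

abbreviation uvar :: "nat \<Rightarrow> 'a::{zero,one} mls" where
  "uvar i \<equiv> mls_of_fls i fls_X"

text \<open>Rows are indexed by \<open>I\<close> in increasing order, columns by \<open>j = 1, \<dots>, card I\<close>.\<close>

definition indexed_det :: "nat set \<Rightarrow> (nat \<Rightarrow> nat \<Rightarrow> 'a) \<Rightarrow> 'a::comm_ring_1" where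
  "indexed_det I f = det (mat (card I) (card I)
     (\<lambda>(p, q). f (sorted_list_of_set I ! p) (Suc q)))"


section \<open>The boson Fock space and its formal completion\<close>

text \<open>
  A basis vector is a pair \<open>(n, \<mu>)\<close>, standing for \<open>z\<^sup>n \<Prod> (p\<^sub>k\<^sup>(\<^sup>a\<^sup>))\<close> to the power \<open>\<mu> (a, k)\<close>. No bound
  on the component index \<open>a\<close> and no positivity of \<open>k\<close> is built into the types; the space belonging
  to \<open>s\<close> components is carved out in \<open>completed_fock\<close>. The type \<open>boson\<close> is a commutative ring under
  the convolution product of \<open>\<Rightarrow>\<^sub>0\<close>, i.e. polynomials in the \<open>p\<close> and Laurent polynomials in the \<open>z\<close>.
  Elements of \<open>cboson\<close> are arbitrary formal sums of basis vectors.
\<close>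

type_synonym fock_basis = "(nat \<Rightarrow>\<^sub>0 int) \<times> (nat \<times> nat \<Rightarrow>\<^sub>0 nat)"
type_synonym boson = "fock_basis \<Rightarrow>\<^sub>0 complex"
type_synonym cboson = "fock_basis \<Rightarrow> complex"

definition bconst :: "complex \<Rightarrow> boson" where
  "bconst c = Poly_Mapping.single 0 c"

definition zpow :: "(nat \<Rightarrow>\<^sub>0 int) \<Rightarrow> boson" where
  "zpow n = Poly_Mapping.single (n, 0) 1"

definition zvar :: "nat \<Rightarrow> boson" where
  "zvar a = zpow (Poly_Mapping.single a 1)"

definition pvar :: "nat \<Rightarrow> nat \<Rightarrow> boson" where
  "pvar a k = Poly_Mapping.single (0, Poly_Mapping.single (a, k) 1) 1"

definition completed_fock :: "nat \<Rightarrow> int \<Rightarrow> cboson set" where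
  "completed_fock s m = {v. \<forall>n \<mu>. v (n, \<mu>) \<noteq> 0 \<longrightarrow>
     Poly_Mapping.keys n \<subseteq> {1..s} \<and> (\<Sum>a=1..s. Poly_Mapping.lookup n a) = m \<and>
     Poly_Mapping.keys \<mu> \<subseteq> {1..s} \<times> {1..}}"

text \<open>Exponential of a power series without constant term (\<open>F ^ k\<close> has order at least \<open>k\<close>).\<close>

definition boson_exp :: "boson fps \<Rightarrow> boson fps" where
  "boson_exp F = Abs_fps (\<lambda>n. \<Sum>k\<le>n. bconst (1 / fact k) * fps_nth (F ^ k) n)"

definition Hser :: "nat \<Rightarrow> boson fps" where
  "Hser a = boson_exp (Abs_fps (\<lambda>n. if n = 0 then 0 else bconst (1 / of_nat n) * pvar a n))"

definition Eser :: "nat \<Rightarrow> boson fps" where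
  "Eser a = boson_exp (- Abs_fps (\<lambda>n. if n = 0 then 0
     else bconst ((-1) ^ n / of_nat n) * pvar a n))"


section \<open>Fermions and tau-functions\<close>

text \<open>
  A formal series \<open>X(u) = \<Sum>\<^sub>j X\<^sub>j u\<^sup>j\<close> (over all integers \<open>j\<close>) of operators on the completed Fock space
  is the function \<open>j \<mapsto> X\<^sub>j\<close>. In all compositions formed below, the sum over \<open>j\<close> in \<open>ops_comp\<close> has
  finitely many non-zero terms at each basis vector.
\<close>

type_synonym opseries = "int \<Rightarrow> cboson \<Rightarrow> cboson"

definition ops_comp :: "opseries \<Rightarrow> opseries \<Rightarrow> opseries" where
  "ops_comp X Y N v b = Sum_any (\<lambda>j. X j (Y (N - j) v) b)"

definition ops_one :: opseries where
  "ops_one j v = (if j = 0 then v else (\<lambda>_. 0))"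

definition ops_exp :: "opseries \<Rightarrow> opseries" where
  "ops_exp X N v b = Sum_any (\<lambda>k. (1 / fact k) * (ops_comp X ^^ k) ops_one N v b)"

text \<open>The substitution \<open>u \<mapsto> -u\<close>.\<close>

definition ops_neg :: "opseries \<Rightarrow> opseries" where
  "ops_neg X j v b = (-1) powi j * X j v b"

definition mult_op :: "boson \<Rightarrow> cboson \<Rightarrow> cboson" where
  "mult_op P v b = (\<Sum>(c, d) \<in> {(c, d). c \<in> Poly_Mapping.keys P \<and> c + d = b}.
     Poly_Mapping.lookup P c * v d)"

definition ops_of_fps :: "boson fps \<Rightarrow> opseries" where
  "ops_of_fps F j v = (if j < 0 then (\<lambda>_. 0) else mult_op (fps_nth F (nat j)) v)"

text \<open>The partial derivative with respect to \<open>p\<^sub>k\<^sup>(\<^sup>a\<^sup>)\<close>.\<close>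

definition pderiv_op :: "nat \<Rightarrow> nat \<Rightarrow> cboson \<Rightarrow> cboson" where
  "pderiv_op a k v = (\<lambda>(n, \<mu>). of_nat (Poly_Mapping.lookup \<mu> (a, k) + 1)
     * v (n, \<mu> + Poly_Mapping.single (a, k) 1))"

definition Hperp :: "nat \<Rightarrow> opseries" where
  "Hperp a = ops_exp (\<lambda>j v b. if j < 0 then pderiv_op a (nat (-j)) v b else 0)"

definition Eperp :: "nat \<Rightarrow> opseries" where
  "Eperp a = ops_exp (\<lambda>j v b. if j < 0 then - ((-1) ^ nat (-j) * pderiv_op a (nat (-j)) v b) else 0)"

text \<open>
  \<open>Rop \<sigma> a\<close> with \<open>\<sigma> = 1\<close> or \<open>\<sigma> = -1\<close> is \<open>R\<^sup>\<plusminus>\<^sup>(\<^sup>a\<^sup>)(u)\<close>. The coefficient of the result at \<open>z\<^sup>n\<close> comes from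
  that of the argument at \<open>z\<^sup>m\<close>, where \<open>m\<close> is \<open>n\<close> with its \<open>a\<close>-th entry decreased by \<open>\<sigma>\<close>.
\<close>

definition Rop :: "int \<Rightarrow> nat \<Rightarrow> opseries" where
  "Rop \<sigma> a j v = (\<lambda>(n, \<mu>). let m = n - Poly_Mapping.single a \<sigma> in
     if j = \<sigma> * Poly_Mapping.lookup m a
     then (-1) powi (\<Sum>b=1..<a. Poly_Mapping.lookup m b) * v (m, \<mu>) else 0)"

definition psi_plus :: "nat \<Rightarrow> opseries" where
  "psi_plus a = ops_comp (Rop 1 a) (ops_comp (ops_of_fps (Hser a)) (ops_neg (Eperp a)))"

definition psi_minus :: "nat \<Rightarrow> opseries" where
  "psi_minus a = ops_comp (Rop (-1) a) (ops_comp (ops_neg (ops_of_fps (Eser a))) (Hperp a))"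

text \<open>
  The integer \<open>k\<close> encodes the mode \<open>i = k + 1/2\<close>; this mode is the coefficient of
  \<open>u\<close> to the power \<open>- i - 1/2 = - k - 1\<close>, and the opposite mode \<open>- i\<close> has code \<open>- k - 1\<close>.
\<close>

definition psi_plus_mode :: "nat \<Rightarrow> int \<Rightarrow> cboson \<Rightarrow> cboson" where
  "psi_plus_mode a k = psi_plus a (- k - 1)"

definition psi_minus_mode :: "nat \<Rightarrow> int \<Rightarrow> cboson \<Rightarrow> cboson" where
  "psi_minus_mode a k = psi_minus a (- k - 1)"

text \<open>
  \<open>Omega s v w\<close> is \<open>\<Omega> (v \<otimes> w)\<close>, written in the completed tensor square as a function of two
  basis vectors. At each pair of basis vectors only finitely many modes contribute when \<open>v\<close> and
  \<open>w\<close> lie in \<open>completed_fock\<close>.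
\<close>

definition Omega :: "nat \<Rightarrow> cboson \<Rightarrow> cboson \<Rightarrow> fock_basis \<Rightarrow> fock_basis \<Rightarrow> complex" where
  "Omega s v w b b' = (\<Sum>a=1..s. Sum_any (\<lambda>k. psi_plus_mode a k v b * psi_minus_mode a (- k - 1) w b'))"

definition tau_function_of_charge :: "nat \<Rightarrow> int \<Rightarrow> cboson \<Rightarrow> bool" where
  "tau_function_of_charge s m \<tau> \<longleftrightarrow>
     \<tau> \<in> completed_fock s m \<and> \<tau> \<noteq> (\<lambda>_. 0) \<and> (\<forall>b b'. Omega s \<tau> \<tau> b b' = 0)"

definition tau_function :: "nat \<Rightarrow> cboson \<Rightarrow> bool" where
  "tau_function s \<tau> \<longleftrightarrow> (\<exists>m. tau_function_of_charge s m \<tau>)"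

definition polynomial_tau_function :: "nat \<Rightarrow> cboson \<Rightarrow> bool" where
  "polynomial_tau_function s \<tau> \<longleftrightarrow> tau_function s \<tau> \<and> (\<exists>P :: boson. \<tau> = Poly_Mapping.lookup P)"


section \<open>The generating series\<close>

definition laurent_polynomial :: "'a::zero fls \<Rightarrow> bool" where
  "laurent_polynomial F \<longleftrightarrow> finite {k. fls_nth F k \<noteq> 0}"

definition Tone :: "(nat \<Rightarrow> nat \<Rightarrow> complex fls) \<Rightarrow> nat \<Rightarrow> nat \<Rightarrow> boson fls" where
  "Tone A i r = Abs_fls (\<lambda>k. bconst (fls_nth (A i r) k)) * fps_to_fls (Hser r)"

text \<open>In the following, \<open>a i\<close> is \<open>a\<^sub>i\<close> for \<open>1 \<le> i \<le> l\<close>.\<close>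

definition Tcomp :: "(nat \<Rightarrow> nat \<Rightarrow> complex fls) \<Rightarrow> nat \<Rightarrow> (nat \<Rightarrow> nat) \<Rightarrow> boson mls" where
  "Tcomp A l a =
     (\<Prod>(i, j) \<in> {(i, j). 1 \<le> i \<and> i < j \<and> j \<le> l}. (uvar j - uvar i) ^ of_bool (a i = a j))
     * (\<Prod>j=1..l. mls_of_fls j (Tone A j (a j)))"

fun seq_sign :: "nat list \<Rightarrow> int" where
  "seq_sign [] = 1"
| "seq_sign (x # xs) = (-1) ^ card {i. i < length xs \<and> xs ! i < x} * seq_sign xs"

definition Tfull :: "(nat \<Rightarrow> nat \<Rightarrow> complex fls) \<Rightarrow> nat \<Rightarrow> nat \<Rightarrow> boson mls" where
  "Tfull A s l = (\<Sum>a \<in> {1..l} \<rightarrow>\<^sub>E {1..s}.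
     mls_const (of_int (seq_sign (map a (rev [1..<Suc l]))) * (\<Prod>j=1..l. zvar (a j))) * Tcomp A l a)"

text \<open>
  Every coefficient of \<open>Tfull A s l\<close> has charge \<open>l \<ge> 1\<close> and involves only non-negative powers of the
  \<open>z\<close>, while a polynomial tau-function may have any charge and any \<open>z\<close>-exponents (\<open>1\<close> is one, of
  charge 0). So a polynomial tau-function can be a zero-mode of \<open>Tfull\<close> only up to a monomial
  factor \<open>zpow k\<close>; multiplication by \<open>zpow k\<close> maps tau-functions to tau-functions.
\<close>

end

(*
  Everything happens on finite bosons, since each coefficient of the generating series is a
  polynomial. Both fermion fields have the form R(u) exp(\<sigma> \<Sum> p_k u^k / k) exp(- \<sigma> \<Sum> \<partial>_k u^-k) with
  \<sigma> = 1 or \<sigma> = -1, and commuting the exponentials past each other gives the canonical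
  anticommutation relations. They imply that applying a combination of the modes of \<psi>^+ preserves
  the bilinear equation. Commuting \<psi>^+(u_l) past the factors H(u_1), ..., H(u_(l-1)) shows that T_\<alpha>
  arises from T_\<alpha>' (one variable less) by such a combination, so T_\<alpha> is a tau-function.
  Conversely, as long as some \<psi>^-_y with y above a cutoff does not kill \<tau>, the bilinear equation
  provides a combination X of modes of \<psi>^+ with \<tau> = X \<psi>^-_y \<tau>; after finitely many such steps only
  a vacuum c z^K is left, and reading the steps backwards gives \<tau> as a zero mode up to a monomial.
*)

theory Submission
  imports Defs
begin


text \<open>Exponentials are handled through one recursion: u d/du exp X = (u d/du X) exp X
  expresses n times the n-th coefficient by earlier ones, and since a positive integer can be
  cancelled in \<open>boson\<close>, it determines the series. Inverses, products and commutators of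
  exponentials become verifications of this recursion. Sums over all modes are finite because exp(-
  \<sigma> \<Sum> \<partial>_k u^-k) f is a polynomial in u^-1 for every finite boson f. The
  generating series is built into \<psi>^+(u): its derivative part turns H(v) into (1 - v/u) H(v),
  the power u^m that R^+ contributes clears the denominators and leaves the factors u - v, and the
  sign of R^+ counts the entries that \<epsilon> counts. In the converse one bound N has to survive
  the whole induction. It does, because \<psi>^-_y with y < N anticommutes with every \<psi>^+_x
  with x < -N (indices are powers of u). Once a monomial is pulled out, the modes of negative index
  in X kill the remaining zero mode, so the non-positive powers of a Laurent polynomial capture all
  of X.\<close>

abbreviation lookup :: "('a \<Rightarrow>\<^sub>0 'b::zero) \<Rightarrow> 'a \<Rightarrow> 'b" where "lookup \<equiv> Poly_Mapping.lookup"
abbreviation single :: "'a \<Rightarrow> 'b \<Rightarrow> 'a \<Rightarrow>\<^sub>0 'b::zero" where "single \<equiv> Poly_Mapping.single"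
abbreviation keys :: "('a \<Rightarrow>\<^sub>0 'b::zero) \<Rightarrow> 'a set" where "keys \<equiv> Poly_Mapping.keys"

section \<open>Bosons and linear operators\<close>

lemma bconst_add: "bconst (c + d) = bconst c + bconst d"
  by (simp add: bconst_def single_add)

lemma bconst_mult: "bconst (c * d) = bconst c * bconst d"
  by (simp add: bconst_def mult_single)

lemma bconst_0 [simp]: "bconst 0 = 0"
  by (simp add: bconst_def)

lemma bconst_1 [simp]: "bconst 1 = 1"
  by (simp add: bconst_def)

lemma bconst_uminus: "bconst (- c) = - bconst c"
  by (simp add: bconst_def single_uminus)

lemma bconst_of_nat: "bconst (of_nat n) = of_nat n"
  by (simp add: bconst_def)

lemma bconst_of_int: "bconst (of_int n) = of_int n"
  by (simp add: bconst_def)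

lemma bconst_sum: "bconst (sum f A) = (\<Sum>x\<in>A. bconst (f x))"
  by (induction A rule: infinite_finite_induct) (auto simp: bconst_add)

lemma lookup_bconst_mult [simp]: "lookup (bconst c * f) b = c * lookup f b"
  unfolding bconst_def mult_map_scale_conv_mult[symmetric]
  by (simp add: Poly_Mapping.map.rep_eq when_def)

lemma single_eq_bconst_mult: "single b c = bconst c * single b 1"
  by (simp add: bconst_def mult_single)

text \<open>The recursions for exponentials determine only \<open>n\<close> times a coefficient; the
  constant 1/n in \<open>boson\<close> removes the factor.\<close>

lemma of_nat_mult_cancel_boson:
  assumes "of_nat n * x = of_nat n * (y :: boson)" "n > 0"
  shows "x = y"
proof -
  have "bconst (1 / of_nat n) * (of_nat n * x) = bconst (1 / of_nat n) * (of_nat n * y)"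
    using assms by simp
  then show ?thesis
    using assms(2) by (simp add: bconst_of_nat[symmetric] mult.assoc[symmetric] bconst_mult[symmetric])
qed

lemma boson_sum_single: "(f :: boson) = (\<Sum>b\<in>keys f. single b (lookup f b))"
  by (rule poly_mapping_eqI) (auto simp: lookup_sum lookup_single when_def in_keys_iff)

text \<open>Scalars enter as multiplication by \<open>bconst c\<close>, so that complex linearity
  can be used by rewriting in the ring \<open>boson\<close>.\<close>

definition boson_linear :: "(boson \<Rightarrow> boson) \<Rightarrow> bool" where
  "boson_linear L \<longleftrightarrow> (\<forall>f g. L (f + g) = L f + L g) \<and> (\<forall>c f. L (bconst c * f) = bconst c * L f)"

lemma boson_linearI:
  assumes "\<And>f g. L (f + g) = L f + L g" "\<And>c f. L (bconst c * f) = bconst c * L f"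
  shows "boson_linear L"
  using assms unfolding boson_linear_def by blast

lemma boson_linear_add: "boson_linear L \<Longrightarrow> L (f + g) = L f + L g"
  unfolding boson_linear_def by blast

lemma boson_linear_scale: "boson_linear L \<Longrightarrow> L (bconst c * f) = bconst c * L f"
  unfolding boson_linear_def by blast

lemma boson_linear_0: "boson_linear L \<Longrightarrow> L 0 = 0"
  using boson_linear_scale[of L 0 0] by simp

lemma boson_linear_uminus: "boson_linear L \<Longrightarrow> L (- f) = - L f"
  using boson_linear_scale[of L "-1" f] by (simp add: bconst_uminus)

lemma boson_linear_diff: "boson_linear L \<Longrightarrow> L (f - g) = L f - L g"
  using boson_linear_add[of L f "- g"] by (simp add: boson_linear_uminus)

lemma boson_linear_sum: "boson_linear L \<Longrightarrow> L (sum f A) = (\<Sum>x\<in>A. L (f x))"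
  by (induction A rule: infinite_finite_induct) (auto simp: boson_linear_add boson_linear_0)

lemma boson_linear_of_nat: "boson_linear L \<Longrightarrow> L (of_nat n * f) = of_nat n * L f"
  using boson_linear_scale[of L "of_nat n"] by (simp add: bconst_of_nat)

lemma boson_linear_single: "boson_linear L \<Longrightarrow> L (single b c) = bconst c * L (single b 1)"
  by (metis boson_linear_scale single_eq_bconst_mult)

lemma boson_linear_id: "boson_linear (\<lambda>f. f)"
  by (rule boson_linearI) auto

lemma boson_linear_zero: "boson_linear (\<lambda>f. 0)"
  by (rule boson_linearI) auto

lemma boson_linear_compose:
  "boson_linear L \<Longrightarrow> boson_linear M \<Longrightarrow> boson_linear (\<lambda>f. L (M f))"
  by (rule boson_linearI) (auto simp: boson_linear_add boson_linear_scale)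

lemma boson_linear_mult: "boson_linear L \<Longrightarrow> boson_linear (\<lambda>f. P * L f)"
  by (rule boson_linearI) (auto simp: boson_linear_add boson_linear_scale distrib_left mult.left_commute)

lemma boson_linear_plus:
  "boson_linear L \<Longrightarrow> boson_linear M \<Longrightarrow> boson_linear (\<lambda>f. L f + M f)"
  by (rule boson_linearI) (auto simp: boson_linear_add boson_linear_scale distrib_left add_ac)

lemma boson_linear_setsum:
  "(\<And>i. i \<in> A \<Longrightarrow> boson_linear (L i)) \<Longrightarrow> boson_linear (\<lambda>f. \<Sum>i\<in>A. L i f)"
  by (induction A rule: infinite_finite_induct) (auto intro: boson_linear_zero boson_linear_plus)

lemma boson_linear_eqI:
  assumes "boson_linear L" "boson_linear M" "\<And>b. L (single b 1) = M (single b 1)"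
  shows "L f = M f"
proof -
  have "L (single b c) = M (single b c)" for b c
    by (metis assms boson_linear_single)
  then have "L (\<Sum>b\<in>keys f. single b (lookup f b)) = M (\<Sum>b\<in>keys f. single b (lookup f b))"
    by (simp add: boson_linear_sum assms)
  then show ?thesis unfolding boson_sum_single[of f, symmetric] .
qed

lemma lookup_single_mult:
  "lookup (single c 1 * (f :: boson)) b = (\<Sum>d\<in>keys f. lookup f d when b = c + d)"
proof -
  have "single c 1 * f = (\<Sum>d\<in>keys f. single (c + d) (lookup f d))"
    by (subst boson_sum_single[of f]) (simp add: sum_distrib_left mult_single)
  then show ?thesis by (auto simp: lookup_sum lookup_single when_def intro!: sum.cong)
qed

section \<open>Partial derivatives\<close>

definition pd :: "nat \<Rightarrow> nat \<Rightarrow> boson \<Rightarrow> boson" where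
  "pd a k f = Abs_poly_mapping (pderiv_op a k (lookup f))"

text \<open>\<open>pderiv_op\<close> reads its argument at a shifted exponent, and the shift is
  injective, so finite support is preserved and \<open>Abs_poly_mapping\<close> loses
  nothing.\<close>

lemma lookup_pd: "lookup (pd a k f) = pderiv_op a k (lookup f)"
proof -
  let ?s = "\<lambda>(n, \<mu>). (n, \<mu> + single (a, k) (1::nat)) :: fock_basis"
  have "inj ?s" by (rule injI) (auto split: prod.splits)
  then have "finite (?s -` keys f)" by (intro finite_vimageI) auto
  moreover have "{b. pderiv_op a k (lookup f) b \<noteq> 0} \<subseteq> ?s -` keys f"
    by (auto simp: pderiv_op_def in_keys_iff)
  ultimately show ?thesis unfolding pd_def by (simp add: finite_subset)
qed

lemma lookup_pd': "lookup (pd a k f) (n, \<mu>) =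
    of_nat (lookup \<mu> (a, k) + 1) * lookup f (n, \<mu> + single (a, k) 1)"
  by (simp add: lookup_pd pderiv_op_def)

lemma boson_linear_pd: "boson_linear (pd a k)"
  by (rule boson_linearI; rule poly_mapping_eqI)
     (simp_all add: lookup_pd lookup_add pderiv_op_def distrib_left mult.left_commute split: prod.splits)

lemmas pd_linear_scale = boson_linear_scale[OF boson_linear_pd]

lemma pd_0 [simp]: "pd a k 0 = 0"
  by (rule boson_linear_0[OF boson_linear_pd])

lemma exponent_split:
  assumes "lookup \<mu> x \<noteq> (0::nat)"
  obtains \<nu> where "\<mu> = \<nu> + single x 1"
proof
  show "\<mu> = (\<mu> - single x 1) + single x 1"
    using assms by (intro poly_mapping_eqI) (auto simp: lookup_add lookup_minus lookup_single when_def)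
qed

lemma pd_single:
  "pd a k (single (n, \<mu>) c) = (if lookup \<mu> (a, k) = 0 then 0
     else single (n, \<mu> - single (a, k) 1) (of_nat (lookup \<mu> (a, k)) * c))"
proof (cases "lookup \<mu> (a, k) = 0")
  case True
  have "\<mu> \<noteq> \<nu> + single (a, k) 1" for \<nu>
    using True by (auto simp: lookup_add)
  then show ?thesis using True
    by (intro poly_mapping_eqI) (simp add: lookup_pd pderiv_op_def lookup_single when_def split: prod.splits)
next
  case False
  then obtain \<nu> where \<nu>: "\<mu> = \<nu> + single (a, k) 1" by (rule exponent_split)
  show ?thesis unfolding \<nu>
    by (intro poly_mapping_eqI)
       (auto simp: lookup_pd pderiv_op_def lookup_single when_def lookup_add split: if_splits)
qed

text \<open>Both sides are bilinear, so pairs of basis vectors suffice. The case split there is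
  forced by the truncated subtraction of exponents.\<close>

lemma pd_mult: "pd a k (f * g) = pd a k f * g + f * pd a k g"
proof -
  have sing: "pd a k (single b 1 * single d 1) =
      pd a k (single b 1) * single d 1 + single b 1 * pd a k (single d 1)" for b d :: fock_basis
  proof -
    obtain n \<mu> where b: "b = (n, \<mu>)" by (cases b)
    obtain m \<nu> where d: "d = (m, \<nu>)" by (cases d)
    show ?thesis
    proof (cases "lookup \<mu> (a, k) = 0")
      case True
      show ?thesis
      proof (cases "lookup \<nu> (a, k) = 0")
        case True
        with \<open>lookup \<mu> (a, k) = 0\<close> show ?thesis
          by (simp add: b d mult_single pd_single lookup_add)
      next
        case False
        then obtain \<nu>' where "\<nu> = \<nu>' + single (a, k) 1" by (rule exponent_split)
        with True show ?thesis
          by (simp add: b d mult_single pd_single lookup_add add.assoc[symmetric])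
      qed
    next
      case False
      then obtain \<mu>' where \<mu>': "\<mu> = \<mu>' + single (a, k) 1" by (rule exponent_split)
      show ?thesis
      proof (cases "lookup \<nu> (a, k) = 0")
        case True
        moreover have "\<mu>' + single (a, k) 1 + \<nu> - single (a, k) (Suc 0) = \<mu>' + \<nu>"
          by (intro poly_mapping_eqI) (simp add: lookup_add lookup_minus)
        ultimately show ?thesis
          by (simp add: b d \<mu>' mult_single pd_single lookup_add)
      next
        case False
        then obtain \<nu>' where \<nu>': "\<nu> = \<nu>' + single (a, k) 1" by (rule exponent_split)
        have "\<mu>' + single (a, k) 1 + (\<nu>' + single (a, k) 1) - single (a, k) (Suc 0)
            = \<mu>' + single (a, k) 1 + \<nu>'"
          by (intro poly_mapping_eqI) (simp add: lookup_add lookup_minus)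
        then show ?thesis
          by (simp add: b d \<mu>' \<nu>' mult_single pd_single lookup_add add_ac single_add[symmetric])
      qed
    qed
  qed
  note lin = boson_linear_add[OF boson_linear_pd] pd_linear_scale
  have 1: "pd a k (single b 1 * g) = pd a k (single b 1) * g + single b 1 * pd a k g" for b g
    by (rule boson_linear_eqI[where f = g]; (rule boson_linearI)?)
       (simp_all only: lin distrib_left mult.left_commute[of _ "bconst _"] sing add_ac)
  show ?thesis
    by (rule boson_linear_eqI[where f = f]; (rule boson_linearI)?)
       (simp_all only: lin distrib_left distrib_right mult.assoc 1 add_ac)
qed

lemma pd_commute: "pd a k (pd b j f) = pd b j (pd a k f)"
  by (intro poly_mapping_eqI)
     (auto simp: lookup_pd pderiv_op_def lookup_add lookup_single when_def add_ac split: prod.splits)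

lemma pd_bconst [simp]: "pd a k (bconst c) = 0"
  by (simp add: bconst_def zero_prod_def pd_single)

lemma pd_1 [simp]: "pd a k 1 = 0"
  using pd_bconst[of a k 1] by simp

lemma pd_zpow [simp]: "pd a k (zpow n) = 0"
  by (simp add: zpow_def pd_single)

lemma pd_pvar: "pd a k (pvar b j) = (if a = b \<and> k = j then 1 else 0)"
  by (auto simp: pvar_def pd_single lookup_single when_def zero_prod_def single_one[symmetric]
      simp del: single_one)

section \<open>Coefficients of exponential series\<close>

text \<open>\<open>exp_pow D v k n\<close> is the coefficient of \<open>t\<^sup>n\<close> in \<open>(\<Sum>\<^sub>j D\<^sub>j t\<^sup>j)\<^sup>k v\<close>.\<close>

primrec exp_pow :: "(nat \<Rightarrow> boson \<Rightarrow> boson) \<Rightarrow> boson \<Rightarrow> nat \<Rightarrow> nat \<Rightarrow> boson" where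
  "exp_pow D v 0 n = (if n = 0 then v else 0)"
| "exp_pow D v (Suc k) n = (\<Sum>j=1..n. D j (exp_pow D v k (n - j)))"

definition exp_coeff :: "(nat \<Rightarrow> boson \<Rightarrow> boson) \<Rightarrow> boson \<Rightarrow> nat \<Rightarrow> boson" where
  "exp_coeff D v n = (\<Sum>k\<le>n. bconst (1 / fact k) * exp_pow D v k n)"

text \<open>Linearity of each operator is included: together these are the conditions under which
  the series behaves like the exponential of commuting variables.\<close>

definition commuting :: "(nat \<Rightarrow> boson \<Rightarrow> boson) \<Rightarrow> bool" where
  "commuting D \<longleftrightarrow> (\<forall>j. boson_linear (D j)) \<and> (\<forall>i j f. D i (D j f) = D j (D i f))"

lemma exp_coeff_0 [simp]: "exp_coeff D v 0 = v"
  by (simp add: exp_coeff_def)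

lemma sum_triangle_swap:
  "(\<Sum>j=1..n::nat. \<Sum>i=1..n-j. F i j) = (\<Sum>i=1..n. \<Sum>j=1..n-i. F i j :: 'a::comm_monoid_add)"
  by (simp add: sum.Sigma, rule sum.reindex_bij_witness[of _ prod.swap prod.swap]) auto

lemma of_nat_mult_split:
  "i \<le> n \<Longrightarrow> of_nat n * x = of_nat i * x + of_nat (n - i) * (x :: 'a::semiring_1)"
  by (metis le_add_diff_inverse of_nat_add distrib_right)

text \<open>Each of the \<open>k\<close> factors has order at least 1 in t. Hence cutting the
  exponential sum off at \<open>k = n\<close> in \<open>exp_coeff\<close> loses no term.\<close>

lemma exp_pow_eq_0:
  assumes "commuting D" "k > n"
  shows "exp_pow D v k n = 0"
  using assms(2)
proof (induction k arbitrary: n)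
  case (Suc k)
  have "exp_pow D v k (n - j) = 0" if "j \<in> {1..n}" for j
    using Suc that by (intro Suc.IH) auto
  then show ?case using assms(1) by (simp add: commuting_def boson_linear_0)
qed simp

text \<open>This is the power rule \<open>t d/dt X\<^sup>k\<^sup>+\<^sup>1 = (k + 1) (t d/dt X) X\<^sup>k\<close>.\<close>

lemma exp_pow_deriv:
  assumes D: "commuting D"
  shows "of_nat n * exp_pow D v (Suc k) n
    = of_nat (Suc k) * (\<Sum>j=1..n. of_nat j * D j (exp_pow D v k (n - j)))"
proof (induction k arbitrary: n)
  case 0
  have "of_nat n * D j (exp_pow D v 0 (n - j)) = of_nat j * D j (exp_pow D v 0 (n - j))"
    if "j \<in> {1..n}" for j
  proof (cases "j = n")
    case False
    then have "exp_pow D v 0 (n - j) = 0" using that by auto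
    then show ?thesis using D by (simp only: commuting_def boson_linear_0 mult_zero_right)
  qed simp
  then show ?case by (simp add: sum_distrib_left)
next
  case (Suc k)
  have lin: "boson_linear (D j)" for j using D by (simp add: commuting_def)
  have com: "D i (D j f) = D j (D i f)" for i j f using D unfolding commuting_def by blast
  let ?Y = "exp_pow D v"
  let ?S = "\<Sum>j=1..n. of_nat j * D j (?Y (Suc k) (n - j))"
  have "of_nat n * ?Y (Suc (Suc k)) n = (\<Sum>j=1..n. of_nat n * D j (?Y (Suc k) (n - j)))"
    by (simp only: exp_pow.simps(2)[of D v "Suc k"] sum_distrib_left)
  \<comment> \<open>The weight n is split as j for the outer factor plus n - j for the rest, where
    the induction hypothesis applies.\<close>
  also have "\<dots> = (\<Sum>j=1..n. of_nat j * D j (?Y (Suc k) (n - j))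
      + D j (of_nat (n - j) * ?Y (Suc k) (n - j)))"
  proof (rule sum.cong[OF refl])
    fix j assume j: "j \<in> {1..n}"
    then have "(of_nat n :: boson) = of_nat j + of_nat (n - j)"
      by (metis atLeastAtMost_iff le_add_diff_inverse of_nat_add)
    then show "of_nat n * D j (?Y (Suc k) (n - j)) = of_nat j * D j (?Y (Suc k) (n - j))
      + D j (of_nat (n - j) * ?Y (Suc k) (n - j))"
      by (simp only: boson_linear_of_nat[OF lin] distrib_right)
  qed
  also have "\<dots> = ?S + (\<Sum>j=1..n. D j (of_nat (Suc k) *
      (\<Sum>i=1..n - j. of_nat i * D i (?Y k (n - j - i)))))"
    by (simp only: sum.distrib Suc.IH)
  also have "(\<Sum>j=1..n. D j (of_nat (Suc k) * (\<Sum>i=1..n - j. of_nat i * D i (?Y k (n - j - i)))))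
     = of_nat (Suc k) * (\<Sum>j=1..n. \<Sum>i=1..n - j. of_nat i * D i (D j (?Y k (n - j - i))))"
    by (simp only: boson_linear_of_nat[OF lin] boson_linear_sum[OF lin] sum_distrib_left com)
  also have "(\<Sum>j=1..n. \<Sum>i=1..n - j. of_nat i * D i (D j (?Y k (n - j - i)))) =
     (\<Sum>i=1..n. \<Sum>j=1..n - i. of_nat i * D i (D j (?Y k (n - i - j))))"
    by (subst sum_triangle_swap) (simp add: diff_commute add.commute)
  also have "\<dots> = ?S"
    by (simp only: exp_pow.simps(2)[of D v k] boson_linear_sum[OF lin] sum_distrib_left)
  also have "?S + of_nat (Suc k) * ?S = of_nat (Suc (Suc k)) * ?S"
    by (simp add: algebra_simps)
  finally show ?case .
qed

text \<open>The coefficient form of t d/dt exp X = (t d/dt X) exp X, obtained by summing the power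
  rule with the weights 1/k!.\<close>

lemma exp_coeff_rec:
  assumes D: "commuting D"
  shows "of_nat n * exp_coeff D v n = (\<Sum>j=1..n. of_nat j * D j (exp_coeff D v (n - j)))"
proof (cases n)
  case (Suc m)
  have lin: "boson_linear (D j)" for j using D by (simp add: commuting_def)
  let ?Y = "exp_pow D v"
  have "of_nat n * exp_coeff D v n = (\<Sum>k\<le>Suc m. bconst (1 / fact k) * (of_nat n * ?Y k n))"
    by (simp only: exp_coeff_def sum_distrib_left Suc mult.left_commute[of "of_nat _"])
  also have "\<dots> = (\<Sum>k\<le>m. bconst (1 / fact (Suc k)) * (of_nat n * ?Y (Suc k) n))"
    by (subst sum.atMost_Suc_shift) (simp add: Suc)
  also have "\<dots> = (\<Sum>k\<le>m. bconst (1 / fact k) * (\<Sum>j=1..n. of_nat j * D j (?Y k (n - j))))"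
  proof (rule sum.cong[OF refl])
    fix k
    have "bconst (1 / fact (Suc k)) * (of_nat (Suc k) * x) = bconst (1 / fact k) * x" for x
      by (simp only: mult.assoc[symmetric] bconst_of_nat[symmetric] bconst_mult[symmetric])
         (simp add: divide_simps of_nat_Suc[symmetric] del: of_nat_Suc)
    then show "bconst (1 / fact (Suc k)) * (of_nat n * ?Y (Suc k) n)
       = bconst (1 / fact k) * (\<Sum>j=1..n. of_nat j * D j (?Y k (n - j)))"
      by (simp only: exp_pow_deriv[OF D])
  qed
  also have "\<dots> = (\<Sum>j=1..n. of_nat j * D j (\<Sum>k\<le>m. bconst (1 / fact k) * ?Y k (n - j)))"
    by (simp add: boson_linear_sum[OF lin] boson_linear_scale[OF lin] sum_distrib_left
        sum.swap[of _ "{..m}"] mult.left_commute)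
  also have "\<dots> = (\<Sum>j=1..n. of_nat j * D j (exp_coeff D v (n - j)))"
  proof (rule sum.cong[OF refl])
    fix j assume j: "j \<in> {1..n}"
    have "(\<Sum>k\<le>m. bconst (1 / fact k) * ?Y k (n - j)) = exp_coeff D v (n - j)"
      unfolding exp_coeff_def
      using j Suc by (intro sum.mono_neutral_right) (auto simp: exp_pow_eq_0[OF D])
    then show "of_nat j * D j (\<Sum>k\<le>m. bconst (1 / fact k) * ?Y k (n - j))
       = of_nat j * D j (exp_coeff D v (n - j))" by simp
  qed
  finally show ?thesis .
qed simp

text \<open>Since n can be cancelled, the recursion and the initial value leave no freedom. Most
  identities for exponentials below are proved by guessing the coefficients and checking the
  recursion.\<close>

lemma exp_coeff_unique:
  assumes D: "commuting D" and "E 0 = v"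
    and "\<And>n. n > 0 \<Longrightarrow> of_nat n * E n = (\<Sum>j=1..n. of_nat j * D j (E (n - j)))"
  shows "E n = exp_coeff D v n"
proof (induction n rule: less_induct)
  case (less n)
  show ?case
  proof (cases "n = 0")
    case False
    have "of_nat n * E n = of_nat n * exp_coeff D v n"
      using less False by (simp add: assms(3) exp_coeff_rec[OF D])
    then show ?thesis by (rule of_nat_mult_cancel_boson) (use False in simp)
  qed (use assms in simp)
qed

lemma boson_linear_exp_coeff:
  assumes "commuting D"
  shows "boson_linear (\<lambda>v. exp_coeff D v n)"
proof -
  have "boson_linear (\<lambda>v. exp_pow D v k m)" for k m
  proof (induction k arbitrary: m)
    case 0
    show ?case by (cases "m = 0") (auto intro: boson_linear_id boson_linear_zero)
  next
    case (Suc k)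
    have "boson_linear (\<lambda>v. D j (exp_pow D v k (m - j)))" for j
      using assms boson_linear_compose[OF _ Suc, of "D j"] by (simp add: commuting_def)
    then show ?case by (simp add: boson_linear_setsum)
  qed
  then show ?thesis unfolding exp_coeff_def
    by (intro boson_linear_setsum boson_linear_mult[of "\<lambda>v. exp_pow D v _ _"])
qed

text \<open>Applying \<open>M\<close> to the recursion for \<open>v\<close> gives the recursion for
  \<open>M v\<close>. The index 0 is left out because \<open>D 0\<close> never enters the
  series.\<close>

lemma exp_coeff_intertwine:
  assumes D: "commuting D" and M: "boson_linear M"
    and com: "\<And>j f. j \<ge> 1 \<Longrightarrow> M (D j f) = D j (M f)"
  shows "M (exp_coeff D v n) = exp_coeff D (M v) n"
proof (rule exp_coeff_unique[OF D])
  fix n :: nat assume "n > 0"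
  have "of_nat n * M (exp_coeff D v n) = M (of_nat n * exp_coeff D v n)"
    by (simp add: boson_linear_of_nat[OF M])
  also have "\<dots> = (\<Sum>j=1..n. of_nat j * D j (M (exp_coeff D v (n - j))))"
    by (simp add: exp_coeff_rec[OF D] boson_linear_sum[OF M] boson_linear_of_nat[OF M] com)
  finally show "of_nat n * M (exp_coeff D v n) = (\<Sum>j=1..n. of_nat j * D j (M (exp_coeff D v (n - j))))" .
qed simp

lemma exp_coeff_eq_0:
  assumes D: "commuting D" and "\<And>j. j \<ge> 1 \<Longrightarrow> D j v = 0" and "n > 0"
  shows "exp_coeff D v n = 0"
proof -
  have "D j (if n - j = 0 then v else 0) = 0" if "j \<ge> 1" for j n
    using assms(2)[OF that] D by (cases "n - j = 0") (simp_all only: commuting_def boson_linear_0 if_True if_False refl)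
  then have "(if n = 0 then v else 0) = exp_coeff D v n" for n
    by (intro exp_coeff_unique[OF D, where E = "\<lambda>n. if n = 0 then v else 0"]) simp_all
  then show ?thesis using assms(3) by (metis less_irrefl)
qed

text \<open>This is exp X exp(-X) = 1. The weight n is distributed as i and n - i over the two
  exponentials; the resulting double sums differ only by their sign, so n times the convolution is
  0.\<close>

lemma sum_exp_coeff_opposite:
  assumes D: "commuting D" and D': "\<And>j f. D' j f = - D j f"
  shows "(\<Sum>i\<le>n. exp_coeff D (exp_coeff D' v (n - i)) i) = (if n = 0 then v else 0)"
proof (cases "n = 0")
  case False
  have lin: "boson_linear (D j)" for j using D by (simp add: commuting_def)
  have com: "D i (D j f) = D j (D i f)" for i j f using D unfolding commuting_def by blast
  have D'_com: "commuting D'"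
    unfolding commuting_def D' using lin
    by (auto simp: boson_linear_uminus com intro!: boson_linearI
        simp: boson_linear_add boson_linear_scale)
  have inter: "exp_coeff D (D k x) i = D k (exp_coeff D x i)" for k x i
    by (rule exp_coeff_intertwine[of D "D k" x i, symmetric, OF D lin com])
  define W where "W i j = exp_coeff D (exp_coeff D' v j) i" for i j
  have 1: "of_nat i * W i j = (\<Sum>k=1..i. of_nat k * D k (W (i - k) j))" for i j
    unfolding W_def by (rule exp_coeff_rec[OF D])
  have 2: "of_nat j * W i j = - (\<Sum>k=1..j. of_nat k * D k (W i (j - k)))" for i j
  proof -
    have "of_nat j * W i j = exp_coeff D (of_nat j * exp_coeff D' v j) i"
      unfolding W_def by (simp add: boson_linear_of_nat[OF boson_linear_exp_coeff[OF D]])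
    also have "\<dots> = (\<Sum>k=1..j. - (of_nat k * exp_coeff D (D k (exp_coeff D' v (j - k))) i))"
      by (simp add: exp_coeff_rec[OF D'_com] boson_linear_sum[OF boson_linear_exp_coeff[OF D]] D'
          boson_linear_of_nat[OF boson_linear_exp_coeff[OF D]]
          boson_linear_uminus[OF boson_linear_exp_coeff[OF D]] sum_negf)
    also have "\<dots> = - (\<Sum>k=1..j. of_nat k * D k (W i (j - k)))"
      unfolding W_def by (simp add: inter sum_negf)
    finally show ?thesis .
  qed
  have "of_nat n * (\<Sum>i\<le>n. W i (n - i)) = (\<Sum>i\<le>n. of_nat i * W i (n - i) + of_nat (n - i) * W i (n - i))"
    unfolding sum_distrib_left by (rule sum.cong[OF refl], rule of_nat_mult_split) simp
  also have "\<dots> = (\<Sum>i\<le>n. \<Sum>k=1..i. of_nat k * D k (W (i - k) (n - i)))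
      - (\<Sum>i\<le>n. \<Sum>k=1..n - i. of_nat k * D k (W i (n - i - k)))"
    by (simp only: sum.distrib 1 2 sum_negf) simp
  also have "(\<Sum>i\<le>n. \<Sum>k=1..n - i. of_nat k * D k (W i (n - i - k)))
      = (\<Sum>i\<le>n. \<Sum>k=1..i. of_nat k * D k (W (i - k) (n - i)))"
    by (simp add: sum.Sigma,
        rule sum.reindex_bij_witness[of _ "\<lambda>(i, k). (i - k, k)" "\<lambda>(i, k). (i + k, k)"]) auto
  finally have "of_nat n * (\<Sum>i\<le>n. W i (n - i)) = of_nat n * 0" by simp
  then have "(\<Sum>i\<le>n. W i (n - i)) = 0"
    by (rule of_nat_mult_cancel_boson) (use False in simp)
  then show ?thesis using False by (simp add: W_def)
qed simp

text \<open>The exponential of a derivation is multiplicative: by the Leibniz rule the convolution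
  on the right satisfies the recursion of the left-hand side.\<close>

lemma exp_coeff_mult:
  assumes D: "commuting D" and leib: "\<And>j f g. D j (f * g) = D j f * g + f * D j g"
  shows "exp_coeff D (f * g) n = (\<Sum>i\<le>n. exp_coeff D f i * exp_coeff D g (n - i))"
proof (rule exp_coeff_unique[OF D, symmetric, where E = "\<lambda>n. \<Sum>i\<le>n. exp_coeff D f i * exp_coeff D g (n - i)"])
  fix n :: nat
  have lin: "boson_linear (D j)" for j using D by (simp add: commuting_def)
  let ?A = "exp_coeff D f" and ?B = "exp_coeff D g"
  have step: "?A i * (of_nat m * ?B m) = (\<Sum>j=1..m. of_nat j * (?A i * D j (?B (m - j))))" for i m
    unfolding exp_coeff_rec[OF D] sum_distrib_left by (rule sum.cong[OF refl], rule mult.left_commute)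
  have "of_nat n * (\<Sum>i\<le>n. ?A i * ?B (n - i)) =
      (\<Sum>i\<le>n. of_nat i * (?A i * ?B (n - i)) + of_nat (n - i) * (?A i * ?B (n - i)))"
    unfolding sum_distrib_left by (rule sum.cong[OF refl], rule of_nat_mult_split) simp
  also have "\<dots> = (\<Sum>i\<le>n. of_nat i * ?A i * ?B (n - i)) + (\<Sum>i\<le>n. ?A i * (of_nat (n - i) * ?B (n - i)))"
    by (simp only: sum.distrib mult.assoc mult.left_commute[of "of_nat (n - _)"])
  also have "(\<Sum>i\<le>n. of_nat i * ?A i * ?B (n - i)) =
      (\<Sum>i\<le>n. \<Sum>j=1..i. of_nat j * D j (?A (i - j)) * ?B (n - i))"
    by (simp add: exp_coeff_rec[OF D] sum_distrib_right)
  also have "\<dots> = (\<Sum>j=1..n. \<Sum>i\<le>n - j. of_nat j * D j (?A i) * ?B (n - j - i))"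
    by (simp add: sum.Sigma,
        rule sum.reindex_bij_witness[of _ "\<lambda>(j, i). (i + j, j)" "\<lambda>(i, j). (j, i - j)"]) auto
  also have "(\<Sum>i\<le>n. ?A i * (of_nat (n - i) * ?B (n - i))) =
      (\<Sum>i\<le>n. \<Sum>j=1..n - i. of_nat j * (?A i * D j (?B (n - i - j))))"
    by (rule sum.cong[OF refl], rule step)
  also have "\<dots> = (\<Sum>j=1..n. \<Sum>i\<le>n - j. of_nat j * (?A i * D j (?B (n - j - i))))"
    by (simp add: sum.Sigma,
        rule sum.reindex_bij_witness[of _ "\<lambda>(j, i). (i, j)" "\<lambda>(i, j). (j, i)"])
       (auto simp: add.commute)
  finally show "of_nat n * (\<Sum>i\<le>n. ?A i * ?B (n - i)) =
      (\<Sum>j=1..n. of_nat j * D j (\<Sum>i\<le>n - j. ?A i * ?B (n - j - i)))"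
    unfolding boson_linear_sum[OF lin] leib sum_distrib_left sum.distrib distrib_left mult.assoc .
qed simp


text \<open>Constants, monomials in z and the variables p generate the algebra. This suits the bound
  on \<open>Qc\<close>, which passes to sums and products.\<close>

lemma boson_induct [case_names const z p add mult]:
  assumes const: "\<And>c. P (bconst c)" and z: "\<And>n. P (zpow n)" and p: "\<And>a k. P (pvar a k)"
    and add: "\<And>f g. P f \<Longrightarrow> P g \<Longrightarrow> P (f + g)" and mult: "\<And>f g. P f \<Longrightarrow> P g \<Longrightarrow> P (f * g)"
  shows "P (f :: boson)"
proof -
  have power: "P (single (0, single x m) 1)" for x m
  proof (induction m)
    case 0
    show ?case using const[of 1] by (simp add: bconst_def zero_prod_def)
  next
    case (Suc m)
    have "single (0, single x (Suc m)) 1 = pvar (fst x) (snd x) * single (0, single x m) 1"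
      by (simp add: pvar_def mult_single single_add[symmetric])
    then show ?case using mult[OF p Suc] by simp
  qed
  have mono: "P (single (0, \<mu>) 1)" for \<mu>
  proof (induction \<mu> rule: Poly_Mapping.update_induct)
    case const
    show ?case using power[of undefined 0] by simp
  next
    case (update \<mu> x m)
    have "Poly_Mapping.update x m \<mu> = \<mu> + single x m"
      using update(1)
      by (intro poly_mapping_eqI) (auto simp: lookup_update lookup_add lookup_single when_def in_keys_iff)
    then have "single (0 :: nat \<Rightarrow>\<^sub>0 int, Poly_Mapping.update x m \<mu>) (1 :: complex) = single (0, \<mu>) 1 * single (0, single x m) 1"
      by (simp add: mult_single)
    then show ?case using mult[OF update(3) power[of x m]] by simp
  qed
  have sing: "P (single b c)" for b c
  proof -
    have "single b c = bconst c * (zpow (fst b) * single (0, snd b) 1)"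
      by (cases b) (simp add: bconst_def zpow_def mult_single)
    then show ?thesis by (simp add: mult const z mono)
  qed
  have "P (\<Sum>b\<in>B. single b (lookup f b))" if "finite B" for B
    using that by (induction B) (use const[of 0] in \<open>auto intro: add sing\<close>)
  from this[OF finite_keys, of f] show ?thesis
    unfolding boson_sum_single[of f, symmetric] .
qed

section \<open>The factors of the vertex operators\<close>

text \<open>
  For a sign \<open>\<sigma>\<close>, \<open>Gc \<sigma> a j\<close> is the coefficient of \<open>u\<^sup>j\<close> in \<open>exp (\<sigma> \<Sum> p\<^sub>k u\<^sup>k / k)\<close>, and
  \<open>Qc \<sigma> a i\<close> is the coefficient of \<open>u\<^sup>-\<^sup>i\<close> in \<open>exp (- \<sigma> \<Sum> \<partial>\<^sub>k u\<^sup>-\<^sup>k)\<close>. So \<open>\<sigma> = 1\<close> gives \<open>H(u)\<close> and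
  \<open>E\<^sup>\<bottom>(-u)\<close>, while \<open>\<sigma> = -1\<close> gives \<open>E(-u)\<close> and \<open>H\<^sup>\<bottom>(u)\<close>: both fermion fields are treated at once.
\<close>

definition gen_op :: "int \<Rightarrow> nat \<Rightarrow> nat \<Rightarrow> boson \<Rightarrow> boson" where
  "gen_op \<sigma> a k f = bconst (of_int \<sigma> / of_nat k) * pvar a k * f"

definition shift_op :: "int \<Rightarrow> nat \<Rightarrow> nat \<Rightarrow> boson \<Rightarrow> boson" where
  "shift_op \<sigma> a k f = bconst (- of_int \<sigma>) * pd a k f"

definition Gc :: "int \<Rightarrow> nat \<Rightarrow> int \<Rightarrow> boson" where
  "Gc \<sigma> a j = (if j < 0 then 0 else exp_coeff (gen_op \<sigma> a) 1 (nat j))"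

definition Qc :: "int \<Rightarrow> nat \<Rightarrow> int \<Rightarrow> boson \<Rightarrow> boson" where
  "Qc \<sigma> a i f = (if i < 0 then 0 else exp_coeff (shift_op \<sigma> a) f (nat i))"

lemma commuting_gen_op: "commuting (gen_op \<sigma> a)"
  unfolding commuting_def gen_op_def by (auto intro!: boson_linearI simp: algebra_simps)

lemma boson_linear_shift_op: "boson_linear (shift_op \<sigma> a k)"
  by (rule boson_linearI)
     (auto simp: shift_op_def boson_linear_add[OF boson_linear_pd] pd_linear_scale
       distrib_left mult.left_commute)

lemma shift_op_commute: "shift_op \<sigma> a i (shift_op \<rho> b j f) = shift_op \<rho> b j (shift_op \<sigma> a i f)"
  by (simp add: shift_op_def pd_linear_scale pd_commute[of a i b j] mult.left_commute)

lemma commuting_shift_op: "commuting (shift_op \<sigma> a)"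
  unfolding commuting_def using boson_linear_shift_op shift_op_commute by blast

lemma shift_op_mult: "shift_op \<sigma> a j (f * g) = shift_op \<sigma> a j f * g + f * shift_op \<sigma> a j g"
  by (simp add: shift_op_def pd_mult distrib_left mult_ac)

lemma Gc_neg [simp]: "j < 0 \<Longrightarrow> Gc \<sigma> a j = 0"
  by (simp add: Gc_def)

lemma Gc_0 [simp]: "Gc \<sigma> a 0 = 1"
  by (simp add: Gc_def)

lemma Qc_neg [simp]: "i < 0 \<Longrightarrow> Qc \<sigma> a i f = 0"
  by (simp add: Qc_def)

lemma Qc_0 [simp]: "Qc \<sigma> a 0 f = f"
  by (simp add: Qc_def)

lemma boson_linear_Qc: "boson_linear (Qc \<sigma> a i)"
proof (cases "i < 0")
  case True
  then show ?thesis using boson_linear_zero by (simp add: Qc_def[abs_def])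
next
  case False
  then show ?thesis using boson_linear_exp_coeff[OF commuting_shift_op, of \<sigma> a "nat i"]
    by (simp add: Qc_def[abs_def])
qed

lemmas Qc_linear_0 = boson_linear_0[OF boson_linear_Qc]
lemmas Qc_linear_sum = boson_linear_sum[OF boson_linear_Qc]

lemma Qc_intertwine:
  assumes "boson_linear M" "\<And>j f. j \<ge> 1 \<Longrightarrow> M (pd a j f) = pd a j (M f)"
  shows "M (Qc \<sigma> a i f) = Qc \<sigma> a i (M f)"
proof (cases "i < 0")
  case False
  have "M (shift_op \<sigma> a j f) = shift_op \<sigma> a j (M f)" if "j \<ge> 1" for j f
    using assms that by (simp add: shift_op_def boson_linear_scale)
  from exp_coeff_intertwine[of "shift_op \<sigma> a" M f "nat i", OF commuting_shift_op assms(1) this]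
  show ?thesis using False by (simp add: Qc_def)
qed (simp add: boson_linear_0 assms)

lemma pd_Qc: "pd b j (Qc \<sigma> a i f) = Qc \<sigma> a i (pd b j f)"
  by (rule Qc_intertwine[of "pd b j", OF boson_linear_pd]) (rule pd_commute)

lemma Qc_commute: "Qc \<rho> b j (Qc \<sigma> a i f) = Qc \<sigma> a i (Qc \<rho> b j f)"
  by (rule Qc_intertwine[of "Qc \<rho> b j", OF boson_linear_Qc]) (simp add: pd_Qc)

lemma Qc_mult_const:
  assumes "\<And>k. k \<ge> 1 \<Longrightarrow> pd a k P = 0"
  shows "Qc \<sigma> a i (P * f) = P * Qc \<sigma> a i f"
proof (rule Qc_intertwine[of "\<lambda>f. P * f", symmetric])
  show "boson_linear (\<lambda>f. P * f)" using boson_linear_mult[OF boson_linear_id] .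
  show "P * pd a j f = pd a j (P * f)" if "j \<ge> 1" for j f
    using assms that by (simp add: pd_mult)
qed

lemma Qc_zpow_mult: "Qc \<sigma> a i (zpow n * f) = zpow n * Qc \<sigma> a i f"
  by (rule Qc_mult_const) simp

lemma Qc_eq_0:
  assumes "\<And>k. k \<ge> 1 \<Longrightarrow> pd a k P = 0" "i \<noteq> 0"
  shows "Qc \<sigma> a i P = 0"
proof (cases "i < 0")
  case False
  then show ?thesis using assms
    by (simp add: Qc_def exp_coeff_eq_0[OF commuting_shift_op] shift_op_def)
qed simp

lemma Qc_mult:
  "Qc \<sigma> a (int n) (f * g) = (\<Sum>i\<le>n. Qc \<sigma> a (int i) f * Qc \<sigma> a (int n - int i) g)"
  unfolding Qc_def
  by (simp add: exp_coeff_mult[OF commuting_shift_op shift_op_mult] nat_diff_distrib' flip: of_nat_diff)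

text \<open>In contrast to \<open>exp_coeff_rec\<close> the derivative acts on \<open>f\<close>
  before the exponential, which is possible because the derivatives commute.\<close>

lemma Qc_rec:
  "of_nat n * Qc \<sigma> a (int n) f = (\<Sum>j=1..n. of_nat j * Qc \<sigma> a (int (n - j)) (shift_op \<sigma> a j f))"
proof -
  have "exp_coeff (shift_op \<sigma> a) (shift_op \<sigma> a j f) m = shift_op \<sigma> a j (exp_coeff (shift_op \<sigma> a) f m)" for j m
    by (rule exp_coeff_intertwine[of _ "shift_op \<sigma> a j", symmetric, OF commuting_shift_op boson_linear_shift_op])
       (rule shift_op_commute)
  then show ?thesis
    using exp_coeff_rec[OF commuting_shift_op, of n \<sigma> a f]
    by (auto simp: Qc_def nat_diff_distrib' intro!: sum.cong)
qed

text \<open>The derivative parts of \<psi>^+ and \<psi>^- are inverse to each other, E^perp(-u)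
  H^perp(u) = 1.\<close>

lemma Qc_opposite:
  "(\<Sum>i\<le>n. Qc \<sigma> a (int i) (Qc (- \<sigma>) a (int n - int i) f)) = (if n = 0 then f else 0)"
proof -
  have "shift_op (- \<sigma>) a j f = - shift_op \<sigma> a j f" for j f
    by (simp add: shift_op_def bconst_uminus)
  from sum_exp_coeff_opposite[OF commuting_shift_op this, where n = n and v = f] show ?thesis
    by (simp add: Qc_def nat_diff_distrib')
qed

text \<open>The source of all finiteness of mode sums. A variable p_k is shifted only in degree k,
  and for products the bounds add, since the index is distributed over the two factors.\<close>

lemma Qc_bounded: "\<exists>n. \<forall>\<sigma> a i. i > n \<longrightarrow> Qc \<sigma> a i f = 0"
proof (induction f rule: boson_induct)
  case (const c)
  show ?case by (rule exI[of _ 0]) (simp add: Qc_eq_0)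
next
  case (z n)
  show ?case by (rule exI[of _ 0]) (simp add: Qc_eq_0)
next
  case (p b k)
  have "Qc \<sigma> a i (pvar b k) = 0" if i: "i > int k" for \<sigma> a i
  proof -
    \<comment> \<open>In the recursion for i > k, the term j = i contains \<partial>_i p_k = 0. For
      j < i the derivative is a constant, which \<open>Qc\<close> with positive index i - j
      kills.\<close>
    have "of_nat (nat i) * Qc \<sigma> a (int (nat i)) (pvar b k) = of_nat (nat i) * 0"
      unfolding Qc_rec mult_zero_right
    proof (rule sum.neutral, rule ballI)
      fix j assume j: "j \<in> {1..nat i}"
      show "of_nat j * Qc \<sigma> a (int (nat i - j)) (shift_op \<sigma> a j (pvar b k)) = 0"
      proof (cases "j = nat i")
        case True
        then have "j \<noteq> k" using i by auto
        then show ?thesis using i by (simp add: shift_op_def pd_pvar Qc_linear_0)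
      next
        case False
        then show ?thesis using i j
          by (subst Qc_eq_0) (auto simp: shift_op_def pd_pvar)
      qed
    qed
    then have "Qc \<sigma> a (int (nat i)) (pvar b k) = 0"
      by (rule of_nat_mult_cancel_boson) (use i in simp)
    then show ?thesis using i by simp
  qed
  then show ?case by blast
next
  case (add f g)
  then obtain n m where n: "\<And>\<sigma> a i. i > n \<Longrightarrow> Qc \<sigma> a i f = 0"
    and m: "\<And>\<sigma> a i. i > m \<Longrightarrow> Qc \<sigma> a i g = 0" by blast
  show ?case
    by (rule exI[of _ "max n m"]) (simp add: boson_linear_add[OF boson_linear_Qc] n m)
next
  case (mult f g)
  then obtain n m where n: "\<And>\<sigma> a i. i > n \<Longrightarrow> Qc \<sigma> a i f = 0"
    and m: "\<And>\<sigma> a i. i > m \<Longrightarrow> Qc \<sigma> a i g = 0" by blast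
  have "Qc \<sigma> a i (f * g) = 0" if i: "i > max 0 (n + m)" for \<sigma> a i
  proof -
    have "Qc \<sigma> a (int j) f * Qc \<sigma> a (i - int j) g = 0" for j
      using n[of "int j"] m[of "i - int j"] i by (cases "int j > n") auto
    then have "Qc \<sigma> a (int (nat i)) (f * g) = 0"
      unfolding Qc_mult using i by (intro sum.neutral) simp
    then show ?thesis using i by simp
  qed
  then show ?case by blast
qed

section \<open>The coefficients of H(u) and E(-u)\<close>

lemma Gc_nat: "Gc \<sigma> a (int n) = exp_coeff (gen_op \<sigma> a) 1 n"
  by (simp add: Gc_def)

lemma gen_op_of_nat: "j \<ge> 1 \<Longrightarrow> of_nat j * gen_op \<sigma> a j f = bconst (of_int \<sigma>) * (pvar a j * f)"
proof -
  assume "j \<ge> 1"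
  then have "of_nat j * bconst (of_int \<sigma> / of_nat j) = bconst (of_int \<sigma>)"
    by (simp flip: bconst_of_nat bconst_mult)
  then show ?thesis by (simp add: gen_op_def mult.assoc[symmetric])
qed

text \<open>Newton's identities: for \<sigma> = 1 they read n h_n = \<Sum> p_j h_(n-j), for \<sigma>
  = -1 they concern (-1)^n e_n.\<close>

lemma Gc_rec:
  "of_nat n * Gc \<sigma> a (int n) = bconst (of_int \<sigma>) * (\<Sum>j=1..n. pvar a j * Gc \<sigma> a (int n - int j))"
proof -
  have "of_nat n * Gc \<sigma> a (int n) = (\<Sum>j=1..n. of_nat j * gen_op \<sigma> a j (Gc \<sigma> a (int (n - j))))"
    unfolding Gc_nat by (rule exp_coeff_rec[OF commuting_gen_op])
  also have "\<dots> = (\<Sum>j=1..n. bconst (of_int \<sigma>) * (pvar a j * Gc \<sigma> a (int n - int j)))"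
    by (rule sum.cong[OF refl]) (simp only: atLeastAtMost_iff gen_op_of_nat of_nat_diff)
  finally show ?thesis by (simp only: sum_distrib_left)
qed

text \<open>The coefficient form of \<partial>_k exp(\<sigma> \<Sum> p_j u^j / j) = (\<sigma> u^k /
  k) exp(...). In Newton's identity the derivative of p_k contributes the weight k, the remaining
  terms contribute n - k by induction, and the two add up to n.\<close>

lemma pd_Gc_nat:
  assumes "k \<ge> 1"
  shows "pd b k (Gc \<sigma> a (int n)) = (if a = b then bconst (of_int \<sigma> / of_nat k) * Gc \<sigma> a (int n - int k) else 0)"
proof (induction n rule: less_induct)
  case (less n)
  have lin: "boson_linear (pd b k)" by (rule boson_linear_pd)
  show ?case
  proof (cases "n = 0")
    case True
    then show ?thesis using assms by simp
  next
    case False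
    let ?c = "bconst (of_int \<sigma>)" and ?d = "bconst (of_int \<sigma> / of_nat k)"
    let ?R = "if a = b then ?d * Gc \<sigma> a (int n - int k) else 0"
    have IH: "pd b k (Gc \<sigma> a (int n - int j)) = (if a = b then ?d * Gc \<sigma> a (int (n - j) - int k) else 0)"
      if "j \<in> {1..n}" for j
      using less[of "n - j"] that False by (simp add: of_nat_diff)
    have "of_nat n * pd b k (Gc \<sigma> a (int n)) = pd b k (of_nat n * Gc \<sigma> a (int n))"
      by (simp add: boson_linear_of_nat[OF lin])
    also have "\<dots> = ?c * (\<Sum>j=1..n. pd b k (pvar a j * Gc \<sigma> a (int n - int j)))"
      unfolding Gc_rec by (simp add: boson_linear_scale[OF lin] boson_linear_sum[OF lin])
    also have "\<dots> = ?c * (\<Sum>j=1..n. pd b k (pvar a j) * Gc \<sigma> a (int n - int j))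
       + ?c * (\<Sum>j=1..n. pvar a j * pd b k (Gc \<sigma> a (int n - int j)))"
      by (simp add: pd_mult sum.distrib distrib_left)
    also have "\<dots> = of_nat n * ?R"
    proof (cases "a = b")
      case True
      have "(\<Sum>j=1..n. pd b k (pvar a j) * Gc \<sigma> a (int n - int j)) =
          (\<Sum>j\<in>{1..n}. if j = k then Gc \<sigma> a (int n - int k) else 0)"
        using True by (intro sum.cong) (auto simp: pd_pvar)
      also have "\<dots> = Gc \<sigma> a (int n - int k)"
        using assms by (auto simp: sum.delta)
      finally have 1: "(\<Sum>j=1..n. pd b k (pvar a j) * Gc \<sigma> a (int n - int j)) = Gc \<sigma> a (int n - int k)" .
      have "?c * (\<Sum>j=1..n. pvar a j * pd b k (Gc \<sigma> a (int n - int j)))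
          = ?c * (\<Sum>j=1..n. pvar a j * (?d * Gc \<sigma> a (int (n - j) - int k)))"
        using IH True by (intro arg_cong2[where f = "(*)"] sum.cong) auto
      also have "\<dots> = ?d * (?c * (\<Sum>j=1..n. pvar a j * Gc \<sigma> a (int (n - j) - int k)))"
        by (simp add: sum_distrib_left mult_ac)
      also have "(\<Sum>j=1..n. pvar a j * Gc \<sigma> a (int (n - j) - int k))
          = (\<Sum>j=1..n-k. pvar a j * Gc \<sigma> a (int (n - k) - int j))"
      proof (rule sum.mono_neutral_cong_right)
        show "\<forall>j\<in>{1..n} - {1..n - k}. pvar a j * Gc \<sigma> a (int (n - j) - int k) = 0"
          by (auto simp: of_nat_diff)
        show "pvar a j * Gc \<sigma> a (int (n - j) - int k) = pvar a j * Gc \<sigma> a (int (n - k) - int j)"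
          if "j \<in> {1..n - k}" for j
        proof -
          have "int (n - j) - int k = int (n - k) - int j" using that by auto
          then show ?thesis by (simp only:)
        qed
      qed auto
      also have "?c * \<dots> = of_nat (n - k) * Gc \<sigma> a (int (n - k))"
        unfolding Gc_rec ..
      also have "\<dots> = of_nat (n - k) * Gc \<sigma> a (int n - int k)"
        by (cases "k \<le> n") (auto simp: of_nat_diff)
      finally have 2: "?c * (\<Sum>j=1..n. pvar a j * pd b k (Gc \<sigma> a (int n - int j)))
          = ?d * (of_nat (n - k) * Gc \<sigma> a (int n - int k))" .
      have c: "?c = ?d * of_nat k"
        using assms by (simp flip: bconst_of_nat bconst_mult)
      show ?thesis
      proof (cases "k \<le> n")
        case True
        then have x: "of_nat n * (?d * x) = ?d * of_nat k * x + ?d * (of_nat (n - k) * x)" for x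
          by (simp only: of_nat_mult_split[of k n] distrib_left mult_ac)
        have "?c * (\<Sum>j=1..n. pd b k (pvar a j) * Gc \<sigma> a (int n - int j))
            + ?c * (\<Sum>j=1..n. pvar a j * pd b k (Gc \<sigma> a (int n - int j)))
          = of_nat n * (?d * Gc \<sigma> a (int n - int k))"
          unfolding 1 2 unfolding c x ..
        then show ?thesis using \<open>a = b\<close> by simp
      next
        case False
        then have "?c * (\<Sum>j=1..n. pd b k (pvar a j) * Gc \<sigma> a (int n - int j))
            + ?c * (\<Sum>j=1..n. pvar a j * pd b k (Gc \<sigma> a (int n - int j))) = 0"
          unfolding 1 2 by simp
        then show ?thesis using \<open>a = b\<close> False by simp
      qed
    next
      case False
      then show ?thesis using IH by (auto simp: pd_pvar intro!: sum.neutral)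
    qed
    finally show ?thesis
      by (rule of_nat_mult_cancel_boson) (use False in simp)
  qed
qed

lemma pd_Gc:
  assumes "k \<ge> 1"
  shows "pd b k (Gc \<sigma> a j) = (if a = b then bconst (of_int \<sigma> / of_nat k) * Gc \<sigma> a (j - int k) else 0)"
proof (cases "j < 0")
  case True
  then show ?thesis by (simp add: boson_linear_0[OF boson_linear_pd])
next
  case False
  then show ?thesis using pd_Gc_nat[OF assms, of b \<sigma> a "nat j"] by simp
qed

lemma Qc_Gc_other: "a \<noteq> b \<Longrightarrow> Qc \<sigma> a i (Gc \<rho> b j * f) = Gc \<rho> b j * Qc \<sigma> a i f"
  by (rule Qc_mult_const) (simp add: pd_Gc)

text \<open>This is H(u) E(-u) = 1. Multiplication operators commute with multiplication by
  \<open>w\<close>, so exponentiating them on \<open>w\<close> is the same as multiplying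
  \<open>w\<close> by the exponential.\<close>

lemma Gc_opposite:
  "(\<Sum>i\<le>n. Gc \<sigma> a (int i) * Gc (- \<sigma>) a (int n - int i)) = (if n = 0 then 1 else 0)"
proof -
  have "exp_coeff (gen_op \<sigma> a) w m = w * exp_coeff (gen_op \<sigma> a) 1 m" for w m
    using exp_coeff_intertwine[of "gen_op \<sigma> a" "\<lambda>f. w * f" 1 m, OF commuting_gen_op
        boson_linear_mult[OF boson_linear_id]]
    by (simp add: gen_op_def mult_ac)
  note this[of "exp_coeff (gen_op (- \<sigma>) a) 1 _"]
  moreover have "gen_op (- \<sigma>) a j f = - gen_op \<sigma> a j f" for j f
    by (simp add: gen_op_def bconst_uminus)
  ultimately show ?thesis
    using sum_exp_coeff_opposite[OF commuting_gen_op, of "gen_op (- \<sigma>) a" \<sigma> a 1 n]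
    by (simp add: Gc_def nat_diff_distrib' mult.commute)
qed

section \<open>Commuting derivatives past multiplications\<close>

context
  fixes \<sigma> :: int
  assumes sgn: "\<sigma> = 1 \<or> \<sigma> = -1"
begin

lemma shift_op_Gc_same: "k \<ge> 1 \<Longrightarrow> of_nat k * shift_op \<sigma> a k (Gc \<sigma> a j) = - Gc \<sigma> a (j - int k)"
proof -
  assume k: "k \<ge> 1"
  have "of_nat k * (bconst (- of_int \<sigma>) * bconst (of_int \<sigma> / of_nat k)) = bconst (-1)"
    using sgn k by (auto simp flip: bconst_of_nat bconst_mult)
  then have "of_nat k * (bconst (- of_int \<sigma>) * (bconst (of_int \<sigma> / of_nat k) * x)) = - x" for x
    by (simp only: mult.assoc[symmetric]) (simp add: bconst_uminus)
  then show ?thesis using k by (simp add: shift_op_def pd_Gc)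
qed

lemma shift_op_Gc_opposite: "k \<ge> 1 \<Longrightarrow> of_nat k * shift_op \<sigma> a k (Gc (- \<sigma>) a j) = Gc (- \<sigma>) a (j - int k)"
proof -
  assume k: "k \<ge> 1"
  have "of_nat k * (bconst (- of_int \<sigma>) * bconst (of_int (- \<sigma>) / of_nat k)) = bconst 1"
    using sgn k by (auto simp flip: bconst_of_nat bconst_mult)
  then have "of_nat k * (bconst (- of_int \<sigma>) * (bconst (of_int (- \<sigma>) / of_nat k) * x)) = x" for x
    by (simp only: mult.assoc[symmetric]) simp
  then show ?thesis using k by (simp add: shift_op_def pd_Gc)
qed

text \<open>Each \<partial>_k multiplies the series in v by \<sigma> v^k / k, so the exponent
  becomes - \<Sum> (v/u)^k / k = log(1 - v/u). The factor 1 - v/u leaves two terms; it is the origin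
  of the Vandermonde factors.\<close>

lemma Qc_Gc_same_nat:
  "Qc \<sigma> a (int n) (Gc \<sigma> a j) = (if n = 0 then Gc \<sigma> a j else if n = 1 then - Gc \<sigma> a (j - 1) else 0)"
proof -
  let ?E = "\<lambda>n::nat. if n = 0 then Gc \<sigma> a j else if n = 1 then - Gc \<sigma> a (j - 1) else 0"
  have "?E n = exp_coeff (shift_op \<sigma> a) (Gc \<sigma> a j) n"
  proof (rule exp_coeff_unique[OF commuting_shift_op, where E = ?E])
    fix n :: nat assume n: "n > 0"
    \<comment> \<open>Only k = n and k = n - 1 contribute. They cancel for n > 1, while for n = 1
      the second one is k = 0 and falls outside the range.\<close>
    have "(\<Sum>k=1..n. of_nat k * shift_op \<sigma> a k (?E (n - k))) = (\<Sum>k\<in>{1..n}.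
        (if k = n then - Gc \<sigma> a (j - int n) else 0) + (if k = n - 1 then Gc \<sigma> a (j - int n) else 0))"
    proof (rule sum.cong[OF refl])
      fix k assume k: "k \<in> {1..n}"
      consider "k = n" | "k = n - 1" "n - k = 1" "n \<noteq> k" | "k < n - 1" using k by force
      then show "of_nat k * shift_op \<sigma> a k (?E (n - k)) =
         (if k = n then - Gc \<sigma> a (j - int n) else 0) + (if k = n - 1 then Gc \<sigma> a (j - int n) else 0)"
      proof cases
        case 1
        then show ?thesis using k by (simp add: shift_op_Gc_same)
      next
        case 2
        have e: "j - 1 - int k = j - int n" using 2 k by simp
        then have "of_nat k * shift_op \<sigma> a k (- Gc \<sigma> a (j - 1)) = Gc \<sigma> a (j - int n)"
          using k shift_op_Gc_same[of k a "j - 1", unfolded e]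
          by (simp add: boson_linear_uminus[OF boson_linear_shift_op])
        moreover have "?E (n - k) = - Gc \<sigma> a (j - 1)" using 2 by simp
        moreover have "(if k = n then - Gc \<sigma> a (j - int n) else 0) +
          (if k = n - 1 then Gc \<sigma> a (j - int n) else 0) = Gc \<sigma> a (j - int n)" using 2 by auto
        ultimately show ?thesis by (simp only:)
      next
        case 3
        then show ?thesis using k by (simp add: boson_linear_0[OF boson_linear_shift_op])
      qed
    qed
    also have "\<dots> = of_nat n * ?E n"
      using n by (auto simp: sum.distrib)
    finally show "of_nat n * ?E n = (\<Sum>k=1..n. of_nat k * shift_op \<sigma> a k (?E (n - k)))" ..
  qed simp
  then show ?thesis by (simp add: Qc_def)
qed

text \<open>With the opposite sign in the exponent the factor is 1/(1 - v/u), a geometric series, so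
  every shift appears with coefficient 1.\<close>

lemma Qc_Gc_opposite: "i \<ge> 0 \<Longrightarrow> Qc \<sigma> a i (Gc (- \<sigma>) a j) = Gc (- \<sigma>) a (j - i)"
proof -
  assume "i \<ge> 0"
  have "Gc (- \<sigma>) a (j - int n) = exp_coeff (shift_op \<sigma> a) (Gc (- \<sigma>) a j) n" for n
    by (rule exp_coeff_unique[OF commuting_shift_op, where E = "\<lambda>n. Gc (- \<sigma>) a (j - int n)"])
       (auto simp: shift_op_Gc_opposite of_nat_diff)
  from this[of "nat i"] show ?thesis using \<open>i \<ge> 0\<close> by (simp add: Qc_def)
qed

lemma Qc_Gc_same_mult: "Qc \<sigma> a i (Gc \<sigma> a j * f) = Gc \<sigma> a j * Qc \<sigma> a i f - Gc \<sigma> a (j - 1) * Qc \<sigma> a (i - 1) f"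
proof (cases "i < 0")
  case False
  then obtain n where n: "i = int n" by (metis nonneg_int_cases not_less)
  show ?thesis
  proof (cases n)
    case 0
    then show ?thesis using n by simp
  next
    case (Suc m)
    have "Qc \<sigma> a i (Gc \<sigma> a j * f) = (\<Sum>k\<in>{0,1}. Qc \<sigma> a (int k) (Gc \<sigma> a j) * Qc \<sigma> a (int n - int k) f)"
      unfolding n Qc_mult by (rule sum.mono_neutral_right) (use Suc in \<open>auto simp: Qc_Gc_same_nat\<close>)
    then show ?thesis using n by (simp add: Qc_Gc_same_nat[of a 1, simplified])
  qed
qed simp

lemma Qc_Gc_opposite_mult:
  "Qc \<sigma> a (int n) (Gc (- \<sigma>) a j * f) = (\<Sum>t\<le>n. Gc (- \<sigma>) a (j - int t) * Qc \<sigma> a (int n - int t) f)"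
  unfolding Qc_mult by (simp add: Qc_Gc_opposite)

end


section \<open>Bernstein operators\<close>

text \<open>\<open>Bop \<sigma> a M\<close> is the coefficient of \<open>u\<^sup>M\<close> in \<open>H(u) E\<^sup>\<bottom>(-u)\<close> or \<open>E(-u) H\<^sup>\<bottom>(u)\<close>.\<close>

definition Bop :: "int \<Rightarrow> nat \<Rightarrow> int \<Rightarrow> boson \<Rightarrow> boson" where
  "Bop \<sigma> a M f = Sum_any (\<lambda>i. Gc \<sigma> a (M + i) * Qc \<sigma> a i f)"

lemma Bop_eq:
  assumes "\<And>i. i > n \<Longrightarrow> Qc \<sigma> a i f = 0"
  shows "Bop \<sigma> a M f = (\<Sum>i=0..n. Gc \<sigma> a (M + i) * Qc \<sigma> a i f)"
  unfolding Bop_def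
proof (rule Sum_any.expand_superset)
  show "{i. Gc \<sigma> a (M + i) * Qc \<sigma> a i f \<noteq> 0} \<subseteq> {0..n}"
    using assms by (auto simp: not_less[symmetric])
qed simp

lemma Qc_bounded_nonneg: "\<exists>n\<ge>0. \<forall>\<sigma> a i. i > n \<longrightarrow> Qc \<sigma> a i f = 0"
proof -
  obtain n where "\<forall>\<sigma> a i. i > n \<longrightarrow> Qc \<sigma> a i f = 0" using Qc_bounded by blast
  then show ?thesis by (intro exI[of _ "max n 0"]) auto
qed

lemma boson_linear_Bop: "boson_linear (Bop \<sigma> a M)"
proof (rule boson_linearI)
  fix f g
  obtain n where "n \<ge> 0" and n: "\<And>\<sigma> a i. i > n \<Longrightarrow> Qc \<sigma> a i f = 0" using Qc_bounded_nonneg[of f] by blast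
  obtain m where "m \<ge> 0" and m: "\<And>\<sigma> a i. i > m \<Longrightarrow> Qc \<sigma> a i g = 0" using Qc_bounded_nonneg[of g] by blast
  show "Bop \<sigma> a M (f + g) = Bop \<sigma> a M f + Bop \<sigma> a M g"
    by (subst (1 2 3) Bop_eq[where n = "max n m"])
       (auto simp: n m boson_linear_add[OF boson_linear_Qc] distrib_left sum.distrib)
next
  fix c f
  obtain n where "n \<ge> 0" and n: "\<And>\<sigma> a i. i > n \<Longrightarrow> Qc \<sigma> a i f = 0" using Qc_bounded_nonneg[of f] by blast
  show "Bop \<sigma> a M (bconst c * f) = bconst c * Bop \<sigma> a M f"
    by (subst (1 2) Bop_eq[where n = n])
       (auto simp: n boson_linear_scale[OF boson_linear_Qc] sum_distrib_left mult.left_commute)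
qed

lemmas Bop_linear_sum = boson_linear_sum[OF boson_linear_Bop]

text \<open>The window up to \<open>n + T\<close> contains the support of every shift by at most
  \<open>T\<close>, so a family of shifts can be summed over one common range.\<close>

lemma Qc_sum_shift:
  assumes "\<And>i. i > n \<Longrightarrow> Qc \<sigma> a i f = 0" "0 \<le> t" "t \<le> T"
  shows "(\<Sum>i=0..n+T. c i * Qc \<sigma> a (i - t) f) = (\<Sum>i=0..n. c (i + t) * Qc \<sigma> a i f)"
proof -
  have "(\<Sum>i=0..n+T. c i * Qc \<sigma> a (i - t) f) = (\<Sum>i=t..n+t. c i * Qc \<sigma> a (i - t) f)"
    by (rule sum.mono_neutral_right) (use assms in auto)
  also have "\<dots> = (\<Sum>i=0..n. c (i + t) * Qc \<sigma> a i f)"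
    by (rule sum.reindex_bij_witness[of _ "\<lambda>i. i + t" "\<lambda>i. i - t"]) auto
  finally show ?thesis .
qed

lemma Bop_mult_const:
  assumes "\<And>i f. Qc \<sigma> a i (P * f) = P * Qc \<sigma> a i f"
  shows "Bop \<sigma> a M (P * f) = P * Bop \<sigma> a M f"
proof -
  obtain n where "n \<ge> 0" and n: "\<And>\<sigma> a i. i > n \<Longrightarrow> Qc \<sigma> a i f = 0" using Qc_bounded_nonneg[of f] by blast
  show ?thesis
    by (subst (1 2) Bop_eq[where n = n]) (auto simp: n assms sum_distrib_left mult.left_commute)
qed

lemma Bop_zpow_mult: "Bop \<sigma> a M (zpow n * f) = zpow n * Bop \<sigma> a M f"
  by (rule Bop_mult_const) (rule Qc_zpow_mult)

lemma Qc_Bop_other: "a \<noteq> b \<Longrightarrow> Qc \<sigma> a i (Bop \<rho> b M f) = Bop \<rho> b M (Qc \<sigma> a i f)"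
proof -
  assume ab: "a \<noteq> b"
  obtain n where "n \<ge> 0" and n: "\<And>\<sigma> a i. i > n \<Longrightarrow> Qc \<sigma> a i f = 0" using Qc_bounded_nonneg[of f] by blast
  have "Qc \<rho> b k (Qc \<sigma> a i f) = 0" if "k > n" for k
    using Qc_commute[of \<rho> b k \<sigma> a i f] n[OF that] by (simp add: Qc_linear_0)
  then have "Bop \<rho> b M (Qc \<sigma> a i f) = (\<Sum>k=0..n. Gc \<rho> b (M + k) * Qc \<rho> b k (Qc \<sigma> a i f))"
    by (rule Bop_eq)
  then show ?thesis
    by (simp add: Bop_eq[OF n] Qc_linear_sum Qc_Gc_other[OF ab]
        Qc_commute[of \<rho> b _ \<sigma> a i f])
qed

text \<open>Operators of different components act on different variables. The minus sign between the
  corresponding fermions comes from R alone.\<close>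

lemma Bop_commute_other:
  assumes "a \<noteq> b"
  shows "Bop \<sigma> a M (Bop \<rho> b N f) = Bop \<rho> b N (Bop \<sigma> a M f)"
proof -
  obtain n where "n \<ge> 0" and n: "\<And>\<sigma> a i. i > n \<Longrightarrow> Qc \<sigma> a i f = 0" using Qc_bounded_nonneg[of f] by blast
  have "Qc \<sigma> a i (Bop \<rho> b N f) = 0" if "i > n" for i
    using n[OF that] assms by (simp add: Qc_Bop_other boson_linear_0[OF boson_linear_Bop])
  then have "Bop \<sigma> a M (Bop \<rho> b N f) = (\<Sum>i=0..n. Gc \<sigma> a (M + i) * Bop \<rho> b N (Qc \<sigma> a i f))"
    using assms by (simp add: Bop_eq[where n = n] Qc_Bop_other)
  also have "\<dots> = (\<Sum>i=0..n. Bop \<rho> b N (Gc \<sigma> a (M + i) * Qc \<sigma> a i f))"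
    using assms by (simp add: Bop_mult_const[OF Qc_Gc_other])
  also have "\<dots> = Bop \<rho> b N (Bop \<sigma> a M f)"
    by (simp add: Bop_eq[where \<sigma> = \<sigma> and a = a and n = n, OF n] Bop_linear_sum)
  finally show ?thesis .
qed

lemma Bop_eq_0:
  assumes "\<And>i. i > n \<Longrightarrow> Qc \<sigma> a i f = 0" "M < - n"
  shows "Bop \<sigma> a M f = 0"
  using assms(2) by (subst Bop_eq[where n = n, OF assms(1)]) (auto intro!: sum.neutral)

text \<open>H(u) E(-u) = 1 once more, over an arbitrary finite window that contains the support of
  the products.\<close>

lemma Gc_convolution:
  assumes "{-x..y} \<subseteq> S" "finite S"
  shows "(\<Sum>t\<in>S. Gc \<sigma> a (x + t) * Gc (- \<sigma>) a (y - t)) = (if x + y = 0 then 1 else 0)"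
proof -
  have "(\<Sum>t\<in>S. Gc \<sigma> a (x + t) * Gc (- \<sigma>) a (y - t)) = (\<Sum>t\<in>{-x..y}. Gc \<sigma> a (x + t) * Gc (- \<sigma>) a (y - t))"
    by (rule sum.mono_neutral_right) (use assms in \<open>auto simp: not_le\<close>)
  also have "\<dots> = (if x + y = 0 then 1 else 0)"
  proof (cases "x + y < 0")
    case False
    have "(\<Sum>t\<in>{-x..y}. Gc \<sigma> a (x + t) * Gc (- \<sigma>) a (y - t)) =
        (\<Sum>i\<le>nat (x + y). Gc \<sigma> a (int i) * Gc (- \<sigma>) a (int (nat (x + y)) - int i))"
      by (rule sum.reindex_bij_witness[of _ "\<lambda>i. int i - x" "\<lambda>t. nat (x + t)"]) (use False in auto)
    also have "\<dots> = (if x + y = 0 then 1 else 0)"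
      unfolding Gc_opposite using False by auto
    finally show ?thesis .
  qed auto
  finally show ?thesis .
qed

context
  fixes \<sigma> :: int
  assumes sgn: "\<sigma> = 1 \<or> \<sigma> = -1"
begin

text \<open>In generating functions: moving B(u) past G(v) of the same sign produces the factor 1 -
  v/u.\<close>

lemma Bop_Gc_same:
  "Bop \<sigma> a M (Gc \<sigma> a j * f) = Gc \<sigma> a j * Bop \<sigma> a M f - Gc \<sigma> a (j - 1) * Bop \<sigma> a (M + 1) f"
proof -
  obtain n where "n \<ge> 0" and n: "\<And>\<sigma> a i. i > n \<Longrightarrow> Qc \<sigma> a i f = 0" using Qc_bounded_nonneg[of f] by blast
  have "Bop \<sigma> a M (Gc \<sigma> a j * f) = (\<Sum>i=0..n+1. Gc \<sigma> a (M + i) *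
      (Gc \<sigma> a j * Qc \<sigma> a i f - Gc \<sigma> a (j - 1) * Qc \<sigma> a (i - 1) f))"
    by (subst Bop_eq[where n = "n + 1"]) (auto simp: Qc_Gc_same_mult[OF sgn] n)
  also have "\<dots> = Gc \<sigma> a j * (\<Sum>i=0..n+1. Gc \<sigma> a (M + i) * Qc \<sigma> a i f)
      - Gc \<sigma> a (j - 1) * (\<Sum>i=0..n+1. Gc \<sigma> a (M + i) * Qc \<sigma> a (i - 1) f)"
    by (simp only: right_diff_distrib sum_subtractf sum_distrib_left mult.left_commute[of "Gc \<sigma> a (M + _)"])
  also have "(\<Sum>i=0..n+1. Gc \<sigma> a (M + i) * Qc \<sigma> a (i - 1) f) = Bop \<sigma> a (M + 1) f"
    by (subst Qc_sum_shift[OF n]) (auto simp: Bop_eq[OF n] add_ac)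
  also have "(\<Sum>i=0..n+1. Gc \<sigma> a (M + i) * Qc \<sigma> a i f) = Bop \<sigma> a M f"
    by (subst Bop_eq[where n = "n + 1"]) (auto simp: n)
  finally show ?thesis .
qed

text \<open>B(u) B(v) = (1 - v/u) F(u,v) with a normally ordered product F that is symmetric in u
  and v. Hence u B(u) B(v) = - v B(v) B(u), which explains the shifts by one.\<close>

lemma Bop_anticommute: "Bop \<sigma> a M (Bop \<sigma> a N f) = - Bop \<sigma> a (N - 1) (Bop \<sigma> a (M + 1) f)"
proof -
  obtain n where "n \<ge> 0" and n: "\<And>\<sigma> a i. i > n \<Longrightarrow> Qc \<sigma> a i f = 0" using Qc_bounded_nonneg[of f] by blast
  have nn: "Qc \<sigma> a i (Qc \<sigma> a k f) = 0" if "i > n" for i k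
    using Qc_commute[of \<sigma> a i \<sigma> a k f] n[OF that] by (simp add: Qc_linear_0)
  have Beq: "Bop \<sigma> a M (Qc \<sigma> a k f) = (\<Sum>i=0..n. Gc \<sigma> a (M + i) * Qc \<sigma> a i (Qc \<sigma> a k f))" for M k
    by (rule Bop_eq) (rule nn)
  \<comment> \<open>The coefficients of the normally ordered product, with all multiplications to
    the left of all derivatives.\<close>
  define F where "F N M = (\<Sum>k=0..n. \<Sum>i=0..n. Gc \<sigma> a (N + k) * (Gc \<sigma> a (M + i) * Qc \<sigma> a i (Qc \<sigma> a k f)))" for N M
  have F_sym: "F N M = F M N" for N M
  proof -
    have "F N M = (\<Sum>i=0..n. \<Sum>k=0..n. Gc \<sigma> a (N + k) * (Gc \<sigma> a (M + i) * Qc \<sigma> a i (Qc \<sigma> a k f)))"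
      unfolding F_def by (rule sum.swap)
    also have "\<dots> = F M N"
      unfolding F_def by (intro sum.cong refl) (simp only: Qc_commute[of \<sigma> a _ \<sigma> a _ f] mult.left_commute)
    finally show ?thesis .
  qed
  have BB: "Bop \<sigma> a M (Bop \<sigma> a N f) = F N M - F (N - 1) (M + 1)" for M N
  proof -
    have "Bop \<sigma> a M (Bop \<sigma> a N f) = (\<Sum>k=0..n. Bop \<sigma> a M (Gc \<sigma> a (N + k) * Qc \<sigma> a k f))"
      by (simp add: Bop_eq[where \<sigma> = \<sigma> and n = n, OF n] Bop_linear_sum)
    also have "\<dots> = (\<Sum>k=0..n. Gc \<sigma> a (N + k) * Bop \<sigma> a M (Qc \<sigma> a k f)
        - Gc \<sigma> a (N + k - 1) * Bop \<sigma> a (M + 1) (Qc \<sigma> a k f))"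
      by (simp only: Bop_Gc_same)
    also have "\<dots> = F N M - F (N - 1) (M + 1)"
      unfolding F_def Beq sum_subtractf sum_distrib_left by (simp add: algebra_simps)
    finally show ?thesis .
  qed
  show ?thesis unfolding BB using F_sym[of "M + 1" "N - 1"] F_sym[of M N] by simp
qed

lemma Qc_Gc_opposite_mult':
  assumes "T \<ge> j"
  shows "Qc \<sigma> a i (Gc (- \<sigma>) a j * f) = (\<Sum>t=0..T. Gc (- \<sigma>) a (j - t) * Qc \<sigma> a (i - t) f)"
proof (cases "i < 0")
  case True
  then show ?thesis by (auto intro!: sum.neutral[symmetric])
next
  case False
  then obtain n where i: "i = int n" by (metis nonneg_int_cases not_less)
  have "Qc \<sigma> a i (Gc (- \<sigma>) a j * f) = (\<Sum>t\<le>n. Gc (- \<sigma>) a (j - int t) * Qc \<sigma> a (int n - int t) f)"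
    unfolding i by (rule Qc_Gc_opposite_mult[OF sgn])
  also have "\<dots> = (\<Sum>t=0..i. Gc (- \<sigma>) a (j - t) * Qc \<sigma> a (i - t) f)"
    by (rule sum.reindex_bij_witness[of _ nat int]) (auto simp: i)
  also have "\<dots> = (\<Sum>t=0..max i T. Gc (- \<sigma>) a (j - t) * Qc \<sigma> a (i - t) f)"
    by (rule sum.mono_neutral_left) auto
  also have "\<dots> = (\<Sum>t=0..T. Gc (- \<sigma>) a (j - t) * Qc \<sigma> a (i - t) f)"
    by (rule sum.mono_neutral_right) (use assms in auto)
  finally show ?thesis .
qed

lemma Bop_Gc_opposite:
  assumes n: "\<And>i. i > n \<Longrightarrow> Qc \<sigma> a i f = 0" and T: "T \<ge> j" "T \<ge> 0"
  shows "Bop \<sigma> a M (Gc (- \<sigma>) a j * f) =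
    (\<Sum>t=0..T. \<Sum>i=0..n. Gc \<sigma> a (M + i + t) * Gc (- \<sigma>) a (j - t) * Qc \<sigma> a i f)"
proof -
  have "Bop \<sigma> a M (Gc (- \<sigma>) a j * f) = (\<Sum>i=0..n+T. Gc \<sigma> a (M + i) * Qc \<sigma> a i (Gc (- \<sigma>) a j * f))"
    by (rule Bop_eq) (use T n in \<open>auto simp: Qc_Gc_opposite_mult' intro!: sum.neutral\<close>)
  also have "\<dots> = (\<Sum>t=0..T. \<Sum>i=0..n+T. Gc \<sigma> a (M + i) * Gc (- \<sigma>) a (j - t) * Qc \<sigma> a (i - t) f)"
    unfolding Qc_Gc_opposite_mult'[OF T(1)] sum_distrib_left mult.assoc by (rule sum.swap)
  also have "\<dots> = (\<Sum>t=0..T. \<Sum>i=0..n. Gc \<sigma> a (M + (i + t)) * Gc (- \<sigma>) a (j - t) * Qc \<sigma> a i f)"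
    by (intro sum.cong refl Qc_sum_shift[of n \<sigma> a f _ T "\<lambda>i. Gc \<sigma> a (M + i) * Gc (- \<sigma>) a (j - _)"]) (use n in auto)
  finally show ?thesis by (simp only: add.assoc)
qed

text \<open>For opposite signs the factor in front of the normally ordered product is 1/(1 - v/u),
  expanded in powers of v/u; \<open>t\<close> is the summation index of this geometric
  series.\<close>

lemma Bop_opposite_double:
  assumes n: "\<And>\<rho> i. i > n \<Longrightarrow> Qc \<rho> a i f = 0" and T: "T \<ge> N + n" "T \<ge> 0"
  shows "Bop \<sigma> a M (Bop (- \<sigma>) a N f) = (\<Sum>k=0..n. \<Sum>i=0..n.
    (\<Sum>t=0..T. Gc \<sigma> a (M + i + t) * Gc (- \<sigma>) a (N + k - t)) * Qc \<sigma> a i (Qc (- \<sigma>) a k f))"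
proof -
  have nn: "Qc \<sigma> a i (Qc (- \<sigma>) a k f) = 0" if "i > n" for i k
    using Qc_commute[of \<sigma> a i "- \<sigma>" a k f] n[OF that] by (simp add: Qc_linear_0)
  have "Bop \<sigma> a M (Bop (- \<sigma>) a N f) = (\<Sum>k=0..n. Bop \<sigma> a M (Gc (- \<sigma>) a (N + k) * Qc (- \<sigma>) a k f))"
    by (simp add: Bop_eq[where \<sigma> = "- \<sigma>" and n = n, OF n] Bop_linear_sum)
  also have "\<dots> = (\<Sum>k=0..n. \<Sum>t=0..T. \<Sum>i=0..n.
      Gc \<sigma> a (M + i + t) * Gc (- \<sigma>) a (N + k - t) * Qc \<sigma> a i (Qc (- \<sigma>) a k f))"
    by (intro sum.cong refl Bop_Gc_opposite) (use nn T in auto)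
  also have "\<dots> = (\<Sum>k=0..n. \<Sum>i=0..n. \<Sum>t=0..T.
      Gc \<sigma> a (M + i + t) * Gc (- \<sigma>) a (N + k - t) * Qc \<sigma> a i (Qc (- \<sigma>) a k f))"
    by (intro sum.cong refl sum.swap)
  finally show ?thesis by (simp only: sum_distrib_right)
qed

end

text \<open>Both orders give the same normally ordered product, multiplied by the expansion over t
  \<ge> 0 in one case and over t < 0 in the other. Together they form the formal delta function,
  which sets u = v; there the multiplications cancel by \<open>Gc_opposite\<close> and the
  derivatives by \<open>Qc_opposite\<close>.\<close>

lemma Bop_opposite:
  assumes sgn: "\<sigma> = 1 \<or> \<sigma> = -1"
  shows "Bop \<sigma> a M (Bop (- \<sigma>) a N f) + Bop (- \<sigma>) a (N + 1) (Bop \<sigma> a (M - 1) f) = (if M + N = 0 then f else 0)"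
proof -
  have sgn': "- \<sigma> = 1 \<or> - \<sigma> = -1" using sgn by auto
  obtain n where n: "n \<ge> 0" "\<And>\<sigma> a i. i > n \<Longrightarrow> Qc \<sigma> a i f = 0" using Qc_bounded_nonneg[of f] by blast
  \<comment> \<open>Large enough for both double sums, and for {-1-T..T} to contain the support of
    every convolution with i and k at most n.\<close>
  define T where "T = \<bar>M\<bar> + \<bar>N\<bar> + n"
  have T: "T \<ge> N + n" "T \<ge> 0" "T \<ge> M - 1 + n" "T \<ge> M + n" using n(1) by (auto simp: T_def)
  let ?W = "\<lambda>k i. Qc \<sigma> a i (Qc (- \<sigma>) a k f)"
  have 1: "Bop \<sigma> a M (Bop (- \<sigma>) a N f) = (\<Sum>k=0..n. \<Sum>i=0..n.
    (\<Sum>t=0..T. Gc \<sigma> a (M + i + t) * Gc (- \<sigma>) a (N + k - t)) * ?W k i)"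
    by (rule Bop_opposite_double[OF sgn n(2) T(1,2)])
  have "Bop (- \<sigma>) a (N + 1) (Bop \<sigma> a (M - 1) f) = (\<Sum>i=0..n. \<Sum>k=0..n.
    (\<Sum>t=0..T. Gc (- \<sigma>) a (N + 1 + k + t) * Gc \<sigma> a (M - 1 + i - t)) * Qc (- \<sigma>) a k (Qc \<sigma> a i f))"
    using Bop_opposite_double[OF sgn' n(2) T(3,2)] by simp
  also have "\<dots> = (\<Sum>k=0..n. \<Sum>i=0..n.
    (\<Sum>t=0..T. Gc (- \<sigma>) a (N + 1 + k + t) * Gc \<sigma> a (M - 1 + i - t)) * ?W k i)"
    by (subst sum.swap) (simp only: Qc_commute[of "- \<sigma>" a _ \<sigma> a _ f])
  also have "\<dots> = (\<Sum>k=0..n. \<Sum>i=0..n.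
    (\<Sum>t=-1-T..-1. Gc \<sigma> a (M + i + t) * Gc (- \<sigma>) a (N + k - t)) * ?W k i)"
  proof -
    \<comment> \<open>The substitution t := -1 - t turns the second expansion into the negative half
      of the first.\<close>
    have "(\<Sum>t=0..T. Gc (- \<sigma>) a (N + 1 + k + t) * Gc \<sigma> a (M - 1 + i - t)) =
       (\<Sum>t=-1-T..-1. Gc \<sigma> a (M + i + t) * Gc (- \<sigma>) a (N + k - t))" for k i
      by (rule sum.reindex_bij_witness[of _ "\<lambda>t. - 1 - t" "\<lambda>t. - 1 - t"]) (auto simp: algebra_simps)
    then show ?thesis by (simp only:)
  qed
  finally have 2: "Bop (- \<sigma>) a (N + 1) (Bop \<sigma> a (M - 1) f) = (\<Sum>k=0..n. \<Sum>i=0..n.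
    (\<Sum>t=-1-T..-1. Gc \<sigma> a (M + i + t) * Gc (- \<sigma>) a (N + k - t)) * ?W k i)" .
  have un: "{-1-T..-1} \<union> {0..T} = {-1-T..T}" "{-1-T..-1} \<inter> {0..T} = {}" using T by auto
  have "Bop \<sigma> a M (Bop (- \<sigma>) a N f) + Bop (- \<sigma>) a (N + 1) (Bop \<sigma> a (M - 1) f) =
    (\<Sum>k=0..n. \<Sum>i=0..n. (\<Sum>t=-1-T..T. Gc \<sigma> a (M + i + t) * Gc (- \<sigma>) a (N + k - t)) * ?W k i)"
    unfolding 1 2 sum.distrib[symmetric] distrib_right[symmetric] un(1)[symmetric]
    by (subst sum.union_disjoint) (use un(2) in \<open>auto simp: add.commute\<close>)
  also have "\<dots> = (\<Sum>k=0..n. \<Sum>i=0..n. if i + k = - (M + N) then ?W k i else 0)"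
  proof (intro sum.cong refl)
    fix k i assume "k \<in> {0..n}" "i \<in> {0..n}"
    then have "{- (M + i)..N + k} \<subseteq> {-1-T..T}" using T by auto
    from Gc_convolution[OF this, of \<sigma> a]
    have "(\<Sum>t=-1-T..T. Gc \<sigma> a (M + i + t) * Gc (- \<sigma>) a (N + k - t)) = (if i + k = - (M + N) then 1 else 0)"
      by (simp add: algebra_simps eq_neg_iff_add_eq_0)
    then show "(\<Sum>t=-1-T..T. Gc \<sigma> a (M + i + t) * Gc (- \<sigma>) a (N + k - t)) * ?W k i =
      (if i + k = - (M + N) then ?W k i else 0)" by simp
  qed
  also have "\<dots> = (\<Sum>i=0..n. \<Sum>k=0..n. if i + k = - (M + N) then ?W k i else 0)"
    by (rule sum.swap)
  \<comment> \<open>For fixed i a single k survives. If it lies outside {0..n}, the corresponding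
    \<open>Qc\<close> gives 0, so no case distinction remains.\<close>
  also have "\<dots> = (\<Sum>i=0..n. ?W (- (M + N) - i) i)"
  proof (intro sum.cong refl)
    fix i
    have "(\<Sum>k=0..n. if i + k = - (M + N) then ?W k i else 0)
        = (\<Sum>k=0..n. if k = - (M + N) - i then ?W (- (M + N) - i) i else 0)"
      by (intro sum.cong refl) auto
    also have "\<dots> = ?W (- (M + N) - i) i"
      using n(2)[of "- (M + N) - i" "- \<sigma>" a]
      by (auto simp: not_le Qc_linear_0)
    finally show "(\<Sum>k=0..n. if i + k = - (M + N) then ?W k i else 0) = ?W (- (M + N) - i) i" .
  qed
  also have "\<dots> = (if M + N = 0 then f else 0)"
  proof (cases "M + N > 0")
    case True
    then show ?thesis by (auto intro!: sum.neutral simp: Qc_linear_0)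
  next
    case False
    define m where "m = nat (- (M + N))"
    have m: "- (M + N) = int m" using False by (simp add: m_def)
    have W0: "?W (int m - i) i = 0" if "i > n" for i
      using Qc_commute[of \<sigma> a i "- \<sigma>" a "int m - i" f] n(2)[OF that]
      by (simp add: Qc_linear_0)
    \<comment> \<open>The range is first enlarged, where \<open>Qc\<close> on f is 0 beyond n, and
      then cut at m, where the other index turns negative.\<close>
    have "(\<Sum>i=0..n. ?W (int m - i) i) = (\<Sum>i=0..max n (int m). ?W (int m - i) i)"
      by (rule sum.mono_neutral_left) (auto simp: W0)
    also have "\<dots> = (\<Sum>i=0..int m. ?W (int m - i) i)"
      by (rule sum.mono_neutral_right) (auto simp: Qc_linear_0)
    also have "\<dots> = (\<Sum>i\<le>m. ?W (int m - int i) (int i))"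
      by (rule sum.reindex_bij_witness[of _ int nat]) auto
    also have "\<dots> = (if m = 0 then f else 0)" by (rule Qc_opposite)
    finally show ?thesis using m by auto
  qed
  finally show ?thesis .
qed


section \<open>Fermion modes on bosons\<close>

text \<open>Homogeneity, charge and the range of variables are linear conditions; stated as
  predicates they are carried through exponentials and Bernstein operators by closure arguments
  only.\<close>

definition closed_subspace :: "(boson \<Rightarrow> bool) \<Rightarrow> bool" where
  "closed_subspace P \<longleftrightarrow> P 0 \<and> (\<forall>f g. P f \<longrightarrow> P g \<longrightarrow> P (f + g)) \<and> (\<forall>c f. P f \<longrightarrow> P (bconst c * f))"

lemma closed_subspace_sum: "closed_subspace P \<Longrightarrow> (\<And>x. x \<in> A \<Longrightarrow> P (f x)) \<Longrightarrow> P (sum f A)"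
  by (induction A rule: infinite_finite_induct) (auto simp: closed_subspace_def)

lemma exp_coeff_closed:
  assumes P: "closed_subspace P" "P v" and D: "\<And>j f. j \<ge> 1 \<Longrightarrow> P f \<Longrightarrow> P (D j f)"
  shows "P (exp_coeff D v n)"
proof -
  have "P (exp_pow D v k m)" for k m
  proof (induction k arbitrary: m)
    case 0
    show ?case using P by (simp add: closed_subspace_def)
  next
    case (Suc k)
    show ?case unfolding exp_pow.simps
      by (rule closed_subspace_sum[OF P(1)]) (use D Suc in auto)
  qed
  then show ?thesis unfolding exp_coeff_def
    using P(1) by (intro closed_subspace_sum[OF P(1)]) (auto simp: closed_subspace_def)
qed

lemma Qc_closed:
  assumes P: "closed_subspace P" "P f" and D: "\<And>j f. j \<ge> 1 \<Longrightarrow> P f \<Longrightarrow> P (pd a j f)"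
  shows "P (Qc \<sigma> a i f)"
  using assms exp_coeff_closed[of P f "shift_op \<sigma> a" "nat i"]
  by (auto simp: Qc_def shift_op_def closed_subspace_def)

lemma Gc_closed:
  assumes P: "closed_subspace P" "P 1" and D: "\<And>j f. j \<ge> 1 \<Longrightarrow> P f \<Longrightarrow> P (pvar a j * f)"
  shows "P (Gc \<sigma> a i)"
  using assms exp_coeff_closed[of P 1 "gen_op \<sigma> a" "nat i"]
  by (auto simp: Gc_def gen_op_def closed_subspace_def mult.assoc)

lemma Bop_closed:
  assumes P: "closed_subspace P" "P f" and D: "\<And>j f. j \<ge> 1 \<Longrightarrow> P f \<Longrightarrow> P (pd a j f)"
    and p: "\<And>i f. P f \<Longrightarrow> P (Gc \<sigma> a i * f)"
  shows "P (Bop \<sigma> a M f)"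
proof -
  obtain n where "n \<ge> 0" and n: "\<And>\<sigma> a i. i > n \<Longrightarrow> Qc \<sigma> a i f = 0"
    using Qc_bounded_nonneg[of f] by blast
  have e: "Bop \<sigma> a M f = (\<Sum>i=0..n. Gc \<sigma> a (M + i) * Qc \<sigma> a i f)"
    by (rule Bop_eq) (rule n)
  show ?thesis unfolding e
    by (rule closed_subspace_sum[OF P(1)]) (rule p[OF Qc_closed[of P, OF P D]])
qed

definition homogeneous :: "(nat \<Rightarrow>\<^sub>0 int) \<Rightarrow> boson \<Rightarrow> bool" where
  "homogeneous n f \<longleftrightarrow> (\<forall>m \<mu>. m \<noteq> n \<longrightarrow> lookup f (m, \<mu>) = 0)"

lemma closed_subspace_homogeneous: "closed_subspace (homogeneous n)"
  unfolding closed_subspace_def homogeneous_def by (auto simp: lookup_add)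

lemma homogeneous_single: "homogeneous n (single (n, \<mu>) c)"
  by (auto simp: homogeneous_def lookup_single when_def)

lemma homogeneous_mult:
  assumes "homogeneous n f" "homogeneous m g"
  shows "homogeneous (n + m) (f * g)"
proof -
  have "k = n + m" if k: "(k, \<mu>) \<in> keys (f * g)" for k \<mu>
  proof -
    obtain b c where bc: "b \<in> keys f" "c \<in> keys g" "(k, \<mu>) = b + c"
      using keys_mult[of f g] k by blast
    then have "fst b = n" "fst c = m"
      using assms by (cases b, cases c, auto simp: homogeneous_def in_keys_iff)+
    then show ?thesis using bc(3) by (metis fst_add fst_conv)
  qed
  then show ?thesis by (auto simp: homogeneous_def in_keys_iff)
qed

lemma homogeneous_mult_0: "homogeneous 0 f \<Longrightarrow> homogeneous n g \<Longrightarrow> homogeneous n (f * g)"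
  using homogeneous_mult[of 0 f n g] by simp

lemma homogeneous_bconst: "homogeneous 0 (bconst c)"
  by (simp add: bconst_def zero_prod_def homogeneous_single)

lemma homogeneous_1: "homogeneous 0 1"
  using homogeneous_bconst[of 1] by simp

lemma homogeneous_pvar: "homogeneous 0 (pvar a k)"
  by (simp add: pvar_def homogeneous_single)

lemma homogeneous_zpow: "homogeneous n (zpow n)"
  by (simp add: zpow_def homogeneous_single)

lemma homogeneous_pd: "homogeneous n f \<Longrightarrow> homogeneous n (pd a k f)"
  by (auto simp: homogeneous_def lookup_pd pderiv_op_def)

lemma homogeneous_Gc: "homogeneous 0 (Gc \<sigma> a i)"
  by (rule Gc_closed[OF closed_subspace_homogeneous homogeneous_1])
     (rule homogeneous_mult_0[OF homogeneous_pvar])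

lemma homogeneous_Bop: "homogeneous n f \<Longrightarrow> homogeneous n (Bop \<sigma> a M f)"
  by (rule Bop_closed[OF closed_subspace_homogeneous])
     (auto intro: homogeneous_pd homogeneous_mult_0[OF homogeneous_Gc])

definition zsign :: "(nat \<Rightarrow>\<^sub>0 int) \<Rightarrow> nat \<Rightarrow> complex" where
  "zsign n a = (-1) powi (\<Sum>b=1..<a. lookup n b)"

text \<open>The coefficient of \<open>u\<^sup>N\<close> in \<open>\<psi>\<^sup>+\<^sup>(\<^sup>a\<^sup>)(u)\<close> (for \<open>\<sigma> = 1\<close>) or \<open>\<psi>\<^sup>-\<^sup>(\<^sup>a\<^sup>)(u)\<close> (for \<open>\<sigma> = -1\<close>).\<close>

definition Psi :: "int \<Rightarrow> nat \<Rightarrow> int \<Rightarrow> boson \<Rightarrow> boson" where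
  "Psi \<sigma> a N f = (\<Sum>b\<in>keys f. bconst (zsign (fst b) a) * (zpow (single a \<sigma>) *
     Bop \<sigma> a (N - \<sigma> * lookup (fst b) a) (single b (lookup f b))))"

lemma Psi_superset:
  assumes "keys f \<subseteq> S" "finite S"
  shows "Psi \<sigma> a N f = (\<Sum>b\<in>S. bconst (zsign (fst b) a) * (zpow (single a \<sigma>) *
     Bop \<sigma> a (N - \<sigma> * lookup (fst b) a) (single b (lookup f b))))"
  unfolding Psi_def
  by (rule sum.mono_neutral_left) (use assms in \<open>auto simp: in_keys_iff boson_linear_0[OF boson_linear_Bop]\<close>)

lemma boson_linear_Psi: "boson_linear (Psi \<sigma> a N)"
proof (rule boson_linearI)
  fix f g :: boson
  note sup = Psi_superset[where S = "keys f \<union> keys g"]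
  have "keys (f + g) \<subseteq> keys f \<union> keys g" by (rule Poly_Mapping.keys_add)
  then show "Psi \<sigma> a N (f + g) = Psi \<sigma> a N f + Psi \<sigma> a N g"
    by (simp only: sup finite_Un finite_keys Un_upper1 Un_upper2 lookup_add single_add
        boson_linear_add[OF boson_linear_Bop] distrib_left sum.distrib)
next
  fix c and f :: boson
  have S: "keys (bconst c * f) \<subseteq> keys f" by (auto simp: in_keys_iff)
  have s: "single b (c * d) = bconst c * single b d" for b :: fock_basis and d
    by (simp add: bconst_def mult_single)
  show "Psi \<sigma> a N (bconst c * f) = bconst c * Psi \<sigma> a N f"
    unfolding Psi_superset[OF S finite_keys] unfolding Psi_def lookup_bconst_mult s
      boson_linear_scale[OF boson_linear_Bop] sum_distrib_left
    by (simp only: mult.left_commute)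
qed

lemmas Psi_linear_0 = boson_linear_0[OF boson_linear_Psi]
lemmas Psi_linear_scale = boson_linear_scale[OF boson_linear_Psi]
lemmas Psi_linear_sum = boson_linear_sum[OF boson_linear_Psi]

text \<open>On a single power of z the operator R has a fixed sign and a fixed power of u, so a
  fermion mode is a Bernstein operator with its index shifted by the charge.\<close>

lemma Psi_homogeneous:
  assumes "homogeneous n f"
  shows "Psi \<sigma> a N f = bconst (zsign n a) * (zpow (single a \<sigma>) * Bop \<sigma> a (N - \<sigma> * lookup n a) f)"
proof -
  have "fst b = n" if "b \<in> keys f" for b
    using assms that by (cases b) (auto simp: homogeneous_def in_keys_iff)
  then have "Psi \<sigma> a N f = (\<Sum>b\<in>keys f. bconst (zsign n a) * (zpow (single a \<sigma>) *
     Bop \<sigma> a (N - \<sigma> * lookup n a) (single b (lookup f b))))"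
    unfolding Psi_def by (intro sum.cong) auto
  also have "\<dots> = bconst (zsign n a) * (zpow (single a \<sigma>) *
     Bop \<sigma> a (N - \<sigma> * lookup n a) (\<Sum>b\<in>keys f. single b (lookup f b)))"
    by (simp add: Bop_linear_sum sum_distrib_left)
  finally show ?thesis unfolding boson_sum_single[of f, symmetric] .
qed

lemma homogeneous_Psi:
  assumes "homogeneous n f"
  shows "homogeneous (n + single a \<sigma>) (Psi \<sigma> a N f)"
proof -
  have "homogeneous (single a \<sigma> + n) (zpow (single a \<sigma>) * Bop \<sigma> a (N - \<sigma> * lookup n a) f)"
    by (intro homogeneous_mult homogeneous_zpow homogeneous_Bop assms)
  then show ?thesis unfolding Psi_homogeneous[OF assms]
    by (metis add.commute homogeneous_bconst homogeneous_mult_0)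
qed

lemma lookup_zpow_mult: "lookup (zpow k * f) (n, \<mu>) = lookup f (n - k, \<mu>)"
proof -
  have "lookup (zpow k * f) (n, \<mu>) = (\<Sum>d\<in>keys f. lookup f d when (n, \<mu>) = (k, 0) + d)"
    unfolding zpow_def by (rule lookup_single_mult)
  also have "\<dots> = (\<Sum>d\<in>keys f. if d = (n - k, \<mu>) then lookup f (n - k, \<mu>) else 0)"
  proof (rule sum.cong[OF refl])
    fix d
    have "(n, \<mu>) = (k, 0) + d \<longleftrightarrow> d = (n - k, \<mu>)" by (cases d) auto
    then show "(lookup f d when (n, \<mu>) = (k, 0) + d) = (if d = (n - k, \<mu>) then lookup f (n - k, \<mu>) else 0)"
      by (simp add: when_def)
  qed
  also have "\<dots> = lookup f (n - k, \<mu>)"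
    by (simp only: sum.delta finite_keys in_keys_iff) simp
  finally show ?thesis .
qed

text \<open>The coefficientwise form matches the way \<open>Rop\<close> is defined, and therefore
  links \<open>Psi\<close> to the fermions of the completed space.\<close>

lemma lookup_Psi:
  assumes m: "m = n - single a \<sigma>"
  shows "lookup (Psi \<sigma> a N f) (n, \<mu>) = zsign m a * lookup (Bop \<sigma> a (N - \<sigma> * lookup m a) f) (m, \<mu>)"
proof -
  have "lookup (Psi \<sigma> a N f) (n, \<mu>) = (\<Sum>b\<in>keys f. zsign (fst b) a *
     lookup (Bop \<sigma> a (N - \<sigma> * lookup (fst b) a) (single b (lookup f b))) (m, \<mu>))"
    by (simp add: Psi_def lookup_sum lookup_zpow_mult m)
  also have "\<dots> = (\<Sum>b\<in>keys f. zsign m a *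
     lookup (Bop \<sigma> a (N - \<sigma> * lookup m a) (single b (lookup f b))) (m, \<mu>))"
  proof (rule sum.cong[OF refl])
    fix b
    have "homogeneous (fst b) (Bop \<sigma> a M (single b (lookup f b)))" for M
      by (intro homogeneous_Bop) (metis homogeneous_single prod.collapse)
    then have "fst b \<noteq> m \<Longrightarrow> lookup (Bop \<sigma> a M (single b (lookup f b))) (m, \<mu>) = 0" for M
      by (auto simp: homogeneous_def)
    then show "zsign (fst b) a * lookup (Bop \<sigma> a (N - \<sigma> * lookup (fst b) a) (single b (lookup f b))) (m, \<mu>) =
      zsign m a * lookup (Bop \<sigma> a (N - \<sigma> * lookup m a) (single b (lookup f b))) (m, \<mu>)"
      by (cases "fst b = m") auto
  qed
  also have "\<dots> = zsign m a * lookup (Bop \<sigma> a (N - \<sigma> * lookup m a) (\<Sum>b\<in>keys f. single b (lookup f b))) (m, \<mu>)"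
    by (simp add: Bop_linear_sum lookup_sum sum_distrib_left)
  finally show ?thesis unfolding boson_sum_single[of f, symmetric] .
qed

lemma zsign_add: "zsign (n + k) a = zsign n a * zsign k a"
  by (simp add: zsign_def lookup_add sum.distrib power_int_add)

lemma zsign_single:
  assumes "\<sigma> = 1 \<or> \<sigma> = -1"
  shows "zsign (single b \<sigma>) a = (if 1 \<le> b \<and> b < a then -1 else 1)"
proof -
  have "(\<Sum>c=1..<a. lookup (single b \<sigma>) c) = (if 1 \<le> b \<and> b < a then \<sigma> else 0)"
    by (simp only: lookup_single when_def sum.delta' finite_atLeastLessThan atLeastLessThan_iff)
  then show ?thesis using assms unfolding zsign_def by auto
qed

lemma zsign_square: "zsign n a * zsign n a = 1"
  by (cases "even (\<Sum>b=1..<a. lookup n b)") (auto simp: zsign_def power_int_minus_left)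

lemma zpow_mult: "zpow n * zpow m = zpow (n + m)"
  by (simp add: zpow_def mult_single)

lemma zpow_0 [simp]: "zpow 0 = 1"
  by (simp add: zpow_def zero_prod_def[symmetric])

section \<open>The canonical anticommutation relations\<close>

lemma Psi_Psi:
  assumes "homogeneous n f"
  shows "Psi \<sigma> a M (Psi \<rho> b N f) = bconst (zsign (n + single b \<rho>) a * zsign n b) *
    (zpow (single a \<sigma> + single b \<rho>) *
     Bop \<sigma> a (M - \<sigma> * lookup (n + single b \<rho>) a) (Bop \<rho> b (N - \<rho> * lookup n b) f))"
  unfolding Psi_homogeneous[OF homogeneous_Psi[OF assms]] unfolding Psi_homogeneous[OF assms]
  by (simp add: boson_linear_scale[OF boson_linear_Bop] Bop_zpow_mult bconst_mult zpow_mult[symmetric] mult_ac)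

text \<open>The Bernstein parts commute, and in exactly one of the two orders R passes over a unit
  of charge in a smaller component. The sum in \<open>zsign\<close> starts at component 1, hence the
  lower bounds on \<open>a\<close> and \<open>b\<close>.\<close>

lemma Psi_Psi_other:
  assumes "homogeneous n f" "a \<noteq> b" "a \<ge> 1" "b \<ge> 1" "\<sigma> = 1 \<or> \<sigma> = -1" "\<rho> = 1 \<or> \<rho> = -1"
  shows "Psi \<sigma> a M (Psi \<rho> b N f) = - Psi \<rho> b N (Psi \<sigma> a M f)"
proof -
  have "zsign (n + single b \<rho>) a * zsign n b = - (zsign (n + single a \<sigma>) b * zsign n a)"
    unfolding zsign_add zsign_single[OF assms(5)] zsign_single[OF assms(6)]
    using assms(2-4) by (cases "a < b") auto
  moreover have "lookup (n + single b \<rho>) a = lookup n a" "lookup (n + single a \<sigma>) b = lookup n b"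
    using assms(2) by (auto simp: lookup_add lookup_single when_def)
  ultimately show ?thesis
    unfolding Psi_Psi[OF assms(1)]
    by (simp add: Bop_commute_other[OF assms(2)] bconst_uminus add.commute)
qed

text \<open>For equal components the outer mode sees the charge changed by \<sigma>, which lowers
  its index by \<sigma> \<sigma> = 1. This is just the shift in
  \<open>Bop_anticommute\<close>.\<close>

lemma Psi_anticommute:
  assumes "a \<ge> 1" "b \<ge> 1" and sgn: "\<sigma> = 1 \<or> \<sigma> = -1"
  shows "Psi \<sigma> a M (Psi \<sigma> b N f) = - Psi \<sigma> b N (Psi \<sigma> a M f)"
proof -
  have 1: "Psi \<sigma> a M (Psi \<sigma> b N f) + Psi \<sigma> b N (Psi \<sigma> a M f) = 0" if f: "f = single (n, \<mu>) 1" for f n \<mu>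
  proof -
    have h: "homogeneous n f" unfolding f by (rule homogeneous_single)
    show ?thesis
    proof (cases "a = b")
      case False
      then show ?thesis using Psi_Psi_other[OF h False assms(1,2) sgn sgn] by simp
    next
      case True
      have z: "zsign (n + single b \<sigma>) b = zsign n b"
        unfolding zsign_add zsign_single[OF sgn] by simp
      have l: "\<sigma> * lookup (n + single b \<sigma>) b = \<sigma> * lookup n b + 1"
        using sgn by (auto simp: lookup_add algebra_simps)
      show ?thesis
        using Bop_anticommute[OF sgn, of b "M - (\<sigma> * lookup n b + 1)" "N - \<sigma> * lookup n b" f]
        unfolding Psi_Psi[OF h] True z l by (simp add: algebra_simps)
    qed
  qed
  have "Psi \<sigma> a M (Psi \<sigma> b N f) + Psi \<sigma> b N (Psi \<sigma> a M f) = 0"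
  proof (rule boson_linear_eqI[where f = f])
    show "boson_linear (\<lambda>f. Psi \<sigma> a M (Psi \<sigma> b N f) + Psi \<sigma> b N (Psi \<sigma> a M f))"
      by (rule boson_linear_plus;
          rule boson_linear_compose[of "Psi \<sigma> _ _" "Psi \<sigma> _ _", OF boson_linear_Psi boson_linear_Psi])
    show "Psi \<sigma> a M (Psi \<sigma> b N (single d 1)) + Psi \<sigma> b N (Psi \<sigma> a M (single d 1)) = 0" for d
      by (rule 1[of _ "fst d" "snd d"]) simp
  qed (rule boson_linear_zero)
  then show ?thesis by (simp add: eq_neg_iff_add_eq_0)
qed

text \<open>The contraction condition reads M + N = -1 because modes i and -i belong to the powers
  -i - 1/2 and i - 1/2 of u.\<close>

lemma Psi_opposite:
  assumes "a \<ge> 1" "b \<ge> 1" and sgn: "\<sigma> = 1 \<or> \<sigma> = -1"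
  shows "Psi \<sigma> a M (Psi (- \<sigma>) b N f) + Psi (- \<sigma>) b N (Psi \<sigma> a M f) =
    (if a = b \<and> M + N = -1 then f else 0)"
proof -
  have sgn': "- \<sigma> = 1 \<or> - \<sigma> = -1" using sgn by auto
  have 1: "Psi \<sigma> a M (Psi (- \<sigma>) b N f) + Psi (- \<sigma>) b N (Psi \<sigma> a M f) =
    bconst (if a = b \<and> M + N = -1 then 1 else 0) * f" if f: "f = single (n, \<mu>) 1" for f n \<mu>
  proof -
    have h: "homogeneous n f" unfolding f by (rule homogeneous_single)
    show ?thesis
    proof (cases "a = b")
      case False
      then show ?thesis using Psi_Psi_other[OF h False assms(1,2) sgn sgn'] by simp
    next
      case True
      have z: "zsign (n + single b \<rho>) b = zsign n b" if "\<rho> = 1 \<or> \<rho> = -1" for \<rho>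
        unfolding zsign_add zsign_single[OF that] by simp
      have l: "\<sigma> * lookup (n + single b (- \<sigma>)) b = \<sigma> * lookup n b - 1"
        "- \<sigma> * lookup (n + single b \<sigma>) b = - \<sigma> * lookup n b - 1"
        using sgn by (auto simp: lookup_add algebra_simps)
      have s: "single b \<sigma> + single b (- \<sigma>) = 0" "single b (- \<sigma>) + single b \<sigma> = 0"
        by (simp_all add: single_add[symmetric])
      let ?k = "\<sigma> * lookup n b"
      have B: "Bop \<sigma> b (M - (?k - 1)) (Bop (- \<sigma>) b (N - - \<sigma> * lookup n b) f)
          + Bop (- \<sigma>) b (N - (- \<sigma> * lookup n b - 1)) (Bop \<sigma> b (M - ?k) f)
          = bconst (if M + N = -1 then 1 else 0) * f"
      proof -
        have e: "M - (?k - 1) = M - ?k + 1" "N - - \<sigma> * lookup n b = N + ?k"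
          "N - (- \<sigma> * lookup n b - 1) = N + ?k + 1" "M - ?k = (M - ?k + 1) - 1" by auto
        have c: "(M - ?k + 1 + (N + ?k) = 0) = (M + N = -1)" by auto
        show ?thesis
          unfolding e(2,3) unfolding e(1) unfolding e(4)[THEN arg_cong[where f = "\<lambda>x. Bop \<sigma> b x f"]]
          using Bop_opposite[OF sgn, of b "M - ?k + 1" "N + ?k" f] unfolding c by simp
      qed
      show ?thesis
        unfolding Psi_Psi[OF h] True z[OF sgn] z[OF sgn'] l s zsign_square
        using B by simp
    qed
  qed
  have "Psi \<sigma> a M (Psi (- \<sigma>) b N f) + Psi (- \<sigma>) b N (Psi \<sigma> a M f) =
    bconst (if a = b \<and> M + N = -1 then 1 else 0) * f"
  proof (rule boson_linear_eqI[where f = f])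
    show "boson_linear (\<lambda>f. Psi \<sigma> a M (Psi (- \<sigma>) b N f) + Psi (- \<sigma>) b N (Psi \<sigma> a M f))"
      by (rule boson_linear_plus;
          rule boson_linear_compose[of "Psi _ _ _" "Psi _ _ _", OF boson_linear_Psi boson_linear_Psi])
    show "boson_linear (\<lambda>f. bconst (if a = b \<and> M + N = -1 then 1 else 0) * f)"
      by (rule boson_linear_mult[OF boson_linear_id])
    show "Psi \<sigma> a M (Psi (- \<sigma>) b N (single d 1)) + Psi (- \<sigma>) b N (Psi \<sigma> a M (single d 1)) =
      bconst (if a = b \<and> M + N = -1 then 1 else 0) * single d 1" for d
      by (rule 1[of _ "fst d" "snd d"]) simp
  qed
  then show ?thesis by auto
qed

lemma Psi_bounded: "\<exists>n. \<forall>N<n. Psi \<sigma> a N f = 0"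
proof -
  have "\<exists>n. \<forall>N<n. Psi \<sigma> a N (single (m, \<mu>) 1) = 0" for m \<mu>
  proof -
    obtain n where n: "\<And>\<sigma> a i. i > n \<Longrightarrow> Qc \<sigma> a i (single (m, \<mu>) 1) = 0"
      using Qc_bounded_nonneg[of "single (m, \<mu>) 1"] by blast
    have "Psi \<sigma> a N (single (m, \<mu>) 1) = 0" if "N < \<sigma> * lookup m a - n" for N
      unfolding Psi_homogeneous[OF homogeneous_single]
      using that by (subst Bop_eq_0[where n = n, OF n]) auto
    then show ?thesis by blast
  qed
  then have "\<forall>b. \<exists>n. \<forall>N<n. Psi \<sigma> a N (single b 1) = 0" by (metis prod.collapse)
  then obtain c where c: "\<And>b N. N < c b \<Longrightarrow> Psi \<sigma> a N (single b 1) = 0" by metis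
  have "Psi \<sigma> a N f = 0" if N: "N < Min (insert 0 (c ` keys f))" for N
  proof -
    have "Psi \<sigma> a N (single b (lookup f b)) = 0" if "b \<in> keys f" for b
      using N that by (subst boson_linear_single[OF boson_linear_Psi]) (simp add: c)
    then have "Psi \<sigma> a N (\<Sum>b\<in>keys f. single b (lookup f b)) = 0"
      by (simp add: Psi_linear_sum)
    then show ?thesis unfolding boson_sum_single[of f, symmetric] .
  qed
  then show ?thesis by blast
qed


section \<open>Operator series acting on bosons\<close>

text \<open>Only the action on finite bosons is transported from the completed space; all states to
  which the bilinear equation is applied below are of this kind.\<close>

definition implements :: "opseries \<Rightarrow> (int \<Rightarrow> boson \<Rightarrow> boson) \<Rightarrow> bool" where
  "implements X L \<longleftrightarrow> (\<forall>N f. X N (lookup f) = lookup (L N f))"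

text \<open>For given \<open>b\<close> the first exponent determines the second, so the sum in
  \<open>mult_op\<close> is finite and can be cut down to the support of \<open>f\<close>.\<close>

lemma mult_op_lookup: "mult_op P (lookup f) = lookup (P * f)"
proof
  fix b :: fock_basis
  let ?S0 = "{(c, d). c \<in> keys P \<and> c + d = b}"
  let ?S1 = "{(c, d). c \<in> keys P \<and> d \<in> keys f \<and> c + d = b}"
  have S1: "?S1 = {x \<in> keys P \<times> keys f. case x of (c, d) \<Rightarrow> c + d = b}" by auto
  have "inj_on fst ?S0" by (auto simp: inj_on_def)
  moreover have "fst ` ?S0 \<subseteq> keys P" by auto
  ultimately have fin: "finite ?S0" by (rule inj_on_finite) simp
  have "lookup (P * f) b = lookup (\<Sum>c\<in>keys P. bconst (lookup P c) * (single c 1 * f)) b"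
    by (subst boson_sum_single[of P])
       (simp add: sum_distrib_right mult.assoc[symmetric] single_eq_bconst_mult[of _ "lookup P _", symmetric])
  also have "\<dots> = (\<Sum>c\<in>keys P. \<Sum>d\<in>keys f. if c + d = b then lookup P c * lookup f d else 0)"
    by (simp add: lookup_sum lookup_single_mult sum_distrib_left when_def if_distrib eq_commute[of b] cong: if_cong)
  also have "\<dots> = (\<Sum>x\<in>keys P \<times> keys f. if (case x of (c, d) \<Rightarrow> c + d = b)
      then (case x of (c, d) \<Rightarrow> lookup P c * lookup f d) else 0)"
    unfolding sum.cartesian_product by (rule sum.cong) auto
  also have "\<dots> = (\<Sum>(c, d)\<in>?S1. lookup P c * lookup f d)"
    unfolding S1 by (rule sum.inter_filter[symmetric]) simp
  also have "\<dots> = (\<Sum>(c, d)\<in>?S0. lookup P c * lookup f d)"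
    by (rule sum.mono_neutral_left[OF fin]) (auto simp: in_keys_iff)
  finally show "mult_op P (lookup f) b = lookup (P * f) b" by (simp add: mult_op_def)
qed

text \<open>The substitution t := c t; with c = -1 it accounts for the arguments -u in the two
  fermion fields.\<close>

lemma exp_coeff_scale:
  assumes "\<And>j. boson_linear (D j)" "\<And>j f. D' j f = bconst (c ^ j) * D j f"
  shows "exp_coeff D' v n = bconst (c ^ n) * exp_coeff D v n"
proof -
  have "exp_pow D' v k n = bconst (c ^ n) * exp_pow D v k n" for k
  proof (induction k arbitrary: n)
    case (Suc k)
    have "D' j (exp_pow D' v k (n - j)) = bconst (c ^ n) * D j (exp_pow D v k (n - j))" if "j \<in> {1..n}" for j
    proof -
      have "c ^ n = c ^ j * c ^ (n - j)" using that by (simp flip: power_add)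
      then show ?thesis
        by (simp add: Suc assms(2) boson_linear_scale[OF assms(1)] bconst_mult mult.assoc)
    qed
    then show ?case by (simp add: sum_distrib_left)
  qed simp
  then show ?thesis by (simp add: exp_coeff_def sum_distrib_left mult.left_commute)
qed

lemma fps_nth_boson_exp:
  assumes "fps_nth F 0 = 0"
  shows "fps_nth (boson_exp F) n = exp_coeff (\<lambda>j f. fps_nth F j * f) 1 n"
proof -
  have "fps_nth (F ^ k) n = exp_pow (\<lambda>j f. fps_nth F j * f) 1 k n" for k
  proof (induction k arbitrary: n)
    case (Suc k)
    have "fps_nth (F ^ Suc k) n = (\<Sum>i=0..n. fps_nth F i * fps_nth (F ^ k) (n - i))"
      by (simp add: fps_mult_nth)
    also have "\<dots> = (\<Sum>i=1..n. fps_nth F i * fps_nth (F ^ k) (n - i))"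
      by (rule sum.mono_neutral_right) (use assms in \<open>auto simp: Suc_le_eq\<close>)
    finally show ?case by (simp add: Suc)
  qed simp
  then show ?thesis by (simp add: boson_exp_def exp_coeff_def)
qed

lemma fps_nth_Hser: "fps_nth (Hser a) n = Gc 1 a (int n)"
proof -
  \<comment> \<open>At j = 0 both sides vanish, the right one because 1 / 0 = 0.\<close>
  have "(\<lambda>j f. fps_nth (Abs_fps (\<lambda>n. if n = 0 then 0 else bconst (1 / of_nat n) * pvar a n)) j * f) = gen_op 1 a"
    by (intro ext) (simp add: gen_op_def)
  then show ?thesis by (simp add: Hser_def fps_nth_boson_exp Gc_nat)
qed

lemma fps_nth_Eser: "fps_nth (Eser a) n = bconst ((-1) ^ n) * Gc (-1) a (int n)"
proof -
  let ?F = "- Abs_fps (\<lambda>n. if n = 0 then 0 else bconst ((-1) ^ n / of_nat n) * pvar a n)"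
  have "fps_nth ?F j * f = bconst ((-1) ^ j) * gen_op (-1) a j f" for j f
  proof -
    have "bconst ((-1) ^ j) * bconst (- 1 / of_nat j) = - bconst ((-1) ^ j / of_nat j)"
      by (simp flip: bconst_mult bconst_uminus)
    then show ?thesis by (simp add: gen_op_def mult.assoc[symmetric])
  qed
  moreover have "boson_linear (gen_op (-1) a j)" for j
    using commuting_gen_op by (simp add: commuting_def)
  ultimately have "exp_coeff (\<lambda>j f. fps_nth ?F j * f) 1 n = bconst ((-1) ^ n) * exp_coeff (gen_op (-1) a) 1 n"
    by (intro exp_coeff_scale) auto
  then show ?thesis by (simp only: Eser_def Gc_nat) (simp add: fps_nth_boson_exp)
qed

lemma implements_ops_of_fps:
  "implements (ops_of_fps F) (\<lambda>j f. if j < 0 then 0 else fps_nth F (nat j) * f)"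
  by (auto simp: implements_def ops_of_fps_def mult_op_lookup fun_eq_iff)

lemma implements_Hser: "implements (ops_of_fps (Hser a)) (\<lambda>j f. Gc 1 a j * f)"
proof -
  have "(\<lambda>j f. if j < 0 then 0 else fps_nth (Hser a) (nat j) * f) = (\<lambda>j f. Gc 1 a j * f)"
    by (intro ext) (simp add: fps_nth_Hser)
  then show ?thesis using implements_ops_of_fps[of "Hser a"] by simp
qed

lemma implements_ops_neg:
  assumes "implements X L"
  shows "implements (ops_neg X) (\<lambda>j f. bconst ((-1) powi j) * L j f)"
  using assms unfolding implements_def ops_neg_def by (simp add: fun_eq_iff)

lemma implements_Eser: "implements (ops_neg (ops_of_fps (Eser a))) (\<lambda>j f. Gc (-1) a j * f)"
proof -
  have "bconst ((-1) powi j) * (if j < 0 then 0 else fps_nth (Eser a) (nat j) * f) = Gc (-1) a j * f" for j f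
  proof (cases "j < 0")
    case False
    have "bconst ((-1) powi j) * (bconst ((-1) ^ nat j) * x) = x" for x
      using False by (simp add: mult.assoc[symmetric] power_int_def flip: bconst_mult power_mult_distrib)
    then show ?thesis using False by (simp add: fps_nth_Eser mult.assoc)
  qed simp
  then show ?thesis using implements_ops_neg[OF implements_ops_of_fps[of "Eser a"]] by simp
qed

text \<open>The exponent contains only negative powers of u, so the coefficient at \<open>N\<close>
  is the one of t^(-N) for t = 1/u, and the sums over all integers reduce to those of
  \<open>exp_pow\<close>.\<close>

lemma implements_ops_exp:
  assumes X: "\<And>j v b. j \<ge> 0 \<Longrightarrow> X j v b = 0" and D: "commuting D"
    and XD: "\<And>k f. k \<ge> 1 \<Longrightarrow> X (- int k) (lookup f) = lookup (D k f)"
  shows "implements (ops_exp X) (\<lambda>N f. if N > 0 then 0 else exp_coeff D f (nat (- N)))"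
proof -
  have lin: "boson_linear (D j)" for j using D by (simp add: commuting_def)
  have pow: "(ops_comp X ^^ k) ops_one N (lookup f) = lookup (if N > 0 then 0 else exp_pow D f k (nat (- N)))"
    for k N f
  proof (induction k arbitrary: N)
    case 0
    show ?case by (auto simp: ops_one_def fun_eq_iff)
  next
    case (Suc k)
    let ?Y = "(ops_comp X ^^ k) ops_one"
    show ?case
    proof
      fix b
      \<comment> \<open>For j \<ge> 0 the outer operator vanishes; for j < N the inner power would
        have positive index and is 0.\<close>
      have nz: "X j (?Y (N - j) (lookup f)) b = 0" if "j \<notin> {N..-1}" for j
      proof (cases "j \<ge> 0")
        case False
        then have "N - j > 0" using that by auto
        moreover have "1 \<le> nat (- j)" using False by simp
        ultimately have "X j (?Y (N - j) (lookup f)) = lookup (D (nat (- j)) 0)"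
          using XD[of "nat (- j)" 0] False by (simp add: Suc del: lookup_zero)
        then show ?thesis by (simp add: boson_linear_0[OF lin])
      qed (simp add: X)
      have "(ops_comp X ^^ Suc k) ops_one N (lookup f) b = Sum_any (\<lambda>j. X j (?Y (N - j) (lookup f)) b)"
        by (simp add: ops_comp_def)
      also have "\<dots> = (\<Sum>j=N..-1. X j (?Y (N - j) (lookup f)) b)"
        by (rule Sum_any.expand_superset) (use nz in blast)+
      also have "\<dots> = (\<Sum>i=1..nat (- N). lookup (D i (exp_pow D f k (nat (- N) - i))) b)"
      proof (rule sum.reindex_bij_witness[of _ "\<lambda>i. - int i" "\<lambda>j. nat (- j)"])
        fix j assume j: "j \<in> {N..-1}"
        have "nat (- (N - j)) = nat (- N) - nat (- j)" using j by auto
        then show "lookup (D (nat (- j)) (exp_pow D f k (nat (- N) - nat (- j)))) b = X j (?Y (N - j) (lookup f)) b"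
          using j XD[of "nat (- j)" "exp_pow D f k (nat (- (N - j)))"] by (simp add: Suc le_nat_iff)
      qed auto
      also have "\<dots> = lookup (if N > 0 then 0 else exp_pow D f (Suc k) (nat (- N))) b"
        by (simp add: lookup_sum)
      finally show "(ops_comp X ^^ Suc k) ops_one N (lookup f) b =
        lookup (if N > 0 then 0 else exp_pow D f (Suc k) (nat (- N))) b" .
    qed
  qed
  show ?thesis unfolding implements_def
  proof (intro allI ext)
    fix N f b
    have "ops_exp X N (lookup f) b =
        (\<Sum>k\<le>nat (- N). 1 / fact k * (ops_comp X ^^ k) ops_one N (lookup f) b)"
      unfolding ops_exp_def
    proof (rule Sum_any.expand_superset)
      have "k \<le> nat (- N)" if "lookup (exp_pow D f k (nat (- N))) b \<noteq> 0" for k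
        using exp_pow_eq_0[OF D, of "nat (- N)" k f] that by (cases "k > nat (- N)") auto
      then show "{k. 1 / fact k * (ops_comp X ^^ k) ops_one N (lookup f) b \<noteq> 0} \<subseteq> {..nat (- N)}"
        by (auto simp: pow)
    qed simp
    then show "ops_exp X N (lookup f) b = lookup (if N > 0 then 0 else exp_coeff D f (nat (- N))) b"
      by (simp add: pow exp_coeff_def lookup_sum)
  qed
qed

lemma implements_Hperp: "implements (Hperp a) (\<lambda>j. Qc (-1) a (- j))"
proof -
  have "implements (Hperp a) (\<lambda>N f. if N > 0 then 0 else exp_coeff (shift_op (-1) a) f (nat (- N)))"
    unfolding Hperp_def
    by (rule implements_ops_exp[OF _ commuting_shift_op]) (auto simp: shift_op_def lookup_pd)
  moreover have "(\<lambda>N f. if N > 0 then 0 else exp_coeff (shift_op (-1) a) f (nat (- N))) = (\<lambda>j. Qc (-1) a (- j))"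
    by (intro ext) (simp add: Qc_def)
  ultimately show ?thesis by simp
qed

lemma implements_Eperp: "implements (ops_neg (Eperp a)) (\<lambda>j. Qc 1 a (- j))"
proof -
  define D where "D k f = bconst ((-1) ^ k) * shift_op 1 a k f" for k f
  have lin: "boson_linear (D k)" for k
    unfolding D_def by (rule boson_linear_mult[OF boson_linear_shift_op])
  have "commuting D"
    unfolding commuting_def using lin
    by (auto simp: D_def boson_linear_scale[OF boson_linear_shift_op] shift_op_commute[of 1 a _ 1 a] mult.left_commute)
  then have "implements (Eperp a) (\<lambda>N f. if N > 0 then 0 else exp_coeff D f (nat (- N)))"
    unfolding Eperp_def
    by (rule implements_ops_exp[rotated]) (auto simp: D_def shift_op_def lookup_pd bconst_uminus fun_eq_iff)
  from implements_ops_neg[OF this]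
  have "implements (ops_neg (Eperp a))
     (\<lambda>j f. bconst ((-1) powi j) * (if j > 0 then 0 else exp_coeff D f (nat (- j))))" .
  moreover have "bconst ((-1) powi j) * (if j > 0 then 0 else exp_coeff D f (nat (- j))) = Qc 1 a (- j) f" for j f
  proof (cases "j > 0")
    case False
    have "bconst ((-1) powi j) * (bconst ((-1) ^ nat (- j)) * x) = x" for x
      using False by (simp add: mult.assoc[symmetric] power_int_def flip: bconst_mult power_mult_distrib)
    moreover have "exp_coeff D f (nat (- j)) = bconst ((-1) ^ nat (- j)) * exp_coeff (shift_op 1 a) f (nat (- j))"
      by (rule exp_coeff_scale) (auto simp: boson_linear_shift_op D_def)
    ultimately show ?thesis using False by (simp add: Qc_def)
  qed (simp add: Qc_def)
  ultimately show ?thesis by simp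
qed

lemma implements_Bop:
  assumes X: "implements X (\<lambda>j f. Gc \<sigma> a j * f)" and Y: "implements Y (\<lambda>j. Qc \<sigma> a (- j))"
  shows "implements (ops_comp X Y) (Bop \<sigma> a)"
  unfolding implements_def
proof (intro allI ext)
  fix M f b
  obtain n where "n \<ge> 0" and n: "\<And>\<sigma> a i. i > n \<Longrightarrow> Qc \<sigma> a i f = 0"
    using Qc_bounded_nonneg[of f] by blast
  have e: "X j (Y (M - j) (lookup f)) b = lookup (Gc \<sigma> a j * Qc \<sigma> a (j - M) f) b" for j
    using X Y by (simp add: implements_def)
  have "ops_comp X Y M (lookup f) b = (\<Sum>j=M..M+n. lookup (Gc \<sigma> a j * Qc \<sigma> a (j - M) f) b)"
    unfolding ops_comp_def e
  proof (rule Sum_any.expand_superset)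
    show "{j. lookup (Gc \<sigma> a j * Qc \<sigma> a (j - M) f) b \<noteq> 0} \<subseteq> {M..M + n}"
    proof (rule subsetI, rule ccontr)
      fix j assume j: "j \<in> {j. lookup (Gc \<sigma> a j * Qc \<sigma> a (j - M) f) b \<noteq> 0}" "j \<notin> {M..M + n}"
      then have "Qc \<sigma> a (j - M) f = 0" by (cases "j < M") (auto simp: n)
      then show False using j by simp
    qed
  qed simp
  also have "\<dots> = (\<Sum>i=0..n. lookup (Gc \<sigma> a (M + i) * Qc \<sigma> a i f) b)"
    by (rule sum.reindex_bij_witness[of _ "\<lambda>i. M + i" "\<lambda>j. j - M"]) auto
  also have "\<dots> = lookup (Bop \<sigma> a M f) b"
    by (simp add: Bop_eq[where \<sigma> = \<sigma> and a = a and f = f and n = n, OF n] lookup_sum)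
  finally show "ops_comp X Y M (lookup f) b = lookup (Bop \<sigma> a M f) b" .
qed

lemma implements_Psi:
  assumes Y: "implements Y (Bop \<sigma> a)"
  shows "implements (ops_comp (Rop \<sigma> a) Y) (Psi \<sigma> a)"
  unfolding implements_def
proof (intro allI ext)
  fix N f and b :: fock_basis
  obtain n \<mu> where b: "b = (n, \<mu>)" by (cases b)
  define m where "m = n - single a \<sigma>"
  have "ops_comp (Rop \<sigma> a) Y N (lookup f) b =
      (\<Sum>j\<in>{\<sigma> * lookup m a}. Rop \<sigma> a j (Y (N - j) (lookup f)) b)"
    unfolding ops_comp_def by (rule Sum_any.expand_superset) (auto simp: Rop_def b m_def Let_def)
  also have "\<dots> = zsign m a * lookup (Bop \<sigma> a (N - \<sigma> * lookup m a) f) (m, \<mu>)"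
    using Y by (simp add: Rop_def b m_def zsign_def implements_def Let_def)
  also have "\<dots> = lookup (Psi \<sigma> a N f) b"
    unfolding b by (rule lookup_Psi[OF m_def, symmetric])
  finally show "ops_comp (Rop \<sigma> a) Y N (lookup f) b = lookup (Psi \<sigma> a N f) b" .
qed

lemma psi_plus_lookup: "psi_plus a N (lookup f) = lookup (Psi 1 a N f)"
  using implements_Psi[OF implements_Bop[OF implements_Hser implements_Eperp, of a]]
  by (simp add: psi_plus_def implements_def)

lemma psi_minus_lookup: "psi_minus a N (lookup f) = lookup (Psi (-1) a N f)"
  using implements_Psi[OF implements_Bop[OF implements_Eser implements_Hperp, of a]]
  by (simp add: psi_minus_def implements_def)

lemma Psi_bounded_uniform: "\<exists>K\<ge>0. \<forall>\<sigma>\<in>{1,-1}. \<forall>a\<in>{1..s}. \<forall>N. N < - K \<longrightarrow> Psi \<sigma> a N f = 0"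
proof -
  have "\<exists>n. \<forall>N<n. Psi (fst x) (snd x) N f = 0" for x by (rule Psi_bounded)
  then obtain c where c: "\<And>x N. N < c x \<Longrightarrow> Psi (fst x) (snd x) N f = 0" by metis
  let ?S = "{1,-1} \<times> {1..s}"
  let ?m = "Min (insert 0 (c ` ?S))"
  have "Psi \<sigma> a N f = 0" if "\<sigma> \<in> {1,-1}" "a \<in> {1..s}" "N < ?m" for \<sigma> a N
  proof -
    have "?m \<le> c (\<sigma>, a)" using that by (intro Min_le) auto
    then have "N < c (\<sigma>, a)" using that(3) by (rule order.strict_trans2[rotated])
    then show ?thesis using c[of N "(\<sigma>, a)"] by simp
  qed
  moreover have "?m \<le> 0" by (intro Min_le) auto
  ultimately show ?thesis by (intro exI[of _ "- ?m"]) auto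
qed

text \<open>After the two recodings of modes, the coefficient of u^(-k-1) in \<psi>^+ is paired with
  that of u^k in \<psi>^-.\<close>

lemma Omega_eq:
  assumes "finite S"
    "\<And>a k. a \<in> {1..s} \<Longrightarrow> k \<notin> S \<Longrightarrow> Psi 1 a (- k - 1) f = 0 \<or> Psi (-1) a k g = 0"
  shows "Omega s (lookup f) (lookup g) b b' =
    (\<Sum>a=1..s. \<Sum>k\<in>S. lookup (Psi 1 a (- k - 1) f) b * lookup (Psi (-1) a k g) b')"
  unfolding Omega_def psi_plus_mode_def psi_minus_mode_def psi_plus_lookup psi_minus_lookup
proof (rule sum.cong[OF refl])
  fix a assume a: "a \<in> {1..s}"
  let ?F = "\<lambda>k. lookup (Psi 1 a (- k - 1) f) b * lookup (Psi (-1) a k g) b'"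
  have "?F k = 0" if "k \<notin> S" for k using assms(2)[OF a that] by auto
  then have "Sum_any ?F = sum ?F S" by (intro Sum_any.expand_superset[OF assms(1)]) auto
  then show "Sum_any (\<lambda>k. lookup (Psi 1 a (- k - 1) f) b * lookup (Psi (-1) a (- (- k - 1) - 1) g) b') = sum ?F S"
    by simp
qed


section \<open>The bilinear equation\<close>

definition hirota :: "nat \<Rightarrow> boson \<Rightarrow> bool" where
  "hirota s f \<longleftrightarrow> (\<forall>b b'. Omega s (lookup f) (lookup f) b b' = 0)"

lemma hirotaD: "hirota s f \<Longrightarrow> Omega s (lookup f) (lookup f) b b' = 0"
  unfolding hirota_def by blast

definition fock :: "nat \<Rightarrow> int \<Rightarrow> boson \<Rightarrow> bool" where
  "fock s m f \<longleftrightarrow> lookup f \<in> completed_fock s m"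

lemma tau_function_lookup:
  "tau_function s (lookup f) \<longleftrightarrow> (\<exists>m. fock s m f) \<and> f \<noteq> 0 \<and> hirota s f"
proof -
  have "lookup f = (\<lambda>_. 0) \<longleftrightarrow> f = 0" by (metis lookup_zero poly_mapping_eqI)
  then show ?thesis
    by (auto simp: tau_function_def tau_function_of_charge_def hirota_def fock_def)
qed

lemma polynomial_tau_function_lookup:
  "polynomial_tau_function s (lookup f) \<longleftrightarrow> tau_function s (lookup f)"
  by (auto simp: polynomial_tau_function_def)

lemma Omega_cutoff:
  assumes "\<And>\<sigma> a N. \<sigma> = 1 \<or> \<sigma> = -1 \<Longrightarrow> a \<in> {1..s} \<Longrightarrow> N < - K \<Longrightarrow> Psi \<sigma> a N f = 0"
  shows "Omega s (lookup f) (lookup f) b b' =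
    (\<Sum>a=1..s. \<Sum>k=-K..K. lookup (Psi 1 a (- k - 1) f) b * lookup (Psi (-1) a k f) b')"
proof (rule Omega_eq)
  fix a k assume "a \<in> {1..s}" "k \<notin> {-K..K}"
  then show "Psi 1 a (- k - 1) f = 0 \<or> Psi (-1) a k f = 0"
    using assms[of 1 a "- k - 1"] assms[of "-1" a k] by (cases "k < - K") auto
qed simp

lemma Psi_cutoff:
  "\<exists>K\<ge>0. \<forall>\<sigma> a N. \<sigma> = 1 \<or> \<sigma> = -1 \<longrightarrow> a \<in> {1..s} \<longrightarrow> N < - K \<longrightarrow> Psi \<sigma> a N f = 0"
proof -
  obtain K where "K \<ge> 0" "\<forall>\<sigma>\<in>{1,-1}. \<forall>a\<in>{1..s}. \<forall>N. N < - K \<longrightarrow> Psi \<sigma> a N f = 0"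
    using Psi_bounded_uniform[where s = s and f = f] by blast
  then show ?thesis by (intro exI[of _ K]) auto
qed

text \<open>A vanishing tensor, evaluated at one basis vector of the second factor, is a linear
  relation among the \<open>x i\<close>, and \<open>L\<close> preserves it.\<close>

lemma tensor_map_left:
  assumes L: "boson_linear L" and 0: "\<And>b. (\<Sum>i\<in>I. lookup (x i) b * y i) = 0"
  shows "(\<Sum>i\<in>I. lookup (L (x i)) b * y i) = 0"
proof -
  have "(\<Sum>i\<in>I. y i * lookup (x i) b) = 0" for b
    using 0[of b] by (simp add: mult.commute)
  then have "(\<Sum>i\<in>I. bconst (y i) * x i) = 0"
    by (intro poly_mapping_eqI) (simp add: lookup_sum)
  then have "L (\<Sum>i\<in>I. bconst (y i) * x i) = 0" by (simp add: boson_linear_0[OF L])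
  then have "lookup (\<Sum>i\<in>I. bconst (y i) * L (x i)) b = 0"
    by (simp add: boson_linear_sum[OF L] boson_linear_scale[OF L])
  then show ?thesis by (simp add: lookup_sum mult.commute)
qed

lemma tensor_map:
  assumes "boson_linear L" "boson_linear M" "\<And>b b'. (\<Sum>i\<in>I. lookup (x i) b * lookup (y i) b') = 0"
  shows "(\<Sum>i\<in>I. lookup (L (x i)) b * lookup (M (y i)) b') = 0"
proof -
  have 1: "(\<Sum>i\<in>I. lookup (L (x i)) b * lookup (y i) b') = 0" for b b'
    by (rule tensor_map_left[OF assms(1)]) (rule assms(3))
  have "(\<Sum>i\<in>I. lookup (M (y i)) b' * lookup (L (x i)) b) = 0"
    by (rule tensor_map_left[OF assms(2)]) (use 1 in \<open>simp add: mult.commute\<close>)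
  then show ?thesis by (simp add: mult.commute)
qed

text \<open>A vector in the span of the modes of \<psi>^+. Adding a variable to the generating
  series and undoing a removal both consist in applying such a vector.\<close>

definition Xop :: "nat \<Rightarrow> int set \<Rightarrow> (nat \<Rightarrow> int \<Rightarrow> complex) \<Rightarrow> boson \<Rightarrow> boson" where
  "Xop s T w f = (\<Sum>a=1..s. \<Sum>N\<in>T. bconst (w a N) * Psi 1 a N f)"

lemma boson_linear_Xop: "boson_linear (Xop s T w)"
  unfolding Xop_def[abs_def]
  by (rule boson_linear_setsum, rule boson_linear_setsum, rule boson_linear_mult, rule boson_linear_Psi)

lemma Psi_Xop:
  assumes "a \<in> {1..s}"
  shows "Psi 1 a M (Xop s T w f) = - Xop s T w (Psi 1 a M f)"
proof -
  have "Psi 1 a M (Psi 1 b N f) = - Psi 1 b N (Psi 1 a M f)" if "b \<in> {1..s}" for b N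
    using Psi_anticommute[of a b 1 M N f] assms that by simp
  then show ?thesis
    by (simp add: Xop_def Psi_linear_sum Psi_linear_scale
        sum_negf cong: sum.cong_simp)
qed

text \<open>X anticommutes with each mode of \<psi>^+, hence with itself, so 2 X X = 0.\<close>

lemma Xop_Xop: "Xop s T w (Xop s T w f) = 0"
proof -
  have lin: "boson_linear (Xop s T w)" by (rule boson_linear_Xop)
  have "Xop s T w (Xop s T w f) = (\<Sum>a=1..s. \<Sum>N\<in>T. bconst (w a N) * Psi 1 a N (Xop s T w f))"
    unfolding Xop_def[of s T w "Xop s T w f"] ..
  also have "\<dots> = (\<Sum>a=1..s. \<Sum>N\<in>T. bconst (w a N) * - Xop s T w (Psi 1 a N f))"
    by (intro sum.cong refl) (simp only: Psi_Xop)
  also have "\<dots> = - Xop s T w (Xop s T w f)"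
    unfolding Xop_def[of s T w f]
    by (simp add: boson_linear_sum[OF lin] boson_linear_scale[OF lin] sum_negf)
  finally have "of_nat 2 * Xop s T w (Xop s T w f) = of_nat 2 * 0"
    by (simp add: eq_neg_iff_add_eq_0)
  then show ?thesis by (rule of_nat_mult_cancel_boson) simp
qed

text \<open>The anticommutator of X with a mode of \<psi>^- is the weight that X gives to the dual
  mode.\<close>

lemma Psi_minus_Xop:
  assumes "a \<in> {1..s}" "finite T"
  shows "Psi (-1) a k (Xop s T w f) =
    bconst (if - k - 1 \<in> T then w a (- k - 1) else 0) * f - Xop s T w (Psi (-1) a k f)"
proof -
  have P: "Psi (-1) a k (Psi 1 b N f) =
      bconst (if a = b \<and> N = - k - 1 then 1 else 0) * f - Psi 1 b N (Psi (-1) a k f)" if "b \<in> {1..s}" for b N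
  proof -
    have "Psi 1 b N (Psi (-1) a k f) + Psi (-1) a k (Psi 1 b N f) = (if b = a \<and> N + k = -1 then f else 0)"
      using Psi_opposite[of b a 1 N k f] assms(1) that by simp
    moreover have "(N + k = -1) = (N = - k - 1)" by auto
    ultimately show ?thesis by (auto simp: eq_diff_eq add.commute split: if_splits)
  qed
  have "Psi (-1) a k (Xop s T w f) = (\<Sum>b=1..s. \<Sum>N\<in>T. bconst (w b N) * Psi (-1) a k (Psi 1 b N f))"
    by (simp add: Xop_def Psi_linear_sum Psi_linear_scale)
  also have "\<dots> = (\<Sum>b=1..s. \<Sum>N\<in>T. bconst (w b N * (if a = b \<and> N = - k - 1 then 1 else 0)) * f
      - bconst (w b N) * Psi 1 b N (Psi (-1) a k f))"
    by (intro sum.cong refl) (simp only: P right_diff_distrib bconst_mult mult.assoc)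
  also have "\<dots> = bconst (\<Sum>b=1..s. \<Sum>N\<in>T. w b N * (if a = b \<and> N = - k - 1 then 1 else 0)) * f
      - Xop s T w (Psi (-1) a k f)"
    by (simp add: sum_subtractf Xop_def bconst_sum sum_distrib_right)
  also have "(\<Sum>b=1..s. \<Sum>N\<in>T. w b N * (if a = b \<and> N = - k - 1 then 1 else 0)) =
      (\<Sum>b=1..s. if b = a then \<Sum>N\<in>T. if N = - k - 1 then w a (- k - 1) else 0 else 0)"
    by (intro sum.cong refl) (auto intro!: sum.cong)
  also have "\<dots> = (if - k - 1 \<in> T then w a (- k - 1) else 0)"
    using assms by (simp add: sum.delta)
  finally show ?thesis .
qed

text \<open>Moving X \<otimes> X through \<Omega> leaves the image of \<Omega>(f \<otimes> f), which
  is 0, and the contractions of X with \<psi>^- in the second factor. The contractions add up to - X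
  X f \<otimes> f = 0.\<close>

lemma hirota_Xop:
  assumes f: "hirota s f" and T: "finite T"
  shows "hirota s (Xop s T w f)"
  unfolding hirota_def
proof (intro allI)
  fix b b'
  let ?X = "Xop s T w"
  obtain K1 where K1: "\<And>\<sigma> a N. \<sigma> = 1 \<or> \<sigma> = -1 \<Longrightarrow> a \<in> {1..s} \<Longrightarrow> N < - K1 \<Longrightarrow> Psi \<sigma> a N f = 0"
    using Psi_cutoff[of s f] by blast
  obtain K2 where K2: "\<And>\<sigma> a N. \<sigma> = 1 \<or> \<sigma> = -1 \<Longrightarrow> a \<in> {1..s} \<Longrightarrow> N < - K2 \<Longrightarrow> Psi \<sigma> a N (?X f) = 0"
    using Psi_cutoff[of s "?X f"] by blast
  \<comment> \<open>Besides both cutoffs the window has to contain the dual index -N - 1 of every N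
    in T.\<close>
  define K where "K = Max ({K1, K2} \<union> (\<lambda>N. \<bar>N\<bar> + 1) ` T)"
  have "x \<le> K" if "x \<in> {K1, K2} \<union> (\<lambda>N. \<bar>N\<bar> + 1) ` T" for x
    unfolding K_def by (rule Max_ge) (use T that in auto)
  then have K12: "K1 \<le> K" "K2 \<le> K" and KT: "\<And>N. N \<in> T \<Longrightarrow> \<bar>N\<bar> + 1 \<le> K" by auto
  let ?P = "\<lambda>i. Psi 1 (fst i) (- snd i - 1) f" and ?M = "\<lambda>i. Psi (-1) (fst i) (snd i) f"
  let ?I = "{1..s} \<times> {-K..K}"
  define c where "c a k = (if - k - 1 \<in> T then w a (- k - 1) else 0)" for a k
  have PM: "Psi (-1) a k (?X f) = bconst (c a k) * f - ?X (Psi (-1) a k f)" if "a \<in> {1..s}" for a k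
    unfolding c_def by (rule Psi_minus_Xop[OF that T])
  let ?c = "\<lambda>i. c (fst i) (snd i)"
  have "(\<Sum>i\<in>?I. lookup (?P i) b * lookup (?M i) b') = Omega s (lookup f) (lookup f) b b'" for b b'
    by (subst Omega_cutoff[of s K f]) (use K1 K12 in \<open>auto simp: sum.cartesian_product split_def\<close>)
  then have om: "(\<Sum>i\<in>?I. lookup (?P i) b * lookup (?M i) b') = 0" for b b'
    using hirotaD[OF f] by simp
  have cP: "(\<Sum>i\<in>?I. bconst (?c i) * ?P i) = ?X f"
  proof -
    have "(\<Sum>i\<in>?I. bconst (?c i) * ?P i) = (\<Sum>a=1..s. \<Sum>k=-K..K. bconst (?c (a, k)) * ?P (a, k))"
      by (simp add: sum.cartesian_product split_def)
    also have "\<dots> = (\<Sum>a=1..s. \<Sum>N\<in>T. bconst (w a N) * Psi 1 a N f)"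
    proof (rule sum.cong[OF refl])
      fix a
      have "(\<Sum>k=-K..K. bconst (?c (a, k)) * ?P (a, k)) =
          (\<Sum>k\<in>(\<lambda>N. - N - 1) ` T. bconst (?c (a, k)) * ?P (a, k))"
      proof (rule sum.mono_neutral_right)
        show "(\<lambda>N. - N - 1) ` T \<subseteq> {-K..K}" using KT by force
        have "k \<in> (\<lambda>N. - N - 1) ` T" if "- k - 1 \<in> T" for k
          using that by (intro image_eqI[of _ _ "- k - 1"]) auto
        then show "\<forall>k\<in>{-K..K} - (\<lambda>N. - N - 1) ` T. bconst (?c (a, k)) * ?P (a, k) = 0"
          by (auto simp: c_def)
      qed simp
      also have "\<dots> = (\<Sum>N\<in>T. bconst (w a N) * Psi 1 a N f)"
        by (subst sum.reindex) (auto simp: inj_on_def c_def)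
      finally show "(\<Sum>k=-K..K. bconst (?c (a, k)) * ?P (a, k)) = (\<Sum>N\<in>T. bconst (w a N) * Psi 1 a N f)" .
    qed
    finally show ?thesis by (simp add: Xop_def)
  qed
  have "Omega s (lookup (?X f)) (lookup (?X f)) b b' =
      (\<Sum>a=1..s. \<Sum>k=-K..K. lookup (Psi 1 a (- k - 1) (?X f)) b * lookup (Psi (-1) a k (?X f)) b')"
    by (rule Omega_cutoff) (use K2 K12 in auto)
  also have "\<dots> = (\<Sum>a=1..s. \<Sum>k=-K..K. lookup (?X (?P (a, k))) b * lookup (?X (?M (a, k))) b'
      - lookup (?X (bconst (?c (a, k)) * ?P (a, k))) b * lookup f b')"
    by (intro sum.cong refl)
       (simp add: Psi_Xop PM lookup_minus boson_linear_scale[OF boson_linear_Xop], simp add: algebra_simps)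
  also have "\<dots> = (\<Sum>i\<in>?I. lookup (?X (?P i)) b * lookup (?X (?M i)) b')
      - (\<Sum>i\<in>?I. lookup (?X (bconst (?c i) * ?P i)) b) * lookup f b'"
    by (simp add: sum.cartesian_product sum_subtractf sum_distrib_right split_def)
  also have "(\<Sum>i\<in>?I. lookup (?X (?P i)) b * lookup (?X (?M i)) b') = 0"
    by (rule tensor_map[OF boson_linear_Xop boson_linear_Xop om])
  also have "(\<Sum>i\<in>?I. lookup (?X (bconst (?c i) * ?P i)) b) = lookup (?X (?X f)) b"
    by (simp only: cP[symmetric] boson_linear_sum[OF boson_linear_Xop] lookup_sum)
  finally show "Omega s (lookup (?X f)) (lookup (?X f)) b b' = 0"
    by (simp add: Xop_Xop)
qed

text \<open>The contraction now occurs in the first factor and leaves f there, while the second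
  factor carries the square of the applied mode, which is 0.\<close>

lemma hirota_Psi_minus:
  assumes f: "hirota s f" and a: "a \<in> {1..s}"
  shows "hirota s (Psi (-1) a y f)"
  unfolding hirota_def
proof (intro allI)
  fix b b'
  let ?X = "Psi (-1) a y"
  obtain K1 where K1: "\<And>\<sigma> a N. \<sigma> = 1 \<or> \<sigma> = -1 \<Longrightarrow> a \<in> {1..s} \<Longrightarrow> N < - K1 \<Longrightarrow> Psi \<sigma> a N f = 0"
    using Psi_cutoff[of s f] by blast
  obtain K2 where K2: "\<And>\<sigma> a N. \<sigma> = 1 \<or> \<sigma> = -1 \<Longrightarrow> a \<in> {1..s} \<Longrightarrow> N < - K2 \<Longrightarrow> Psi \<sigma> a N (?X f) = 0"
    using Psi_cutoff[of s "?X f"] by blast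
  define K where "K = max K1 K2"
  have K12: "K1 \<le> K" "K2 \<le> K" by (auto simp: K_def)
  let ?P = "\<lambda>i. Psi 1 (fst i) (- snd i - 1) f" and ?M = "\<lambda>i. Psi (-1) (fst i) (snd i) f"
  let ?I = "{1..s} \<times> {-K..K}"
  have "(\<Sum>i\<in>?I. lookup (?P i) b * lookup (?M i) b') = Omega s (lookup f) (lookup f) b b'" for b b'
    by (subst Omega_cutoff[of s K f]) (use K1 K12 in \<open>auto simp: sum.cartesian_product split_def\<close>)
  then have om: "(\<Sum>i\<in>?I. lookup (?P i) b * lookup (?M i) b') = 0" for b b'
    using hirotaD[OF f] by simp
  have XX: "?X (?X f) = 0"
  proof -
    have "?X (?X f) = - ?X (?X f)" using Psi_anticommute[of a a "-1" y y f] a by simp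
    then have "of_nat 2 * ?X (?X f) = of_nat 2 * 0" by (simp add: eq_neg_iff_add_eq_0)
    then show ?thesis by (rule of_nat_mult_cancel_boson) simp
  qed
  have M: "Psi (-1) c k (?X f) = - ?X (Psi (-1) c k f)" if "c \<in> {1..s}" for c k
    using Psi_anticommute[of c a "-1" k y f] a that by simp
  have P: "Psi 1 c (- k - 1) (?X f) = bconst (if c = a \<and> k = y then 1 else 0) * f - ?X (Psi 1 c (- k - 1) f)"
    if "c \<in> {1..s}" for c k
    using Psi_opposite[of c a 1 "- k - 1" y f] a that by (auto simp: eq_diff_eq)
  have "Omega s (lookup (?X f)) (lookup (?X f)) b b' =
      (\<Sum>c=1..s. \<Sum>k=-K..K. lookup (Psi 1 c (- k - 1) (?X f)) b * lookup (Psi (-1) c k (?X f)) b')"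
    by (rule Omega_cutoff) (use K2 K12 in auto)
  also have "\<dots> = (\<Sum>c=1..s. \<Sum>k=-K..K. lookup (?X (?P (c, k))) b * lookup (?X (?M (c, k))) b')"
  proof (intro sum.cong refl)
    fix c k assume "c \<in> {1..s}"
    then show "lookup (Psi 1 c (- k - 1) (?X f)) b * lookup (Psi (-1) c k (?X f)) b' =
      lookup (?X (?P (c, k))) b * lookup (?X (?M (c, k))) b'"
      by (cases "c = a \<and> k = y") (simp_all add: M P XX lookup_minus)
  qed
  also have "\<dots> = (\<Sum>i\<in>?I. lookup (?X (?P i)) b * lookup (?X (?M i)) b')"
    by (simp add: sum.cartesian_product split_def)
  also have "\<dots> = 0"
    by (rule tensor_map[OF boson_linear_Psi boson_linear_Psi om])
  finally show "Omega s (lookup (?X f)) (lookup (?X f)) b b' = 0" .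
qed

section \<open>Symmetries of the bilinear equation and the vacuum\<close>

lemma Psi_zpow_mult:
  "Psi \<sigma> a N (zpow k * f) = bconst (zsign k a) * (zpow k * Psi \<sigma> a (N - \<sigma> * lookup k a) f)"
proof (rule boson_linear_eqI[where f = f])
  show "boson_linear (\<lambda>f. Psi \<sigma> a N (zpow k * f))"
    by (rule boson_linear_compose[OF boson_linear_Psi boson_linear_mult[OF boson_linear_id]])
  show "boson_linear (\<lambda>f. bconst (zsign k a) * (zpow k * Psi \<sigma> a (N - \<sigma> * lookup k a) f))"
    by (rule boson_linear_mult, rule boson_linear_mult, rule boson_linear_Psi)
  fix b :: fock_basis
  have h: "homogeneous (fst b) (single b 1)" using homogeneous_single[of "fst b" "snd b" 1] by simp
  have h': "homogeneous (k + fst b) (zpow k * single b 1)"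
    by (rule homogeneous_mult[OF homogeneous_zpow h])
  show "Psi \<sigma> a N (zpow k * single b 1) =
      bconst (zsign k a) * (zpow k * Psi \<sigma> a (N - \<sigma> * lookup k a) (single b 1))"
    unfolding Psi_homogeneous[OF h] Psi_homogeneous[OF h'] Bop_zpow_mult zsign_add bconst_mult
    by (simp add: lookup_add algebra_simps)
qed

text \<open>The monomial moves the index of both paired modes consistently from j to j + k_a, and
  its two signs multiply to 1, so \<Omega> is only re-indexed.\<close>

lemma hirota_zpow_mult:
  assumes "hirota s f"
  shows "hirota s (zpow k * f)"
  unfolding hirota_def
proof (intro allI)
  fix b b' :: fock_basis
  obtain n \<mu> n' \<mu>' where b: "b = (n, \<mu>)" "b' = (n', \<mu>')" by (cases b, cases b')
  let ?F = "\<lambda>a j. lookup (Psi 1 a (- j - 1) f) (n - k, \<mu>) * lookup (Psi (-1) a j f) (n' - k, \<mu>')"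
  have sq: "zsign k a * x * (zsign k a * y) = x * y" for a x y
    using zsign_square[of k a] by (metis mult.assoc mult.left_commute mult.left_neutral)
  have shift: "- j - 1 - 1 * l = - (j + l) - 1" "- (- j - 1) - 1 - - 1 * l = j + l" for j l :: int by auto
  have "Omega s (lookup (zpow k * f)) (lookup (zpow k * f)) b b' =
      (\<Sum>a=1..s. Sum_any (\<lambda>j. ?F a (j + lookup k a)))"
    unfolding Omega_def psi_plus_mode_def psi_minus_mode_def psi_plus_lookup psi_minus_lookup Psi_zpow_mult b
    by (simp only: lookup_bconst_mult lookup_zpow_mult sq shift)
  also have "\<dots> = (\<Sum>a=1..s. Sum_any (?F a))"
  proof (rule sum.cong[OF refl])
    fix a
    have "bij (\<lambda>j. j + lookup k a)"
      by (rule bij_betw_byWitness[where f' = "\<lambda>j. j - lookup k a"]) auto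
    then show "Sum_any (\<lambda>j. ?F a (j + lookup k a)) = Sum_any (?F a)"
      by (rule Sum_any.reindex_cong[symmetric]) (simp add: fun_eq_iff)
  qed
  also have "\<dots> = Omega s (lookup f) (lookup f) (n - k, \<mu>) (n' - k, \<mu>')"
    unfolding Omega_def psi_plus_mode_def psi_minus_mode_def psi_plus_lookup psi_minus_lookup
    by simp
  finally show "Omega s (lookup (zpow k * f)) (lookup (zpow k * f)) b b' = 0"
    using hirotaD[OF assms] by simp
qed

lemma hirota_scale:
  assumes "hirota s f"
  shows "hirota s (bconst c * f)"
  unfolding hirota_def
proof (intro allI)
  fix b b'
  obtain K where K: "\<And>\<sigma> a N. \<sigma> = 1 \<or> \<sigma> = -1 \<Longrightarrow> a \<in> {1..s} \<Longrightarrow> N < - K \<Longrightarrow> Psi \<sigma> a N f = 0"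
    using Psi_cutoff[of s f] by blast
  have K': "Psi \<sigma> a N (bconst c * f) = 0" if "\<sigma> = 1 \<or> \<sigma> = -1" "a \<in> {1..s}" "N < - K" for \<sigma> a N
    using K[OF that] by (simp add: Psi_linear_scale)
  have e: "Omega s (lookup f) (lookup f) b b' =
      (\<Sum>a=1..s. \<Sum>k=-K..K. lookup (Psi 1 a (- k - 1) f) b * lookup (Psi (-1) a k f) b')"
    by (rule Omega_cutoff) (rule K)
  have "Omega s (lookup (bconst c * f)) (lookup (bconst c * f)) b b' = (\<Sum>a=1..s. \<Sum>k=-K..K.
      lookup (Psi 1 a (- k - 1) (bconst c * f)) b * lookup (Psi (-1) a k (bconst c * f)) b')"
    by (rule Omega_cutoff) (rule K')
  also have "\<dots> = c * c * Omega s (lookup f) (lookup f) b b'"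
    unfolding e Psi_linear_scale sum_distrib_left lookup_bconst_mult
    by (simp only: mult_ac)
  finally have "Omega s (lookup (bconst c * f)) (lookup (bconst c * f)) b b' =
      c * c * Omega s (lookup f) (lookup f) b b'" .
  then show "Omega s (lookup (bconst c * f)) (lookup (bconst c * f)) b b' = 0"
    using hirotaD[OF assms] by simp
qed

lemma Bop_1: "Bop \<sigma> a M 1 = Gc \<sigma> a M"
proof -
  have "Bop \<sigma> a M 1 = (\<Sum>i=0..0. Gc \<sigma> a (M + i) * Qc \<sigma> a i 1)"
    by (rule Bop_eq) (simp add: Qc_eq_0)
  then show ?thesis by simp
qed

lemma Psi_1: "Psi \<sigma> a N 1 = zpow (single a \<sigma>) * Gc \<sigma> a N"
  by (simp add: Psi_homogeneous[OF homogeneous_1] Bop_1 zsign_def)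

text \<open>On the vacuum both fields contain only non-negative powers of u, and of the paired
  exponents -k - 1 and k one is always negative.\<close>

lemma hirota_1: "hirota s 1"
  unfolding hirota_def
proof (intro allI)
  fix b b'
  have "Omega s (lookup 1) (lookup 1) b b' =
    (\<Sum>a=1..s. \<Sum>k\<in>{}. lookup (Psi 1 a (- k - 1) 1) b * lookup (Psi (-1) a k 1) b')"
    by (rule Omega_eq) (auto simp: Psi_1 Gc_def)
  then show "Omega s (lookup 1) (lookup 1) b b' = 0" by simp
qed

section \<open>The Fock space of charge m\<close>

lemma fock_iff: "fock s m f \<longleftrightarrow> (\<forall>n \<mu>. (n, \<mu>) \<in> keys f \<longrightarrow>
     keys n \<subseteq> {1..s} \<and> (\<Sum>a=1..s. lookup n a) = m \<and> keys \<mu> \<subseteq> {1..s} \<times> {1..})"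
  by (simp add: fock_def completed_fock_def in_keys_iff)

lemma closed_subspace_fock: "closed_subspace (fock s m)"
proof -
  have "keys (f + g) \<subseteq> keys f \<union> keys g" for f g :: boson by (rule Poly_Mapping.keys_add)
  moreover have "keys (bconst c * f) \<subseteq> keys f" for c f by (auto simp: in_keys_iff)
  ultimately show ?thesis unfolding closed_subspace_def fock_iff by (simp, blast)
qed

lemma fock_mult:
  assumes "fock s m f" "fock s m' g"
  shows "fock s (m + m') (f * g)"
  unfolding fock_iff
proof (intro allI impI)
  fix n \<mu> assume k: "(n, \<mu>) \<in> keys (f * g)"
  obtain b c where bc: "b \<in> keys f" "c \<in> keys g" "(n, \<mu>) = b + c"
    using keys_mult[of f g] k by blast
  obtain n1 \<mu>1 n2 \<mu>2 where e: "b = (n1, \<mu>1)" "c = (n2, \<mu>2)" by (cases b, cases c)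
  have "n = n1 + n2" "\<mu> = \<mu>1 + \<mu>2" using bc(3) e by auto
  moreover have "keys n1 \<subseteq> {1..s}" "(\<Sum>a=1..s. lookup n1 a) = m" "keys \<mu>1 \<subseteq> {1..s} \<times> {1..}"
    "keys n2 \<subseteq> {1..s}" "(\<Sum>a=1..s. lookup n2 a) = m'" "keys \<mu>2 \<subseteq> {1..s} \<times> {1..}"
    using assms bc(1,2) unfolding fock_iff e by blast+
  ultimately show "keys n \<subseteq> {1..s} \<and> (\<Sum>a=1..s. lookup n a) = m + m' \<and> keys \<mu> \<subseteq> {1..s} \<times> {1..}"
    using Poly_Mapping.keys_add[of n1 n2] Poly_Mapping.keys_add[of \<mu>1 \<mu>2]
    by (simp add: lookup_add sum.distrib, blast)
qed

lemma fock_mult_0: "fock s 0 f \<Longrightarrow> fock s m g \<Longrightarrow> fock s m (f * g)"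
  using fock_mult[of s 0 f m g] by simp

lemma fock_bconst: "fock s 0 (bconst c)"
  by (auto simp: fock_iff bconst_def zero_prod_def split: if_splits)

lemma fock_1: "fock s 0 1"
  using fock_bconst[of s 1] by simp

lemma fock_pvar: "a \<in> {1..s} \<Longrightarrow> k \<ge> 1 \<Longrightarrow> fock s 0 (pvar a k)"
  by (auto simp: fock_iff pvar_def)

lemma fock_zpow: "keys n \<subseteq> {1..s} \<Longrightarrow> fock s (\<Sum>a=1..s. lookup n a) (zpow n)"
  by (auto simp: fock_iff zpow_def)

lemma fock_zpow_single: "a \<in> {1..s} \<Longrightarrow> fock s \<sigma> (zpow (single a \<sigma>))"
  using fock_zpow[of "single a \<sigma>" s] by (simp add: lookup_single when_def)

lemma fock_pd: "fock s m f \<Longrightarrow> fock s m (pd a k f)"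
proof -
  assume f: "fock s m f"
  have "keys \<mu> \<subseteq> keys (\<mu> + single (a, k) 1)" for \<mu> :: "nat \<times> nat \<Rightarrow>\<^sub>0 nat"
    by (auto simp: in_keys_iff lookup_add)
  then show ?thesis using f unfolding fock_iff in_keys_iff[of "(_, _)"] lookup_pd'
    by (metis (no_types, lifting) mult_zero_right subset_trans)
qed

lemma fock_Gc: "a \<in> {1..s} \<Longrightarrow> fock s 0 (Gc \<sigma> a i)"
  by (rule Gc_closed[OF closed_subspace_fock fock_1]) (rule fock_mult_0[OF fock_pvar])

lemma fock_Bop: "a \<in> {1..s} \<Longrightarrow> fock s m f \<Longrightarrow> fock s m (Bop \<sigma> a M f)"
  by (rule Bop_closed[OF closed_subspace_fock]) (auto intro: fock_pd fock_mult_0[OF fock_Gc])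

lemma fock_Psi:
  assumes "a \<in> {1..s}" "fock s m f"
  shows "fock s (m + \<sigma>) (Psi \<sigma> a N f)"
  unfolding Psi_def
proof (rule closed_subspace_sum[OF closed_subspace_fock])
  fix b assume b: "b \<in> keys f"
  then have "keys (single b (lookup f b)) \<subseteq> keys f" by auto
  then have "fock s m (single b (lookup f b))"
    using assms(2) unfolding fock_iff by blast
  then have "fock s (\<sigma> + m) (zpow (single a \<sigma>) * Bop \<sigma> a (N - \<sigma> * lookup (fst b) a) (single b (lookup f b)))"
    by (intro fock_mult fock_zpow_single fock_Bop assms)
  then show "fock s (m + \<sigma>) (bconst (zsign (fst b) a) *
      (zpow (single a \<sigma>) * Bop \<sigma> a (N - \<sigma> * lookup (fst b) a) (single b (lookup f b))))"
    by (simp add: fock_mult_0[OF fock_bconst] add.commute)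
qed

section \<open>Decomposability of polynomial tau-functions\<close>

text \<open>If j is the largest index with \<open>Qc \<sigma> a j g\<close> non-zero, then the
  coefficient of u^(-j) of the Bernstein series is exactly that term, since \<open>Gc\<close>
  vanishes at negative indices and is 1 at 0.\<close>

lemma Qc_vanish_of_Bop_vanish:
  assumes "\<And>t. t < T \<Longrightarrow> Bop \<sigma> a t g = 0" "i > - T"
  shows "Qc \<sigma> a i g = 0"
proof (rule ccontr)
  assume nz: "Qc \<sigma> a i g \<noteq> 0"
  obtain n where n: "\<And>\<sigma> a i. i > n \<Longrightarrow> Qc \<sigma> a i g = 0"
    using Qc_bounded_nonneg[of g] by blast
  let ?S = "{j. Qc \<sigma> a j g \<noteq> 0}"
  have "?S \<subseteq> {0..n}" using n by (auto simp: not_less[symmetric])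
  then have fin: "finite ?S" by (rule finite_subset) simp
  define j where "j = Max ?S"
  have "?S \<noteq> {}" using nz by blast
  then have j: "j \<in> ?S" "i \<le> j"
    using Max_in[OF fin] Max_ge[OF fin, of i] nz unfolding j_def by blast+
  have top: "Qc \<sigma> a k g = 0" if "k > j" for k
    using Max_ge[OF fin, of k] that unfolding j_def by force
  have "j \<ge> 0" using j(1) by (auto simp: not_less[symmetric])
  have "Bop \<sigma> a (- j) g = (\<Sum>k=0..j. Gc \<sigma> a (- j + k) * Qc \<sigma> a k g)"
    by (rule Bop_eq) (rule top)
  also have "\<dots> = (\<Sum>k\<in>{j}. Gc \<sigma> a (- j + k) * Qc \<sigma> a k g)"
    by (rule sum.mono_neutral_right) (use \<open>j \<ge> 0\<close> in auto)
  finally show False using assms(1)[of "- j"] assms(2) j by simp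
qed

text \<open>In the recursion for \<open>Qc\<close> at index k only the summand j = k survives, where
  \<open>Qc\<close> has index 0 and is the identity.\<close>

lemma pd_vanish_of_Qc_vanish:
  assumes "\<And>i. i > 0 \<Longrightarrow> Qc (-1) a i g = 0" "k \<ge> 1"
  shows "pd a k g = 0"
proof -
  have e: "Qc (-1) a (int (k - j)) (shift_op (-1) a j g) = pd a j (Qc (-1) a (int (k - j)) g)" for j
    by (simp add: shift_op_def pd_Qc)
  have "of_nat k * Qc (-1) a (int k) g = (\<Sum>j=1..k. of_nat j * pd a j (Qc (-1) a (int (k - j)) g))"
    unfolding Qc_rec e ..
  also have "\<dots> = (\<Sum>j\<in>{k}. of_nat j * pd a j (Qc (-1) a (int (k - j)) g))"
    by (rule sum.mono_neutral_right) (use assms in auto)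
  finally have "of_nat k * pd a k g = of_nat k * 0" using assms by simp
  then show ?thesis by (rule of_nat_mult_cancel_boson) (use assms in simp)
qed

text \<open>Bernstein operators do not touch z, so conditions on modes can be examined separately on
  each power of z.\<close>

lemma homogeneous_part:
  obtains g where "homogeneous n g" "\<And>\<mu>. lookup g (n, \<mu>) = lookup f (n, \<mu>)"
    "\<And>\<sigma> a M \<mu>. lookup (Bop \<sigma> a M g) (n, \<mu>) = lookup (Bop \<sigma> a M f) (n, \<mu>)"
proof
  let ?A = "{b \<in> keys f. fst b = n}" and ?B = "{b \<in> keys f. fst b \<noteq> n}"
  let ?g = "\<Sum>b\<in>?A. single b (lookup f b)" and ?h = "\<Sum>b\<in>?B. single b (lookup f b)"
  have "f = (\<Sum>b\<in>?A \<union> ?B. single b (lookup f b))"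
    by (subst boson_sum_single) (rule sum.cong, auto)
  also have "\<dots> = ?g + ?h" by (rule sum.union_disjoint) auto
  finally have f: "f = ?g + ?h" .
  have hom: "homogeneous (fst b) (single b c)" for b c
    using homogeneous_single[of "fst b" "snd b" c] by simp
  show "homogeneous n ?g"
    by (rule closed_subspace_sum[OF closed_subspace_homogeneous]) (use hom in auto)
  have 1: "lookup (Bop \<sigma> a M ?h) (n, \<mu>) = 0" for \<sigma> a M \<mu>
  proof -
    have "lookup (Bop \<sigma> a M (single b (lookup f b))) (n, \<mu>) = 0" if "b \<in> ?B" for b
      using homogeneous_Bop[OF hom[of b "lookup f b"], of \<sigma> a M] that by (auto simp: homogeneous_def)
    then show ?thesis by (simp add: Bop_linear_sum lookup_sum)
  qed
  show "lookup (Bop \<sigma> a M ?g) (n, \<mu>) = lookup (Bop \<sigma> a M f) (n, \<mu>)" for \<sigma> a M \<mu>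
    by (subst (2) f) (simp add: boson_linear_add[OF boson_linear_Bop] lookup_add 1)
  have 2: "lookup ?h (n, \<mu>) = 0" for \<mu>
    by (auto simp: lookup_sum lookup_single when_def intro!: sum.neutral)
  show "lookup ?g (n, \<mu>) = lookup f (n, \<mu>)" for \<mu>
    by (subst (2) f) (simp add: lookup_add 2)
qed

lemma zsign_nonzero: "zsign n a \<noteq> 0"
  using zsign_square[of n a] by auto

lemma Bop_vanish_of_Psi_vanish:
  assumes "homogeneous n g" "\<And>\<mu>. lookup (Bop \<sigma> a (x - \<sigma> * lookup n a) g) (n, \<mu>) = lookup (Bop \<sigma> a (x - \<sigma> * lookup n a) f) (n, \<mu>)"
    and "Psi \<sigma> a x f = 0"
  shows "Bop \<sigma> a (x - \<sigma> * lookup n a) g = 0"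
proof (rule poly_mapping_eqI)
  fix b :: fock_basis
  obtain m \<mu> where b: "b = (m, \<mu>)" by (cases b)
  have "zsign n a * lookup (Bop \<sigma> a (x - \<sigma> * lookup n a) f) (n, \<mu>) = 0"
    using lookup_Psi[of n "n + single a \<sigma>" a \<sigma> x f \<mu>] assms(3) by simp
  then show "lookup (Bop \<sigma> a (x - \<sigma> * lookup n a) g) b = lookup 0 b"
    using assms(1,2) homogeneous_Bop[OF assms(1), of \<sigma> a "x - \<sigma> * lookup n a"] zsign_nonzero[of n a]
    by (cases "m = n") (auto simp: b homogeneous_def)
qed

text \<open>On the z^n part the two conditions make \<open>Qc\<close> vanish above N + n_a for
  \<sigma> = 1 and above -(N + n_a) for \<sigma> = -1. As \<open>Qc\<close> at 0 is the identity,
  neither bound is negative, so n_a = -N; then every derivative vanishes too, and only one monomial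
  in z is left.\<close>

lemma vacuum_unique:
  assumes f: "f \<noteq> 0" "fock s m f"
    and plus: "\<And>a x. a \<in> {1..s} \<Longrightarrow> x < - N \<Longrightarrow> Psi 1 a x f = 0"
    and minus: "\<And>a y. a \<in> {1..s} \<Longrightarrow> y < N \<Longrightarrow> Psi (-1) a y f = 0"
  shows "\<exists>c K. c \<noteq> 0 \<and> keys K \<subseteq> {1..s} \<and> f = bconst c * zpow K"
proof -
  have comp: "lookup n a = - N \<and> (\<forall>k\<ge>1. \<forall>\<mu>. lookup (pd a k f) (n, \<mu>) = 0)"
    if n: "(n, \<mu>0) \<in> keys f" and a: "a \<in> {1..s}" for n \<mu>0 a
  proof -
    obtain g where g: "homogeneous n g" "\<And>\<mu>. lookup g (n, \<mu>) = lookup f (n, \<mu>)"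
      "\<And>\<sigma> a M \<mu>. lookup (Bop \<sigma> a M g) (n, \<mu>) = lookup (Bop \<sigma> a M f) (n, \<mu>)"
      using homogeneous_part[of n f] by blast
    have g0: "g \<noteq> 0" using g(2)[of \<mu>0] n by (auto simp: in_keys_iff)
    have "Bop 1 a t g = 0" if "t < - N - lookup n a" for t
      using Bop_vanish_of_Psi_vanish[OF g(1) g(3), where \<sigma> = 1 and a = a and x = "t + lookup n a"] plus[OF a] that by simp
    then have p: "Qc 1 a i g = 0" if "i > N + lookup n a" for i
      using Qc_vanish_of_Bop_vanish[of "- N - lookup n a" 1 a g i] that by simp
    have "Bop (-1) a t g = 0" if "t < N + lookup n a" for t
      using Bop_vanish_of_Psi_vanish[OF g(1) g(3), where \<sigma> = "-1" and a = a and x = "t - lookup n a"] minus[OF a] that by simp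
    then have q: "Qc (-1) a i g = 0" if "i > - (N + lookup n a)" for i
      using Qc_vanish_of_Bop_vanish[of "N + lookup n a" "-1" a g i] that by simp
    have "\<not> 0 > N + lookup n a" using p[of 0] g0 by auto
    moreover have "\<not> 0 > - (N + lookup n a)" using q[of 0] g0 by auto
    ultimately have na: "lookup n a = - N" by simp
    then have "pd a k g = 0" if "k \<ge> 1" for k
      using pd_vanish_of_Qc_vanish[of a g k] q that by simp
    moreover have "lookup (pd a k f) (n, \<mu>) = lookup (pd a k g) (n, \<mu>)" for k \<mu>
      by (simp add: lookup_pd' g(2))
    ultimately show ?thesis using na by simp
  qed
  obtain n \<mu> where n: "(n, \<mu>) \<in> keys f" using f(1) by (metis keys_eq_empty ex_in_conv surj_pair)
  have "n' = n \<and> \<mu>' = 0" if n': "(n', \<mu>') \<in> keys f" for n' \<mu>'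
  proof -
    have k: "keys n \<subseteq> {1..s}" "keys n' \<subseteq> {1..s}" "keys \<mu>' \<subseteq> {1..s} \<times> {1..}"
      using f(2) n n' unfolding fock_iff by blast+
    have "lookup n' a = lookup n a" for a
    proof (cases "a \<in> {1..s}")
      case True
      then show ?thesis using comp[OF n True] comp[OF n' True] by simp
    next
      case False
      then show ?thesis using k by (metis in_keys_iff subsetD)
    qed
    then have "n' = n" by (rule poly_mapping_eqI)
    moreover have "\<mu>' = 0"
    proof (rule ccontr)
      assume "\<mu>' \<noteq> 0"
      then obtain x where x: "x \<in> keys \<mu>'" by (metis keys_eq_empty ex_in_conv)
      obtain a j where aj: "x = (a, j)" by (cases x)
      then have a: "a \<in> {1..s}" "j \<ge> 1" using k(3) x by auto
      obtain \<nu> where \<nu>: "\<mu>' = \<nu> + single (a, j) 1"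
        using x aj by (metis exponent_split in_keys_iff)
      \<comment> \<open>This coefficient is a positive integer times the coefficient of f at (n',
        \<mu>'), which is non-zero by choice.\<close>
      have "lookup (pd a j f) (n', \<nu>) = 0" using comp[OF n' a(1)] a(2) by blast
      then show False using n' unfolding lookup_pd' \<nu>[symmetric]
        by (simp add: in_keys_iff) (metis of_nat_Suc of_nat_eq_0_iff nat.distinct(1) add.commute)
    qed
    ultimately show ?thesis by blast
  qed
  then have sub: "keys f \<subseteq> {(n, 0)}" by auto
  have "f = single (n, 0) (lookup f (n, 0))"
    using sub by (intro poly_mapping_eqI) (auto simp: lookup_single when_def in_keys_iff)
  then have "f = bconst (lookup f (n, 0)) * zpow n" by (metis single_eq_bconst_mult zpow_def)
  moreover have "lookup f (n, 0) \<noteq> 0" using sub n by (auto simp: in_keys_iff)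
  moreover have "keys n \<subseteq> {1..s}" using f(2) n unfolding fock_iff by blast
  ultimately show ?thesis by blast
qed

text \<open>The meeting point of the converse: the bilinear equation leads to such states, and each
  step becomes one more variable of the generating series.\<close>

inductive decomposable :: "nat \<Rightarrow> boson \<Rightarrow> bool" for s where
  vacuum: "c \<noteq> 0 \<Longrightarrow> keys K \<subseteq> {1..s} \<Longrightarrow> decomposable s (bconst c * zpow K)"
| step: "decomposable s g \<Longrightarrow> finite T \<Longrightarrow> decomposable s (Xop s T w g)"

text \<open>
  Removing \<open>\<xi> = \<psi>\<^sup>-\<^sub>y\<close>: evaluating the second tensor factor of \<open>\<Omega> (f \<otimes> f) = 0\<close> at a basis vector \<open>b'\<close>
  with \<open>(\<xi> f)(b') \<noteq> 0\<close> gives \<open>X f = 0\<close> for some combination \<open>X\<close> of the \<open>\<psi>\<^sup>+\<close>, and the anticommutator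
  of \<open>X\<close> and \<open>\<xi>\<close> is \<open>(\<xi> f)(b')\<close>, so \<open>f\<close> is proportional to \<open>X (\<xi> f)\<close>.
\<close>

lemma hirota_remove:
  assumes f: "hirota s f" and a: "a \<in> {1..s}" and nz: "Psi (-1) a y f \<noteq> 0"
  obtains T w where "finite T" "f = Xop s T w (Psi (-1) a y f)"
proof -
  let ?g = "Psi (-1) a y f"
  obtain b' where b': "lookup ?g b' \<noteq> 0" using nz by (metis lookup_zero poly_mapping_eqI)
  obtain K1 where K1: "\<And>\<sigma> a N. \<sigma> = 1 \<or> \<sigma> = -1 \<Longrightarrow> a \<in> {1..s} \<Longrightarrow> N < - K1 \<Longrightarrow> Psi \<sigma> a N f = 0"
    using Psi_cutoff[of s f] by blast
  \<comment> \<open>K is at least |y| so that the index -y - 1 dual to the removed mode belongs to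
    T.\<close>
  define K where "K = max K1 \<bar>y\<bar>"
  have K: "K1 \<le> K" "\<bar>y\<bar> \<le> K" by (auto simp: K_def)
  define T where "T = (\<lambda>k. - k - 1) ` {-K..K}"
  define w where "w c N = lookup (Psi (-1) c (- N - 1) f) b'" for c N
  have T: "finite T" "- y - 1 \<in> T" using K(2) by (auto simp: T_def intro!: image_eqI[of _ _ y])
  have "Xop s T w f = (\<Sum>c=1..s. \<Sum>k=-K..K. bconst (lookup (Psi (-1) c k f) b') * Psi 1 c (- k - 1) f)"
    unfolding Xop_def T_def w_def by (rule sum.cong[OF refl], subst sum.reindex) (auto simp: inj_on_def)
  also have "\<dots> = 0"
  proof (rule poly_mapping_eqI)
    fix b
    have "(\<Sum>c=1..s. \<Sum>k=-K..K. lookup (Psi 1 c (- k - 1) f) b * lookup (Psi (-1) c k f) b') = 0"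
      using hirotaD[OF f] Omega_cutoff[of s K f b b'] K1 K(1) by simp
    then show "lookup (\<Sum>c=1..s. \<Sum>k=-K..K. bconst (lookup (Psi (-1) c k f) b') * Psi 1 c (- k - 1) f) b = lookup 0 b"
      by (simp add: lookup_sum) (simp add: mult.commute)
  qed
  finally have "Xop s T w f = 0" .
  then have "Xop s T w ?g = bconst (lookup ?g b') * f"
    using Psi_minus_Xop[OF a T(1), of y w f] T(2) by (simp add: Psi_linear_0 w_def)
  then have "bconst (1 / lookup ?g b') * Xop s T w ?g = f"
    using b' by (simp add: mult.assoc[symmetric] bconst_mult[symmetric])
  moreover have "bconst (1 / lookup ?g b') * Xop s T w ?g = Xop s T (\<lambda>c N. 1 / lookup ?g b' * w c N) ?g"
    by (simp only: Xop_def sum_distrib_left bconst_mult mult.assoc)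
  ultimately show ?thesis using that[OF T(1)] by metis
qed

text \<open>Induction on the number of modes of \<psi>^- with index in [-N, N) that do not kill f. A
  removed mode kills the result because its square is 0, and modes that killed f before still do.
  The charge varies, since each removal lowers it by 1.\<close>

lemma hirota_imp_decomposable:
  assumes "hirota s f" "f \<noteq> 0" "fock s m f"
  shows "decomposable s f"
proof -
  obtain N where N: "\<And>\<sigma> a x. \<sigma> = 1 \<or> \<sigma> = -1 \<Longrightarrow> a \<in> {1..s} \<Longrightarrow> x < - N \<Longrightarrow> Psi \<sigma> a x f = 0"
    using Psi_cutoff[of s f] by blast
  define D where "D f = {(a, y). a \<in> {1..s} \<and> y \<in> {-N..<N} \<and> Psi (-1) a y f \<noteq> 0}" for f
  have finD: "finite (D f)" for f
    by (rule finite_subset[of _ "{1..s} \<times> {-N..<N}"]) (auto simp: D_def)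
  have "decomposable s f"
    if "hirota s f" "f \<noteq> 0" "fock s m f"
      "\<And>a x. a \<in> {1..s} \<Longrightarrow> x < - N \<Longrightarrow> Psi 1 a x f = 0"
      "\<And>a y. a \<in> {1..s} \<Longrightarrow> y < - N \<Longrightarrow> Psi (-1) a y f = 0" for f m
    using that
  proof (induction "card (D f)" arbitrary: f m rule: less_induct)
    case less
    show ?case
    proof (cases "D f = {}")
      case True
      have "Psi (-1) a y f = 0" if "a \<in> {1..s}" "y < N" for a y
        using True less(6)[OF that(1), of y] that by (cases "y < - N") (auto simp: D_def)
      from vacuum_unique[of f s m N, OF less(3,4,5) this] show ?thesis
        by (metis decomposable.vacuum)
    next
      case False
      then obtain a y where ay: "a \<in> {1..s}" "y \<in> {-N..<N}" "Psi (-1) a y f \<noteq> 0" by (auto simp: D_def)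
      let ?g = "Psi (-1) a y f"
      have m: "Psi (-1) c k ?g = - Psi (-1) a y (Psi (-1) c k f)" if "c \<in> {1..s}" for c k
        using Psi_anticommute[of c a "-1" k y f] ay that by simp
      \<comment> \<open>No contraction arises: x < -N and y < N give x + y < -1.\<close>
      have p: "Psi 1 c x ?g = 0" if "c \<in> {1..s}" "x < - N" for c x
        using Psi_opposite[of c a 1 x y f] ay less(5)[OF that] that by (simp add: Psi_linear_0)
      have "Psi (-1) a y ?g = - Psi (-1) a y ?g" using m[OF ay(1), of y] .
      then have "of_nat 2 * Psi (-1) a y ?g = of_nat 2 * 0" by (simp add: eq_neg_iff_add_eq_0)
      then have "Psi (-1) a y ?g = 0" by (rule of_nat_mult_cancel_boson) simp
      then have "(a, y) \<notin> D ?g" "(a, y) \<in> D f" using ay by (auto simp: D_def)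
      moreover have m0: "Psi (-1) c k ?g = 0" if "c \<in> {1..s}" "Psi (-1) c k f = 0" for c k
        unfolding m[OF that(1)] that(2) by (simp add: Psi_linear_0)
      then have "D ?g \<subseteq> D f" unfolding D_def by blast
      ultimately have "D ?g \<subset> D f" by blast
      then have "card (D ?g) < card (D f)" by (rule psubset_card_mono[OF finD])
      moreover have "hirota s ?g" by (rule hirota_Psi_minus[OF less(2) ay(1)])
      moreover have "fock s (m + -1) ?g" by (rule fock_Psi[OF ay(1) less(4)])
      ultimately have "decomposable s ?g"
        by (rule less(1)[OF _ _ ay(3)]) (use m0 p less(6) in blast)+
      moreover obtain T w where "finite T" "f = Xop s T w ?g"
        using hirota_remove[OF less(2) ay(1,3)] .
      ultimately show ?thesis using decomposable.step by metis
    qed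
  qed
  then show ?thesis using assms N by blast
qed


section \<open>Coefficients of multivariate Laurent series\<close>

definition drop_var :: "nat \<Rightarrow> (nat \<Rightarrow>\<^sub>0 int) \<Rightarrow> nat \<Rightarrow>\<^sub>0 int" where
  "drop_var i \<alpha> = \<alpha> - single i (lookup \<alpha> i)"

lemma lookup_drop_var: "lookup (drop_var i \<alpha>) j = (if j = i then 0 else lookup \<alpha> j)"
  by (simp add: drop_var_def lookup_minus lookup_single when_def)

lemma mls_eqI: "(\<And>\<alpha>. mls_coeff F \<alpha> = mls_coeff G \<alpha>) \<Longrightarrow> F = G"
  by (simp add: mls_coeff_inject[symmetric] fun_eq_iff)

lemma mls_coeff_sum: "mls_coeff (sum F X) \<alpha> = (\<Sum>x\<in>X. mls_coeff (F x) \<alpha>)"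
  by (induction X rule: infinite_finite_induct) (auto simp: zero_mls.rep_eq plus_mls.rep_eq)

lemma bounded_mls_coeff: "bounded_below_supp (mls_coeff F)"
  using mls_coeff[of F] by simp

text \<open>A product of coefficients may vanish although neither factor does; passing to 0/1
  indicators in the integers makes \<open>finite_cauchy_prod\<close> yield the full support
  condition.\<close>

lemma finite_mls_prod_supp:
  fixes F G :: "'a::zero mls"
  shows "finite {\<beta>. mls_coeff F \<beta> \<noteq> 0 \<and> mls_coeff G (\<alpha> - \<beta>) \<noteq> 0}"
proof -
  let ?I = "\<lambda>F \<beta>. if mls_coeff F \<beta> \<noteq> 0 then 1 else 0 :: int"
  have "bounded_below_supp (?I F)" for F :: "'a mls"
    using bounded_mls_coeff[of F] unfolding bounded_below_supp_def supp_in_def by (auto split: if_splits)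
  note this[of F] this[of G]
  from finite_cauchy_prod[OF this, of \<alpha>] show ?thesis
    by (rule rev_finite_subset) auto
qed

lemma mls_coeff_mult:
  assumes "finite D" "\<And>\<beta>. mls_coeff F \<beta> \<noteq> 0 \<Longrightarrow> mls_coeff G (\<alpha> - \<beta>) \<noteq> 0 \<Longrightarrow> \<beta> \<in> D"
  shows "mls_coeff (F * G) \<alpha> = (\<Sum>\<beta>\<in>D. mls_coeff F \<beta> * mls_coeff G (\<alpha> - \<beta>))"
  unfolding times_mls.rep_eq cauchy_prod_def
  by (rule Sum_any.expand_superset[OF assms(1)]) (use assms(2) in force)

lemma mls_coeff_const_mult: "mls_coeff (mls_const c * F) \<alpha> = c * mls_coeff F \<alpha>"
  by (subst mls_coeff_mult[where D = "{0}"]) (auto simp: mls_const.rep_eq split: if_splits)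

lemma mls_coeff_one: "mls_coeff 1 \<alpha> = (if \<alpha> = 0 then 1 else 0)"
  by (simp add: one_mls.rep_eq)

lemma mls_coeff_uvar: "mls_coeff (uvar i) \<alpha> = (if \<alpha> = single i 1 then 1 else 0)"
proof -
  have "keys \<alpha> \<subseteq> {i} \<and> lookup \<alpha> i = 1 \<longleftrightarrow> \<alpha> = single i 1"
  proof
    assume a: "keys \<alpha> \<subseteq> {i} \<and> lookup \<alpha> i = 1"
    then have "lookup \<alpha> j = 0" if "j \<noteq> i" for j
      using that by (metis in_keys_iff singletonD subsetD)
    then show "\<alpha> = single i 1"
      using a by (intro poly_mapping_eqI) (auto simp: lookup_single when_def)
  qed auto
  then show ?thesis by (auto simp: mls_of_fls.rep_eq)
qed

lemma mls_coeff_uvar_mult: "mls_coeff (uvar i * F) \<alpha> = mls_coeff F (\<alpha> - single i 1)"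
  by (subst mls_coeff_mult[where D = "{single i 1}"]) (auto simp: mls_coeff_uvar split: if_splits)

lemma mls_coeff_uvar_power_mult: "mls_coeff (uvar i ^ n * F) \<alpha> = mls_coeff F (\<alpha> - single i (int n))"
proof (induction n arbitrary: \<alpha>)
  case (Suc n)
  have e: "\<alpha> - single i 1 - single i (int n) = \<alpha> - single i (int (Suc n))"
    by (intro poly_mapping_eqI) (simp add: lookup_minus lookup_single when_def)
  show ?case by (simp only: power_Suc mult.assoc mls_coeff_uvar_mult Suc e)
qed simp

lemma mls_coeff_of_fls_mult:
  assumes "\<And>\<beta>. mls_coeff G \<beta> \<noteq> 0 \<Longrightarrow> lookup \<beta> i = 0"
  shows "mls_coeff (G * mls_of_fls i F) \<alpha> = mls_coeff G (drop_var i \<alpha>) * fls_nth F (lookup \<alpha> i)"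
proof -
  have "mls_coeff (G * mls_of_fls i F) \<alpha> =
      (\<Sum>\<beta>\<in>{drop_var i \<alpha>}. mls_coeff G \<beta> * mls_coeff (mls_of_fls i F) (\<alpha> - \<beta>))"
  proof (rule mls_coeff_mult)
    fix \<beta> assume \<beta>: "mls_coeff G \<beta> \<noteq> 0" "mls_coeff (mls_of_fls i F) (\<alpha> - \<beta>) \<noteq> 0"
    have "keys (\<alpha> - \<beta>) \<subseteq> {i}" using \<beta>(2) by (auto simp: mls_of_fls.rep_eq split: if_splits)
    then have "lookup \<alpha> j = lookup \<beta> j" if "j \<noteq> i" for j
      using that by (metis eq_iff_diff_eq_0 in_keys_iff lookup_minus singletonD subsetD)
    then have "\<beta> = drop_var i \<alpha>"
      using assms[OF \<beta>(1)] by (intro poly_mapping_eqI) (auto simp: lookup_drop_var)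
    then show "\<beta> \<in> {drop_var i \<alpha>}" by simp
  qed simp
  also have "\<dots> = mls_coeff G (drop_var i \<alpha>) * fls_nth F (lookup \<alpha> i)"
    by (simp add: mls_of_fls.rep_eq drop_var_def)
  finally show ?thesis .
qed

definition vars_in :: "nat set \<Rightarrow> 'a::zero mls \<Rightarrow> bool" where
  "vars_in V F \<longleftrightarrow> (\<forall>\<beta>. mls_coeff F \<beta> \<noteq> 0 \<longrightarrow> keys \<beta> \<subseteq> V)"

lemma vars_in_mult:
  assumes "vars_in V F" "vars_in V (G :: 'a::comm_ring_1 mls)"
  shows "vars_in V (F * G)"
  unfolding vars_in_def
proof (intro allI impI)
  fix \<beta> assume "mls_coeff (F * G) \<beta> \<noteq> 0"
  then obtain \<gamma> where "mls_coeff F \<gamma> \<noteq> 0" "mls_coeff G (\<beta> - \<gamma>) \<noteq> 0"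
    unfolding times_mls.rep_eq by (rule cauchy_prod_nonzeroE)
  then have "keys \<gamma> \<subseteq> V" "keys (\<beta> - \<gamma>) \<subseteq> V" using assms by (auto simp: vars_in_def)
  then show "keys \<beta> \<subseteq> V" using Poly_Mapping.keys_add[of \<gamma> "\<beta> - \<gamma>"] by auto
qed

lemma vars_in_1: "vars_in V (1 :: 'a::comm_ring_1 mls)"
  by (simp add: vars_in_def mls_coeff_one)

lemma vars_in_prod:
  "(\<And>x. x \<in> X \<Longrightarrow> vars_in V (F x)) \<Longrightarrow> vars_in V (\<Prod>x\<in>X. F x :: 'a::comm_ring_1 mls)"
  by (induction X rule: infinite_finite_induct)
     (auto intro: vars_in_mult vars_in_1)

lemma vars_in_diff:
  assumes "vars_in V F" "vars_in V (G :: 'a::comm_ring_1 mls)"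
  shows "vars_in V (F - G)"
  using assms unfolding vars_in_def minus_mls.rep_eq by (metis diff_zero)

lemma vars_in_of_fls: "i \<in> V \<Longrightarrow> vars_in V (mls_of_fls i F)"
  by (auto simp: vars_in_def mls_of_fls.rep_eq split: if_splits)

lemma vars_in_power: "vars_in V (F :: 'a::comm_ring_1 mls) \<Longrightarrow> vars_in V (F ^ n)"
  by (induction n) (auto intro: vars_in_mult vars_in_1)

section \<open>The recursion for the generating series\<close>

lift_definition mls_Qc :: "nat \<Rightarrow> nat \<Rightarrow> boson mls \<Rightarrow> boson mls" is
  "\<lambda>r k F \<alpha>. Qc 1 r (int k) (F \<alpha>)"
  unfolding bounded_below_supp_def supp_in_def by (metis boson_linear_0 boson_linear_Qc)

text \<open>E^perp(-u) in component r, applied to all coefficients; \<open>fps_X\<close> plays the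
  role of 1/u, kept apart from the variables of the series.\<close>

definition mls_Q :: "nat \<Rightarrow> boson mls \<Rightarrow> boson mls fps" where
  "mls_Q r F = Abs_fps (\<lambda>k. mls_Qc r k F)"

text \<open>Being the exponential of a derivation, the operator is multiplicative, so its effect on
  the generating series can be computed factor by factor.\<close>

lemma mls_Q_mult: "mls_Q r (F * G) = mls_Q r F * mls_Q r G"
proof (rule fps_ext, rule mls_eqI)
  fix k \<alpha>
  let ?D = "{\<beta>. mls_coeff F \<beta> \<noteq> 0 \<and> mls_coeff G (\<alpha> - \<beta>) \<noteq> 0}"
  have D: "finite ?D" by (rule finite_mls_prod_supp)
  have Q0: "Qc 1 r j 0 = 0" for j by (rule Qc_linear_0)
  have "mls_coeff (fps_nth (mls_Q r (F * G)) k) \<alpha> = Qc 1 r (int k) (\<Sum>\<beta>\<in>?D. mls_coeff F \<beta> * mls_coeff G (\<alpha> - \<beta>))"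
    by (simp add: mls_Q_def mls_Qc.rep_eq mls_coeff_mult[OF D, of F G])
  also have "\<dots> = (\<Sum>\<beta>\<in>?D. \<Sum>i\<le>k. Qc 1 r (int i) (mls_coeff F \<beta>) * Qc 1 r (int k - int i) (mls_coeff G (\<alpha> - \<beta>)))"
    by (simp only: Qc_linear_sum Qc_mult)
  also have "\<dots> = (\<Sum>i\<le>k. \<Sum>\<beta>\<in>?D. mls_coeff (mls_Qc r i F) \<beta> * mls_coeff (mls_Qc r (k - i) G) (\<alpha> - \<beta>))"
    by (subst sum.swap) (simp add: mls_Qc.rep_eq of_nat_diff)
  also have "\<dots> = (\<Sum>i\<le>k. mls_coeff (mls_Qc r i F * mls_Qc r (k - i) G) \<alpha>)"
    by (intro sum.cong refl mls_coeff_mult[OF D, symmetric]) (auto simp: mls_Qc.rep_eq Q0)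
  also have "\<dots> = mls_coeff (fps_nth (mls_Q r F * mls_Q r G) k) \<alpha>"
    by (simp add: mls_Q_def fps_mult_nth mls_coeff_sum atLeast0AtMost)
  finally show "mls_coeff (fps_nth (mls_Q r (F * G)) k) \<alpha> = mls_coeff (fps_nth (mls_Q r F * mls_Q r G) k) \<alpha>" .
qed

lemma mls_Q_const:
  assumes "\<And>\<alpha> k. k \<ge> 1 \<Longrightarrow> pd r k (mls_coeff F \<alpha>) = 0"
  shows "mls_Q r F = fps_const F"
proof (rule fps_ext, rule mls_eqI)
  fix k \<alpha>
  show "mls_coeff (fps_nth (mls_Q r F) k) \<alpha> = mls_coeff (fps_nth (fps_const F) k) \<alpha>"
    using assms by (simp add: mls_Q_def mls_Qc.rep_eq Qc_eq_0 zero_mls.rep_eq)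
qed

lemma mls_Q_1: "mls_Q r 1 = 1"
  using mls_Q_const[of r 1] by (simp add: mls_coeff_one)

lemma mls_Q_prod: "mls_Q r (\<Prod>x\<in>X. F x) = (\<Prod>x\<in>X. mls_Q r (F x))"
  by (induction X rule: infinite_finite_induct) (auto simp: mls_Q_mult mls_Q_1)

text \<open>Any lower bound of the support may serve as \<open>lo\<close>, so that rows of different
  components can later share one range of summation.\<close>

lemma fls_nth_Tone:
  assumes "\<And>k. k < lo \<Longrightarrow> fls_nth (A i r) k = 0"
  shows "fls_nth (Tone A i r) x = (\<Sum>k=lo..x. bconst (fls_nth (A i r) k) * Gc 1 r (x - k))"
proof -
  let ?F = "Abs_fls (\<lambda>k. bconst (fls_nth (A i r) k))" and ?H = "fps_to_fls (Hser r)"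
  have F: "fls_nth ?F k = bconst (fls_nth (A i r) k)" for k
    by (rule nth_Abs_fls_ex_lower_bound) (use assms in \<open>auto intro!: exI[of _ lo]\<close>)
  have H: "fls_nth ?H k = Gc 1 r k" for k by (simp add: fps_nth_Hser)
  let ?f = "\<lambda>k. fls_nth ?F k * fls_nth ?H (x - k)"
  let ?df = "fls_subdegree ?F" and ?dg = "fls_subdegree ?H"
  have "fls_nth (Tone A i r) x = sum ?f {?df..x - ?dg}"
    unfolding Tone_def by (rule fls_times_nth(2))
  also have "\<dots> = sum ?f {min lo ?df..max x (x - ?dg)}"
  proof (rule sum.mono_neutral_left)
    have "?f k = 0" if "k < ?df \<or> x - ?dg < k" for k
    proof (cases "k < ?df")
      case False
      then have "x - k < ?dg" using that by auto
      then have "fls_nth ?H (x - k) = 0" by (rule fls_eq0_below_subdegree)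
      then show ?thesis by (simp only: mult_zero_right)
    qed simp
    then show "\<forall>k\<in>{min lo ?df..max x (x - ?dg)} - {?df..x - ?dg}. ?f k = 0"
      by (metis Diff_iff atLeastAtMost_iff not_le)
  qed auto
  also have "\<dots> = sum ?f {lo..x}"
    by (rule sum.mono_neutral_right) (auto simp: not_le F H assms)
  finally show ?thesis by (simp only: F H)
qed

lemma fls_nth_zero_below: "\<exists>lo. \<forall>k<lo. fls_nth F k = 0"
  by (rule exI[of _ "fls_subdegree F"]) simp

text \<open>The factor 1 - v/u of \<open>Qc_Gc_same_nat\<close> with v the variable of row
  \<open>i\<close>; the scalar series A is not affected.\<close>

lemma mls_Q_Tone:
  "mls_Q r (mls_of_fls i (Tone A i c)) = fps_const (mls_of_fls i (Tone A i c)) *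
     (if c = r then 1 - fps_const (uvar i) * fps_X else 1)"
proof (cases "c = r")
  case False
  obtain lo where lo: "\<And>k. k < lo \<Longrightarrow> fls_nth (A i c) k = 0" using fls_nth_zero_below by blast
  have T: "fls_nth (Tone A i c) x = (\<Sum>k=lo..x. bconst (fls_nth (A i c) k) * Gc 1 c (x - k))" for x
    by (rule fls_nth_Tone) (rule lo)
  have "pd r k (fls_nth (Tone A i c) x) = 0" if "k \<ge> 1" for k x
    using False that unfolding T
    by (simp add: boson_linear_sum[OF boson_linear_pd] pd_linear_scale pd_Gc)
  then have "pd r k (mls_coeff (mls_of_fls i (Tone A i c)) \<alpha>) = 0" if "k \<ge> 1" for k \<alpha>
    using that by (simp add: mls_of_fls.rep_eq)
  then show ?thesis using False by (simp add: mls_Q_const)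
next
  case True
  obtain lo where lo: "\<And>k. k < lo \<Longrightarrow> fls_nth (A i r) k = 0" using fls_nth_zero_below by blast
  let ?T = "\<lambda>x. fls_nth (Tone A i r) x"
  have T: "?T x = (\<Sum>k=lo..x. bconst (fls_nth (A i r) k) * Gc 1 r (x - k))" for x
    by (rule fls_nth_Tone) (rule lo)
  have Q: "Qc 1 r (int k) (?T x) = (if k = 0 then ?T x else if k = 1 then - ?T (x - 1) else 0)" for k x
  proof -
    have "Qc 1 r (int k) (?T x) = (\<Sum>j=lo..x. bconst (fls_nth (A i r) j) * Qc 1 r (int k) (Gc 1 r (x - j)))"
      unfolding T by (simp add: Qc_linear_sum boson_linear_scale[OF boson_linear_Qc])
    moreover have "?T (x - 1) = (\<Sum>j=lo..x. bconst (fls_nth (A i r) j) * Gc 1 r (x - j - 1))"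
      unfolding T by (rule sum.mono_neutral_cong_left) (auto simp: algebra_simps)
    ultimately show ?thesis
      by (simp add: Qc_Gc_same_nat T[of x] sum_negf)
  qed
  let ?F = "mls_of_fls i (Tone A i r)"
  have shift: "mls_coeff (uvar i * ?F) \<alpha> = (if keys \<alpha> \<subseteq> {i} then ?T (lookup \<alpha> i - 1) else 0)" for \<alpha>
  proof -
    have "keys (\<alpha> - single i 1) \<subseteq> {i} \<longleftrightarrow> keys \<alpha> \<subseteq> {i}"
      by (auto simp: subset_iff in_keys_iff lookup_minus lookup_single when_def)
    then show ?thesis by (simp add: mls_coeff_uvar_mult mls_of_fls.rep_eq lookup_minus)
  qed
  have "mls_Q r ?F = fps_const ?F * (1 - fps_const (uvar i) * fps_X)"
  proof (rule fps_ext, rule mls_eqI)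
    fix k \<alpha>
    have "fps_const ?F * (1 - fps_const (uvar i) * fps_X) = fps_const ?F - fps_const (uvar i * ?F) * fps_X"
      by (simp add: right_diff_distrib mult.assoc[symmetric] mult.commute)
    then have "fps_nth (fps_const ?F * (1 - fps_const (uvar i) * fps_X)) k =
        (if k = 0 then ?F else if k = 1 then - (uvar i * ?F) else 0)"
      by simp
    then show "mls_coeff (fps_nth (mls_Q r ?F) k) \<alpha> =
        mls_coeff (fps_nth (fps_const ?F * (1 - fps_const (uvar i) * fps_X)) k) \<alpha>"
      by (simp only: mls_Q_def fps_nth_Abs_fps mls_Qc.rep_eq)
         (simp add: Q Q[of 1, simplified] shift uminus_mls.rep_eq zero_mls.rep_eq mls_of_fls.rep_eq Qc_linear_0)
  qed
  then show ?thesis using True by simp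
qed

lemma prod_fps_const: "(\<Prod>x\<in>X. fps_const (f x)) = fps_const (\<Prod>x\<in>X. f x :: 'a::comm_ring_1)"
  by (induction X rule: infinite_finite_induct) auto

lemma mls_Q_Tcomp:
  "mls_Q r (Tcomp A l a) = fps_const (Tcomp A l a) *
     (\<Prod>j\<in>{j\<in>{1..l}. a j = r}. 1 - fps_const (uvar j) * fps_X)"
proof -
  let ?P = "\<Prod>(i, j) \<in> {(i, j). 1 \<le> i \<and> i < j \<and> j \<le> l}. (uvar j - uvar i) ^ of_bool (a i = a j) :: boson mls"
  have "\<exists>c. mls_coeff (uvar i :: boson mls) \<alpha> = bconst c" for i \<alpha>
    unfolding mls_coeff_uvar using bconst_0 bconst_1 by (metis (full_types))
  then have "pd r k (mls_coeff (uvar i) \<alpha>) = 0" for k i \<alpha> by (metis pd_bconst)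
  then have "mls_Q r (uvar j - uvar i) = fps_const (uvar j - uvar i)" for i j
    by (intro mls_Q_const) (simp add: minus_mls.rep_eq boson_linear_diff[OF boson_linear_pd])
  then have "mls_Q r ((uvar j - uvar i) ^ of_bool b) = fps_const ((uvar j - uvar i) ^ of_bool b)" for i j b
    by (cases b) (simp_all add: mls_Q_1)
  then have "mls_Q r ?P = fps_const ?P"
    unfolding mls_Q_prod split_def by (simp add: prod_fps_const)
  moreover have "mls_Q r (\<Prod>j=1..l. mls_of_fls j (Tone A j (a j))) =
      (\<Prod>j=1..l. fps_const (mls_of_fls j (Tone A j (a j)))) *
      (\<Prod>j=1..l. if a j = r then 1 - fps_const (uvar j) * fps_X else 1)"
    by (simp only: mls_Q_prod mls_Q_Tone prod.distrib)
  moreover have "(\<Prod>j=1..l. if a j = r then 1 - fps_const (uvar j :: boson mls) * fps_X else 1) =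
      (\<Prod>j\<in>{j\<in>{1..l}. a j = r}. 1 - fps_const (uvar j) * fps_X)"
    by (rule prod.inter_filter[symmetric]) simp
  ultimately show ?thesis
    unfolding Tcomp_def mls_Q_mult by (simp add: prod_fps_const mult.assoc[symmetric])
qed

text \<open>This is U^m times the product of the 1 - x_j / U, written without dividing by U: the
  coefficient of X^k is paired with U^(m-k), which is legitimate because the product has degree at
  most m in X.\<close>

lemma prod_diff_eq_sum:
  fixes U :: "'a::comm_ring_1"
  assumes "finite J"
  shows "(\<Prod>j\<in>J. U - x j) = (\<Sum>k\<le>card J. U ^ (card J - k) *
      fps_nth (\<Prod>j\<in>J. 1 - fps_const (x j) * fps_X) k)"
    and "k > card J \<Longrightarrow> fps_nth (\<Prod>j\<in>J. 1 - fps_const (x j) * fps_X) k = 0"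
proof -
  have "(\<Prod>j\<in>J. U - x j) = (\<Sum>k\<le>card J. U ^ (card J - k) * fps_nth (\<Prod>j\<in>J. 1 - fps_const (x j) * fps_X) k)
      \<and> (\<forall>k > card J. fps_nth (\<Prod>j\<in>J. 1 - fps_const (x j) * fps_X) k = 0)"
    using assms(1)
  proof (induction J rule: finite_induct)
    case (insert y J)
    define m where "m = card J"
    define E where "E = (\<Prod>j\<in>J. 1 - fps_const (x j) * fps_X)"
    have IH: "(\<Prod>j\<in>J. U - x j) = (\<Sum>k\<le>m. U ^ (m - k) * fps_nth E k)"
      "\<And>k. k > m \<Longrightarrow> fps_nth E k = 0" using insert(3) by (auto simp: m_def E_def)
    have E': "(\<Prod>j\<in>insert y J. 1 - fps_const (x j) * fps_X) = E - fps_const (x y) * (fps_X * E)"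
      using insert(1,2) by (simp add: E_def algebra_simps)
    have nth: "fps_nth (E - fps_const (x y) * (fps_X * E)) k =
        fps_nth E k - (if k = 0 then 0 else x y * fps_nth E (k - 1))" for k
      by simp
    have "(\<Prod>j\<in>insert y J. U - x j) = U * (\<Sum>k\<le>m. U ^ (m - k) * fps_nth E k) - x y * (\<Sum>k\<le>m. U ^ (m - k) * fps_nth E k)"
      using insert(1,2) IH(1) by (simp add: left_diff_distrib)
    also have "U * (\<Sum>k\<le>m. U ^ (m - k) * fps_nth E k) = (\<Sum>k\<le>m. U ^ (Suc m - k) * fps_nth E k)"
      unfolding sum_distrib_left by (rule sum.cong) (auto simp: Suc_diff_le)
    also have "\<dots> = (\<Sum>k\<le>Suc m. U ^ (Suc m - k) * fps_nth E k)"
      by (simp add: IH(2))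
    also have "x y * (\<Sum>k\<le>m. U ^ (m - k) * fps_nth E k) =
        (\<Sum>k\<le>Suc m. U ^ (Suc m - k) * (if k = 0 then 0 else x y * fps_nth E (k - 1)))"
      by (subst sum.atMost_Suc_shift) (simp add: sum_distrib_left mult.left_commute)
    finally have "(\<Prod>j\<in>insert y J. U - x j) = (\<Sum>k\<le>Suc m. U ^ (Suc m - k) *
        fps_nth (\<Prod>j\<in>insert y J. 1 - fps_const (x j) * fps_X) k)"
      unfolding E' nth by (simp add: sum_subtractf right_diff_distrib)
    moreover have "fps_nth (\<Prod>j\<in>insert y J. 1 - fps_const (x j) * fps_X) k = 0" if "k > Suc m" for k
      using IH(2)[of k] IH(2)[of "k - 1"] that unfolding E' nth by simp
    ultimately show ?case using insert(1,2) by (simp add: m_def)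
  qed simp
  then show "(\<Prod>j\<in>J. U - x j) = (\<Sum>k\<le>card J. U ^ (card J - k) *
      fps_nth (\<Prod>j\<in>J. 1 - fps_const (x j) * fps_X) k)"
    "k > card J \<Longrightarrow> fps_nth (\<Prod>j\<in>J. 1 - fps_const (x j) * fps_X) k = 0"
    by blast+
qed

lemma Tcomp_Suc:
  "Tcomp A (Suc l) a = Tcomp A l a * (\<Prod>i\<in>{i\<in>{1..l}. a i = a (Suc l)}. uvar (Suc l) - uvar i) *
     mls_of_fls (Suc l) (Tone A (Suc l) (a (Suc l)))"
proof -
  let ?f = "\<lambda>(i, j). (uvar j - uvar i) ^ of_bool (a i = a j) :: boson mls"
  let ?S = "\<lambda>l. {(i, j). 1 \<le> i \<and> i < j \<and> j \<le> l} :: (nat \<times> nat) set"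
  have fin: "finite (?S l)" by (rule finite_subset[of _ "{1..l} \<times> {1..l}"]) auto
  have "?S (Suc l) = ?S l \<union> (\<lambda>i. (i, Suc l)) ` {1..l}" by auto
  then have "prod ?f (?S (Suc l)) = prod ?f (?S l) * prod ?f ((\<lambda>i. (i, Suc l)) ` {1..l})"
    using fin by (simp only:) (rule prod.union_disjoint, auto)
  also have "prod ?f ((\<lambda>i. (i, Suc l)) ` {1..l}) =
      (\<Prod>i\<in>{1..l}. if a i = a (Suc l) then uvar (Suc l) - uvar i else 1)"
    by (subst prod.reindex) (auto simp: inj_on_def of_bool_def intro!: prod.cong)
  also have "\<dots> = (\<Prod>i\<in>{i\<in>{1..l}. a i = a (Suc l)}. uvar (Suc l) - uvar i)"
    by (rule prod.inter_filter[symmetric]) simp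
  finally show ?thesis by (simp add: Tcomp_def mult_ac)
qed

lemma Tcomp_0: "Tcomp A 0 a = 1"
proof -
  have "{(i, j). 1 \<le> i \<and> i < j \<and> j \<le> (0::nat)} = {}" by auto
  then show ?thesis by (simp only: Tcomp_def) simp
qed

lemma vars_in_Tcomp: "vars_in {1..l} (Tcomp A l a)"
  unfolding Tcomp_def
proof (rule vars_in_mult; rule vars_in_prod)
  fix x assume x: "x \<in> {(i, j). 1 \<le> i \<and> i < j \<and> j \<le> l}"
  obtain i j where ij: "x = (i, j)" by (cases x)
  then have "vars_in {1..l} ((uvar j - uvar i) ^ of_bool (a i = a j))"
    using x by (intro vars_in_power vars_in_diff vars_in_of_fls) auto
  then show "vars_in {1..l} (case x of (i, j) \<Rightarrow> (uvar j - uvar i) ^ of_bool (a i = a j))"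
    by (simp add: ij)
qed (rule vars_in_of_fls)

definition count_eq :: "nat \<Rightarrow> (nat \<Rightarrow> nat) \<Rightarrow> nat \<Rightarrow> nat" where
  "count_eq l a r = card {j\<in>{1..l}. a j = r}"

lemma Qc_Tcomp:
  "Qc 1 r (int k) (mls_coeff (Tcomp A l a) \<alpha>) =
    mls_coeff (Tcomp A l a * fps_nth (\<Prod>j\<in>{j\<in>{1..l}. a j = r}. 1 - fps_const (uvar j) * fps_X) k) \<alpha>"
  using arg_cong[OF mls_Q_Tcomp[of r A l a], of "\<lambda>F. mls_coeff (fps_nth F k) \<alpha>"]
  by (simp add: mls_Q_def mls_Qc.rep_eq)

lemma Qc_Tcomp_eq_0: "i > int (count_eq l a r) \<Longrightarrow> Qc 1 r i (mls_coeff (Tcomp A l a) \<alpha>) = 0"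
proof -
  assume i: "i > int (count_eq l a r)"
  have "fps_nth (\<Prod>j\<in>{j\<in>{1..l}. a j = r}. 1 - fps_const (uvar j :: boson mls) * fps_X) (nat i) = 0"
    by (rule prod_diff_eq_sum(2)) (use i in \<open>auto simp: count_eq_def\<close>)
  then show ?thesis using Qc_Tcomp[of r "nat i" A l a \<alpha>] i by (simp add: zero_mls.rep_eq)
qed

lemma Bop_Tcomp:
  "Bop 1 r (M - int (count_eq l a r)) (mls_coeff (Tcomp A l a) \<alpha>) =
    (\<Sum>k\<le>count_eq l a r. Gc 1 r (M - int (count_eq l a r) + int k) * Qc 1 r (int k) (mls_coeff (Tcomp A l a) \<alpha>))"
proof -
  let ?m = "count_eq l a r"
  have "Bop 1 r (M - int ?m) (mls_coeff (Tcomp A l a) \<alpha>) =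
    (\<Sum>k=0..int ?m. Gc 1 r (M - int ?m + k) * Qc 1 r k (mls_coeff (Tcomp A l a) \<alpha>))"
    by (rule Bop_eq) (rule Qc_Tcomp_eq_0)
  also have "\<dots> = (\<Sum>k\<le>?m. Gc 1 r (M - int ?m + int k) * Qc 1 r (int k) (mls_coeff (Tcomp A l a) \<alpha>))"
    by (rule sum.reindex_bij_witness[of _ int nat]) auto
  finally show ?thesis .
qed

text \<open>Every \<open>Gc\<close> that occurs has index at most M. This is the vanishing that
  later confines the modes of X to non-negative indices.\<close>

lemma Bop_Tcomp_neg:
  "M < 0 \<Longrightarrow> Bop 1 r (M - int (count_eq l a r)) (mls_coeff (Tcomp A l a) \<alpha>) = 0"
  unfolding Bop_Tcomp by (rule sum.neutral) auto

text \<open>The new variable u brings A(u) H(u) and the factors u - u_i with a_i = r. By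
  \<open>prod_diff_eq_sum\<close> these factors act on the shorter series as u^m E^perp(-u), so
  together with H(u) they form the Bernstein series.\<close>

lemma Tcomp_rec:
  assumes lo: "\<forall>k<lo. fls_nth (A (Suc l) (a (Suc l))) k = 0"
  shows "mls_coeff (Tcomp A (Suc l) a) \<alpha> =
    (\<Sum>j=lo..lookup \<alpha> (Suc l). bconst (fls_nth (A (Suc l) (a (Suc l))) j) *
      Bop 1 (a (Suc l)) (lookup \<alpha> (Suc l) - j - int (count_eq l a (a (Suc l))))
        (mls_coeff (Tcomp A l a) (drop_var (Suc l) \<alpha>)))"
proof -
  define r where "r = a (Suc l)"
  define m where "m = count_eq l a r"
  define N where "N = lookup \<alpha> (Suc l)"
  let ?J = "{j\<in>{1..l}. a j = r}"
  let ?E = "\<Prod>j\<in>?J. 1 - fps_const (uvar j :: boson mls) * fps_X"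
  let ?U = "uvar (Suc l) :: boson mls" and ?T = "Tone A (Suc l) r" and ?G = "Tcomp A l a"
  let ?g = "mls_coeff ?G (drop_var (Suc l) \<alpha>)"
  have E_vars: "vars_in {1..l} (fps_nth ?E k)" for k
  proof -
    have gen: "vars_in {1..l} (fps_nth (\<Prod>j\<in>J. 1 - fps_const (uvar j :: boson mls) * fps_X) k)"
      if "finite J" "J \<subseteq> {1..l}" for J
      using that
    proof (induction J arbitrary: k rule: finite_induct)
      case empty
      then show ?case by (auto simp: vars_in_def mls_coeff_one zero_mls.rep_eq split: if_splits)
    next
      case (insert y J)
      let ?F = "\<Prod>j\<in>J. 1 - fps_const (uvar j :: boson mls) * fps_X"
      have "(\<Prod>j\<in>insert y J. 1 - fps_const (uvar j :: boson mls) * fps_X) = ?F - fps_const (uvar y) * (fps_X * ?F)"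
        using insert(1,2) by (simp add: algebra_simps)
      then have e: "fps_nth (\<Prod>j\<in>insert y J. 1 - fps_const (uvar j :: boson mls) * fps_X) k =
          fps_nth ?F k - (if k = 0 then 0 else uvar y * fps_nth ?F (k - 1))" by simp
      have "vars_in {1..l} (if k = 0 then 0 else uvar y * fps_nth ?F (k - 1))"
        using insert by (auto intro!: vars_in_mult vars_in_of_fls simp: vars_in_def[of _ 0] zero_mls.rep_eq)
      then show ?case unfolding e using insert by (intro vars_in_diff) auto
    qed
    show ?thesis by (rule gen) auto
  qed
  \<comment> \<open>Only the power of the new variable and the new row contain that variable, so its
    exponent can be read off separately.\<close>
  have coeff: "mls_coeff (?G * fps_nth ?E k * (?U ^ n * mls_of_fls (Suc l) ?T)) \<alpha> =
      Qc 1 r (int k) ?g * fls_nth ?T (N - int n)" for k n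
  proof -
    have v: "vars_in {1..l} (?G * fps_nth ?E k)" by (rule vars_in_mult[OF vars_in_Tcomp E_vars])
    have "mls_coeff (?U ^ n * (?G * fps_nth ?E k * mls_of_fls (Suc l) ?T)) \<alpha> =
        mls_coeff (?G * fps_nth ?E k * mls_of_fls (Suc l) ?T) (\<alpha> - single (Suc l) (int n))"
      by (rule mls_coeff_uvar_power_mult)
    also have "\<dots> = mls_coeff (?G * fps_nth ?E k) (drop_var (Suc l) (\<alpha> - single (Suc l) (int n))) *
        fls_nth ?T (lookup (\<alpha> - single (Suc l) (int n)) (Suc l))"
    proof (rule mls_coeff_of_fls_mult)
      fix \<beta> assume "mls_coeff (?G * fps_nth ?E k) \<beta> \<noteq> 0"
      then have "keys \<beta> \<subseteq> {1..l}" using v by (simp add: vars_in_def)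
      then have "Suc l \<notin> keys \<beta>" by auto
      then show "lookup \<beta> (Suc l) = 0" by (simp add: in_keys_iff)
    qed
    also have "drop_var (Suc l) (\<alpha> - single (Suc l) (int n)) = drop_var (Suc l) \<alpha>"
      by (intro poly_mapping_eqI) (simp add: lookup_drop_var lookup_minus lookup_single when_def)
    also have "lookup (\<alpha> - single (Suc l) (int n)) (Suc l) = N - int n"
      by (simp add: lookup_minus N_def)
    also have "mls_coeff (?G * fps_nth ?E k) (drop_var (Suc l) \<alpha>) = Qc 1 r (int k) ?g"
      by (rule Qc_Tcomp[symmetric])
    finally show ?thesis by (simp only: mult.left_commute[of _ "?U ^ n"] mult.assoc)
  qed
  have "Tcomp A (Suc l) a = ?G * (\<Sum>k\<le>m. ?U ^ (m - k) * fps_nth ?E k) * mls_of_fls (Suc l) ?T"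
    unfolding Tcomp_Suc r_def[symmetric] m_def count_eq_def
    by (subst prod_diff_eq_sum(1)) simp_all
  also have "\<dots> = (\<Sum>k\<le>m. ?G * fps_nth ?E k * (?U ^ (m - k) * mls_of_fls (Suc l) ?T))"
    by (simp add: sum_distrib_left sum_distrib_right mult_ac)
  finally have "mls_coeff (Tcomp A (Suc l) a) \<alpha> = (\<Sum>k\<le>m. Qc 1 r (int k) ?g * fls_nth ?T (N - int (m - k)))"
    by (simp only: mls_coeff_sum coeff)
  also have "\<dots> = (\<Sum>k\<le>m. \<Sum>j=lo..N. bconst (fls_nth (A (Suc l) r) j) *
      (Gc 1 r (N - j - int m + int k) * Qc 1 r (int k) ?g))"
  proof (rule sum.cong[OF refl])
    fix k assume k: "k \<in> {..m}"
    have "fls_nth ?T (N - int (m - k)) = (\<Sum>j=lo..N - int (m - k). bconst (fls_nth (A (Suc l) r) j) * Gc 1 r (N - int (m - k) - j))"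
      by (rule fls_nth_Tone) (use lo in \<open>simp add: r_def\<close>)
    \<comment> \<open>Raising the upper limit to N adds only terms with negative index of
      \<open>Gc\<close>, and makes the range independent of k.\<close>
    also have "\<dots> = (\<Sum>j=lo..N. bconst (fls_nth (A (Suc l) r) j) * Gc 1 r (N - int (m - k) - j))"
      by (rule sum.mono_neutral_left) auto
    also have "\<dots> = (\<Sum>j=lo..N. bconst (fls_nth (A (Suc l) r) j) * Gc 1 r (N - j - int m + int k))"
      using k by (simp add: of_nat_diff algebra_simps)
    finally show "Qc 1 r (int k) ?g * fls_nth ?T (N - int (m - k)) = (\<Sum>j=lo..N. bconst (fls_nth (A (Suc l) r) j) *
      (Gc 1 r (N - j - int m + int k) * Qc 1 r (int k) ?g))"
      by (simp add: sum_distrib_left mult_ac)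
  qed
  also have "\<dots> = (\<Sum>j=lo..N. bconst (fls_nth (A (Suc l) r) j) * Bop 1 r (N - j - int m) ?g)"
    unfolding m_def Bop_Tcomp sum_distrib_left by (rule sum.swap)
  finally show ?thesis by (simp only: r_def m_def N_def)
qed


section \<open>Coefficients of the generating series as fermionic states\<close>

lemma closed_Tcomp:
  assumes P: "closed_subspace P" "P 1" and B: "\<And>i M f. i \<in> {1..l} \<Longrightarrow> P f \<Longrightarrow> P (Bop 1 (a i) M f)"
  shows "P (mls_coeff (Tcomp A l a) \<alpha>)"
  using B
proof (induction l arbitrary: \<alpha>)
  case 0
  show ?case using P by (simp add: Tcomp_0 mls_coeff_one closed_subspace_def)
next
  case (Suc l)
  obtain lo where lo: "\<forall>k<lo. fls_nth (A (Suc l) (a (Suc l))) k = 0" using fls_nth_zero_below by blast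
  have IH: "P (mls_coeff (Tcomp A l a) \<beta>)" for \<beta>
    by (rule Suc.IH) (use Suc.prems in auto)
  have "P (bconst c * Bop 1 (a (Suc l)) M (mls_coeff (Tcomp A l a) \<beta>))" for c M \<beta>
    using Suc.prems[of "Suc l"] IH P(1) by (simp add: closed_subspace_def)
  then show ?case
    unfolding Tcomp_rec[of lo A l a, OF lo]
    by (intro closed_subspace_sum[OF P(1)])
qed

lemma homogeneous_Tcomp: "homogeneous 0 (mls_coeff (Tcomp A l a) \<alpha>)"
  by (rule closed_Tcomp[OF closed_subspace_homogeneous homogeneous_1]) (rule homogeneous_Bop)

lemma fock_Tcomp: "a \<in> {1..l} \<rightarrow> {1..s} \<Longrightarrow> fock s 0 (mls_coeff (Tcomp A l a) \<alpha>)"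
  by (rule closed_Tcomp[OF closed_subspace_fock fock_1]) (rule fock_Bop, auto)

section \<open>Signs and charges of the summands\<close>

definition charge :: "nat \<Rightarrow> (nat \<Rightarrow> nat) \<Rightarrow> nat \<Rightarrow>\<^sub>0 int" where
  "charge l a = (\<Sum>j=1..l. single (a j) 1)"

lemma charge_Suc: "charge (Suc l) a = charge l a + single (a (Suc l)) 1"
  by (simp add: charge_def)

lemma prod_zvar: "(\<Prod>j=1..l. zvar (a j)) = zpow (charge l a)"
  by (induction l) (simp_all add: charge_Suc charge_def[of 0] zvar_def zpow_mult[symmetric] mult.commute)

lemma card_filter_Suc:
  "card {j\<in>{1..Suc l}. Q j} = card {j\<in>{1..l}. Q j} + (if Q (Suc l) then 1 else 0)"
proof -
  have "{j\<in>{1..Suc l}. Q j} = {j\<in>{1..l}. Q j} \<union> (if Q (Suc l) then {Suc l} else {})"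
    by (auto simp: le_Suc_eq)
  then show ?thesis by (auto simp: card_insert_if)
qed

lemma lookup_charge: "lookup (charge l a) r = int (count_eq l a r)"
proof (induction l)
  case (Suc l)
  then show ?case
    unfolding charge_Suc count_eq_def card_filter_Suc lookup_add lookup_single
    by (simp add: when_def)
qed (simp add: charge_def count_eq_def)

text \<open>On the monomial of a_1, ..., a_l the sign of R counts the entries below r, which is the
  exponent in the recursion for \<epsilon>.\<close>

lemma zsign_charge:
  "a \<in> {1..l} \<rightarrow> {1..s} \<Longrightarrow> zsign (charge l a) r = (-1) ^ card {j\<in>{1..l}. a j < r}"
proof (induction l)
  case 0
  show ?case by (simp add: charge_def zsign_def)
next
  case (Suc l)
  have "a \<in> {1..l} \<rightarrow> {1..s}" "a (Suc l) \<ge> 1" using Suc.prems by auto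
  then show ?case
    unfolding charge_Suc zsign_add card_filter_Suc using Suc.IH
    by (simp add: zsign_single)
qed

definition seq_sgn :: "nat \<Rightarrow> (nat \<Rightarrow> nat) \<Rightarrow> int" where
  "seq_sgn l a = seq_sign (map a (rev [1..<Suc l]))"

lemma seq_sgn_0: "seq_sgn 0 a = 1"
  by (simp add: seq_sgn_def)

text \<open>The new entry is put in front of the reversed list, as in \<epsilon>(a_(l+1), a_l, ...,
  a_1); list position i holds a_(l-i).\<close>

lemma seq_sgn_Suc: "seq_sgn (Suc l) a = (-1) ^ card {j\<in>{1..l}. a j < a (Suc l)} * seq_sgn l a"
proof -
  let ?xs = "map a (rev [1..<Suc l])"
  have nth: "?xs ! i = a (l - i)" if "i < l" for i
    using that by (simp add: rev_nth Suc_diff_Suc del: upt_Suc)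
  have "bij_betw (\<lambda>i. l - i) {i. i < length ?xs \<and> ?xs ! i < a (Suc l)} {j\<in>{1..l}. a j < a (Suc l)}"
    by (rule bij_betw_byWitness[where f' = "\<lambda>j. l - j"]) (use nth in \<open>auto simp: image_subset_iff\<close>)
  then have "card {i. i < length ?xs \<and> ?xs ! i < a (Suc l)} = card {j\<in>{1..l}. a j < a (Suc l)}"
    by (rule bij_betw_same_card)
  moreover have "map a (rev [1..<Suc (Suc l)]) = a (Suc l) # ?xs" by simp
  ultimately show ?thesis unfolding seq_sgn_def by (simp only: seq_sign.simps)
qed

lemma seq_sgn_square: "seq_sgn l a * seq_sgn l a = 1"
proof (induction l)
  case (Suc l)
  have "(-1 :: int) ^ n * x * ((-1) ^ n * x) = x * x" for n x
    by (simp add: mult_ac flip: power_mult_distrib)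
  then show ?case by (simp only: seq_sgn_Suc Suc)
qed (simp add: seq_sgn_0)

definition Tstate :: "(nat \<Rightarrow> nat \<Rightarrow> complex fls) \<Rightarrow> nat \<Rightarrow> (nat \<Rightarrow> nat) \<Rightarrow> (nat \<Rightarrow>\<^sub>0 int) \<Rightarrow> boson" where
  "Tstate A l a \<alpha> = of_int (seq_sgn l a) * (zpow (charge l a) * mls_coeff (Tcomp A l a) \<alpha>)"

lemma mls_coeff_Tfull: "mls_coeff (Tfull A s l) \<alpha> = (\<Sum>a \<in> {1..l} \<rightarrow>\<^sub>E {1..s}. Tstate A l a \<alpha>)"
  unfolding Tfull_def mls_coeff_sum mls_coeff_const_mult Tstate_def prod_zvar seq_sgn_def[symmetric]
  by (simp only: mult.assoc)

lemma Psi_Tstate: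
  "Psi 1 r M (Tstate A l a \<alpha>) = of_int (seq_sgn l a) * (bconst (zsign (charge l a) r) *
     (zpow (charge l a + single r 1) * Bop 1 r (M - int (count_eq l a r)) (mls_coeff (Tcomp A l a) \<alpha>)))"
proof -
  have h: "homogeneous (charge l a) (zpow (charge l a) * mls_coeff (Tcomp A l a) \<alpha>)"
    using homogeneous_mult[OF homogeneous_zpow homogeneous_Tcomp] by simp
  have "Psi 1 r M (Tstate A l a \<alpha>) =
      of_int (seq_sgn l a) * Psi 1 r M (zpow (charge l a) * mls_coeff (Tcomp A l a) \<alpha>)"
    unfolding Tstate_def bconst_of_int[symmetric] by (rule Psi_linear_scale)
  also have "\<dots> = of_int (seq_sgn l a) * (bconst (zsign (charge l a) r) *
     (zpow (charge l a + single r 1) * Bop 1 r (M - int (count_eq l a r)) (mls_coeff (Tcomp A l a) \<alpha>)))"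
    unfolding Psi_homogeneous[OF h] lookup_charge Bop_zpow_mult zpow_mult[symmetric]
    by (simp add: mult_ac)
  finally show ?thesis .
qed

lemma Psi_Tstate_neg: "M < 0 \<Longrightarrow> Psi 1 r M (Tstate A l a \<alpha>) = 0"
  by (simp add: Psi_Tstate Bop_Tcomp_neg)

text \<open>Sign, monomial and power of u contributed by R^+ are exactly what turns the Bernstein
  recursion for \<open>Tcomp\<close> into modes of \<psi>^+ acting on signed states.\<close>

lemma Tstate_rec:
  assumes a: "a \<in> {1..Suc l} \<rightarrow> {1..s}"
    and lo: "\<forall>k<lo. fls_nth (A (Suc l) (a (Suc l))) k = 0"
  shows "Tstate A (Suc l) a \<alpha> = (\<Sum>j=lo..lookup \<alpha> (Suc l). bconst (fls_nth (A (Suc l) (a (Suc l))) j) *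
      Psi 1 (a (Suc l)) (lookup \<alpha> (Suc l) - j) (Tstate A l a (drop_var (Suc l) \<alpha>)))"
proof -
  let ?r = "a (Suc l)"
  have "a \<in> {1..l} \<rightarrow> {1..s}" using a by auto
  then have z: "bconst (zsign (charge l a) ?r) = of_int ((-1) ^ card {j\<in>{1..l}. a j < ?r})"
    by (subst zsign_charge) (simp_all flip: bconst_of_int)
  show ?thesis
    unfolding Tstate_def[of A "Suc l"] Tcomp_rec[of lo A l a, OF lo] Psi_Tstate z charge_Suc seq_sgn_Suc
    by (simp add: sum_distrib_left mult_ac)
qed

lemma Tcomp_cong:
  assumes "\<And>i. i \<in> {1..l} \<Longrightarrow> a i = b i" "\<And>i. i \<in> {1..l} \<Longrightarrow> A i (a i) = B i (a i)"
  shows "Tcomp A l a = Tcomp B l b"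
proof -
  have "Tone A i (a i) = Tone B i (b i)" if "i \<in> {1..l}" for i
    using assms[OF that] by (simp add: Tone_def)
  then show ?thesis
    unfolding Tcomp_def using assms(1)
    by (intro arg_cong2[where f = "(*)"] prod.cong) auto
qed

lemma Tstate_cong:
  assumes "\<And>i. i \<in> {1..l} \<Longrightarrow> a i = b i" "\<And>i. i \<in> {1..l} \<Longrightarrow> A i (a i) = B i (a i)"
  shows "Tstate A l a \<alpha> = Tstate B l b \<alpha>"
proof -
  have "Tcomp A l a = Tcomp B l b" by (rule Tcomp_cong) (use assms in auto)
  moreover have "charge l a = charge l b" unfolding charge_def using assms(1) by (intro sum.cong) auto
  moreover have "seq_sgn l a = seq_sgn l b" unfolding seq_sgn_def
    using assms(1) by (intro arg_cong[where f = seq_sign] map_cong) auto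
  ultimately show ?thesis by (simp add: Tstate_def)
qed

lemma Tfull_cong:
  assumes "\<And>i r. i \<in> {1..l} \<Longrightarrow> r \<in> {1..s} \<Longrightarrow> A i r = B i r"
  shows "mls_coeff (Tfull A s l) \<alpha> = mls_coeff (Tfull B s l) \<alpha>"
  unfolding mls_coeff_Tfull
proof (rule sum.cong[OF refl])
  fix a assume a: "a \<in> {1..l} \<rightarrow>\<^sub>E {1..s}"
  show "Tstate A l a \<alpha> = Tstate B l a \<alpha>"
    by (rule Tstate_cong[OF refl]) (use assms PiE_mem[OF a] in blast)
qed

lemma Tfull_0: "mls_coeff (Tfull A s 0) 0 = 1"
  by (simp add: mls_coeff_Tfull Tstate_def seq_sgn_0 charge_def Tcomp_0 mls_coeff_one)

text \<open>A sequence of length l + 1 is one of length l with a last entry r. Summing over r lets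
  all components enter one combination of modes with weights taken from row l + 1 of
  \<open>A\<close>.\<close>

lemma Tfull_rec:
  assumes lo: "\<And>r k. r \<in> {1..s} \<Longrightarrow> k < lo \<Longrightarrow> fls_nth (A (Suc l) r) k = 0"
  shows "mls_coeff (Tfull A s (Suc l)) \<alpha> = (\<Sum>r=1..s. \<Sum>j=lo..lookup \<alpha> (Suc l).
     bconst (fls_nth (A (Suc l) r) j) *
       Psi 1 r (lookup \<alpha> (Suc l) - j) (mls_coeff (Tfull A s l) (drop_var (Suc l) \<alpha>)))"
proof -
  let ?S = "{1..l} \<rightarrow>\<^sub>E {1..s}" and ?N = "lookup \<alpha> (Suc l)" and ?\<beta> = "drop_var (Suc l) \<alpha>"
  have ins: "{1..Suc l} = insert (Suc l) {1..l}" by auto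
  have "mls_coeff (Tfull A s (Suc l)) \<alpha> =
      (\<Sum>(r, a)\<in>{1..s} \<times> ?S. Tstate A (Suc l) (a(Suc l := r)) \<alpha>)"
    unfolding mls_coeff_Tfull ins PiE_insert_eq
    by (subst sum.reindex[OF inj_combinator]) (simp_all add: split_def)
  also have "\<dots> = (\<Sum>(r, a)\<in>{1..s} \<times> ?S. \<Sum>j=lo..?N. bconst (fls_nth (A (Suc l) r) j) *
      Psi 1 r (?N - j) (Tstate A l a ?\<beta>))"
  proof (rule sum.cong[OF refl], clarify)
    fix r a assume r: "r \<in> {1..s}" and a: "a \<in> ?S"
    let ?b = "a(Suc l := r)"
    have "?b i \<in> {1..s}" if "i \<in> {1..Suc l}" for i
      using r PiE_mem[OF a] that by (cases "i = Suc l") auto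
    then have "?b \<in> {1..Suc l} \<rightarrow> {1..s}" by blast
    moreover have "\<forall>k<lo. fls_nth (A (Suc l) (?b (Suc l))) k = 0" using lo r by simp
    ultimately
    have "Tstate A (Suc l) ?b \<alpha> = (\<Sum>j=lo..?N. bconst (fls_nth (A (Suc l) r) j) *
      Psi 1 r (?N - j) (Tstate A l ?b ?\<beta>))" using Tstate_rec[of ?b l s lo A \<alpha>] by simp
    also have "Tstate A l ?b ?\<beta> = Tstate A l a ?\<beta>" by (rule Tstate_cong) auto
    finally show "Tstate A (Suc l) ?b \<alpha> = (\<Sum>j=lo..?N. bconst (fls_nth (A (Suc l) r) j) *
      Psi 1 r (?N - j) (Tstate A l a ?\<beta>))" .
  qed
  also have "\<dots> = (\<Sum>r=1..s. \<Sum>a\<in>?S. \<Sum>j=lo..?N. bconst (fls_nth (A (Suc l) r) j) *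
      Psi 1 r (?N - j) (Tstate A l a ?\<beta>))"
    by (rule sum.cartesian_product[symmetric])
  also have "\<dots> = (\<Sum>r=1..s. \<Sum>j=lo..?N. bconst (fls_nth (A (Suc l) r) j) *
      Psi 1 r (?N - j) (mls_coeff (Tfull A s l) ?\<beta>))"
    unfolding mls_coeff_Tfull Psi_linear_sum sum_distrib_left
    by (intro sum.cong refl sum.swap)
  finally show ?thesis .
qed

lemma fls_nth_zero_below_uniform:
  fixes s :: nat
  shows "\<exists>lo. \<forall>r\<in>{1..s}. \<forall>k<lo. fls_nth (F r) k = 0"
proof -
  have "fls_nth (F r) k = 0" if "r \<in> {1..s}" "k < Min (insert 0 ((\<lambda>r. fls_subdegree (F r)) ` {1..s}))" for r k
  proof -
    have "Min (insert 0 ((\<lambda>r. fls_subdegree (F r)) ` {1..s})) \<le> fls_subdegree (F r)"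
      using that(1) by (intro Min_le) auto
    then have "k < fls_subdegree (F r)" using that(2) by (rule order.strict_trans2[rotated])
    then show ?thesis by (rule fls_eq0_below_subdegree)
  qed
  then show ?thesis by blast
qed

lemma Xop_reindex:
  "(\<Sum>r=1..s. \<Sum>j=lo..N. bconst (c r j) * Psi 1 r (N - j) f) = Xop s ((\<lambda>j. N - j) ` {lo..N}) (\<lambda>r M. c r (N - M)) f"
  unfolding Xop_def by (rule sum.cong[OF refl], subst sum.reindex) (auto simp: inj_on_def)

lemma hirota_0: "hirota s 0"
  using hirota_scale[OF hirota_1, of s 0] by simp

lemma hirota_Tfull: "hirota s (mls_coeff (Tfull A s l) \<alpha>)"
proof (induction l arbitrary: \<alpha>)
  case 0
  show ?case
    by (simp add: mls_coeff_Tfull Tstate_def seq_sgn_0 charge_def Tcomp_0 mls_coeff_one hirota_0 hirota_1)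
next
  case (Suc l)
  obtain lo where "\<forall>r\<in>{1..s}. \<forall>k<lo. fls_nth (A (Suc l) r) k = 0"
    using fls_nth_zero_below_uniform[of s "A (Suc l)"] by blast
  then have "mls_coeff (Tfull A s (Suc l)) \<alpha> = (\<Sum>r=1..s. \<Sum>j=lo..lookup \<alpha> (Suc l).
     bconst (fls_nth (A (Suc l) r) j) *
       Psi 1 r (lookup \<alpha> (Suc l) - j) (mls_coeff (Tfull A s l) (drop_var (Suc l) \<alpha>)))"
    by (intro Tfull_rec) auto
  then show ?case unfolding Xop_reindex by (simp add: hirota_Xop Suc)
qed

lemma hirota_Tstate: "a \<in> {1..l} \<rightarrow> {1..s} \<Longrightarrow> hirota s (Tstate A l a \<alpha>)"
proof (induction l arbitrary: \<alpha>)
  case 0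
  show ?case
    by (simp add: Tstate_def seq_sgn_0 charge_def Tcomp_0 mls_coeff_one hirota_0 hirota_1)
next
  case (Suc l)
  let ?r = "a (Suc l)" and ?N = "lookup \<alpha> (Suc l)" and ?f = "Tstate A l a (drop_var (Suc l) \<alpha>)"
  obtain lo where lo: "\<forall>k<lo. fls_nth (A (Suc l) ?r) k = 0" using fls_nth_zero_below by blast
  have r: "?r \<in> {1..s}" using Suc.prems by auto
  have "Tstate A (Suc l) a \<alpha> = (\<Sum>j=lo..?N. bconst (fls_nth (A (Suc l) ?r) j) * Psi 1 ?r (?N - j) ?f)"
    by (rule Tstate_rec[of a l s lo A \<alpha>, OF Suc.prems lo])
  \<comment> \<open>The single component is spread over all r with zero weights, to reach the form
    of \<open>Xop\<close>.\<close>
  also have "\<dots> = (\<Sum>r=1..s. if r = ?r then \<Sum>j=lo..?N. bconst (fls_nth (A (Suc l) r) j) * Psi 1 r (?N - j) ?f else 0)"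
    using r by (simp add: sum.delta)
  also have "\<dots> = (\<Sum>r=1..s. \<Sum>j=lo..?N. bconst (if r = ?r then fls_nth (A (Suc l) r) j else 0) * Psi 1 r (?N - j) ?f)"
    by (intro sum.cong refl) auto
  also have "\<dots> = Xop s ((\<lambda>j. ?N - j) ` {lo..?N}) (\<lambda>r M. if r = ?r then fls_nth (A (Suc l) r) (?N - M) else 0) ?f"
    by (rule Xop_reindex)
  also have "hirota s \<dots>"
    by (rule hirota_Xop[OF Suc.IH]) (use Suc.prems in auto)
  finally show ?case .
qed

text \<open>The coefficient differs from the signed state by a sign and a monomial in z, and the
  bilinear equation is stable under undoing both.\<close>

lemma hirota_Tcomp:
  assumes "a \<in> {1..l} \<rightarrow> {1..s}"
  shows "hirota s (mls_coeff (Tcomp A l a) \<alpha>)"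
proof -
  let ?e = "bconst (of_int (seq_sgn l a))" and ?g = "mls_coeff (Tcomp A l a) \<alpha>"
  have "zpow (- charge l a) * (?e * Tstate A l a \<alpha>) =
      (of_int (seq_sgn l a * seq_sgn l a)) * (zpow (- charge l a) * zpow (charge l a) * ?g)"
    by (simp add: Tstate_def bconst_of_int mult_ac)
  also have "\<dots> = ?g" unfolding seq_sgn_square by (simp add: zpow_mult)
  finally show ?thesis
    using hirota_zpow_mult[OF hirota_scale[OF hirota_Tstate[OF assms]], of "- charge l a" "of_int (seq_sgn l a)" A \<alpha>]
    by simp
qed

lemma fock_zpow_charge: "a \<in> {1..l} \<rightarrow> {1..s} \<Longrightarrow> fock s (int l) (zpow (charge l a))"
proof (induction l)
  case 0
  show ?case by (simp add: charge_def fock_1)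
next
  case (Suc l)
  have "a \<in> {1..l} \<rightarrow> {1..s}" "a (Suc l) \<in> {1..s}" using Suc.prems by auto
  then have "fock s (int l + 1) (zpow (charge l a) * zpow (single (a (Suc l)) 1))"
    by (intro fock_mult Suc.IH fock_zpow_single)
  then show ?case by (simp add: charge_Suc zpow_mult add.commute)
qed

lemma fock_Tfull: "fock s (int l) (mls_coeff (Tfull A s l) \<alpha>)"
  unfolding mls_coeff_Tfull
proof (rule closed_subspace_sum[OF closed_subspace_fock])
  fix a assume "a \<in> {1..l} \<rightarrow>\<^sub>E {1..s}"
  then have a: "a \<in> {1..l} \<rightarrow> {1..s}" by auto
  have "fock s (int l + 0) (zpow (charge l a) * mls_coeff (Tcomp A l a) \<alpha>)"
    by (intro fock_mult fock_zpow_charge fock_Tcomp a)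
  then show "fock s (int l) (Tstate A l a \<alpha>)"
    unfolding Tstate_def bconst_of_int[symmetric]
    using closed_subspace_fock[of s "int l"] by (simp add: closed_subspace_def)
qed

lemma Psi_Tfull_neg: "M < 0 \<Longrightarrow> Psi 1 r M (mls_coeff (Tfull A s l) \<alpha>) = 0"
  by (simp add: mls_coeff_Tfull Psi_linear_sum Psi_Tstate_neg)

section \<open>Decomposable states are zero modes\<close>

text \<open>
  Coefficients of positive powers of \<open>u\<close> do not contribute to the zero mode, so adding \<open>u\<close> to a row
  makes its entries non-zero without changing the result.
\<close>

definition polar_row :: "nat \<Rightarrow> (nat \<Rightarrow> complex) \<Rightarrow> complex fls" where
  "polar_row d c = Abs_fls (\<lambda>j. if j = 1 then 1 else if j > 0 \<or> j < - int d then 0 else c (nat (- j)))"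

lemma fls_nth_polar_row:
  "fls_nth (polar_row d c) j = (if j = 1 then 1 else if j > 0 \<or> j < - int d then 0 else c (nat (- j)))"
  unfolding polar_row_def by (rule nth_Abs_fls_ex_lower_bound) (auto intro!: exI[of _ "- int d"])

lemma polar_row_nonzero: "polar_row d c \<noteq> 0"
  using fls_nth_polar_row[of d c 1] by auto

lemma laurent_polynomial_polar_row: "laurent_polynomial (polar_row d c)"
  unfolding laurent_polynomial_def
  by (rule finite_subset[of _ "{- int d..1}"]) (auto simp: fls_nth_polar_row split: if_splits)

lemma Tfull_polar_row:
  assumes "\<And>r. r \<in> {1..s} \<Longrightarrow> A (Suc l) r = polar_row d (c r)"
  shows "mls_coeff (Tfull A s (Suc l)) 0 =
    (\<Sum>r=1..s. \<Sum>M=0..int d. bconst (c r (nat M)) * Psi 1 r M (mls_coeff (Tfull A s l) 0))"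
proof -
  have "drop_var (Suc l) 0 = 0" by (simp add: drop_var_def)
  then have "mls_coeff (Tfull A s (Suc l)) 0 = (\<Sum>r=1..s. \<Sum>j=- int d..0.
     bconst (fls_nth (A (Suc l) r) j) * Psi 1 r (- j) (mls_coeff (Tfull A s l) 0))"
    by (subst Tfull_rec[of s "- int d"]) (use assms in \<open>auto simp: fls_nth_polar_row\<close>)
  also have "\<dots> = (\<Sum>r=1..s. \<Sum>M=0..int d. bconst (c r (nat M)) * Psi 1 r M (mls_coeff (Tfull A s l) 0))"
  proof (rule sum.cong[OF refl])
    fix r assume "r \<in> {1..s}"
    then show "(\<Sum>j=- int d..0. bconst (fls_nth (A (Suc l) r) j) * Psi 1 r (- j) (mls_coeff (Tfull A s l) 0)) =
      (\<Sum>M=0..int d. bconst (c r (nat M)) * Psi 1 r M (mls_coeff (Tfull A s l) 0))"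
      using assms by (intro sum.reindex_bij_witness[of _ uminus uminus]) (auto simp: fls_nth_polar_row)
  qed
  finally show ?thesis .
qed

text \<open>Pulling z^k out changes weights by a sign and shifts the modes of component r by k_r.
  Modes that become negative kill the zero mode; the others range over 0, ..., d, as produced by a
  polar row.\<close>

lemma Xop_zpow_Tfull:
  assumes "finite T"
  obtains d c where "Xop s T w (zpow k * mls_coeff (Tfull A s l) 0) =
    zpow k * (\<Sum>r=1..s. \<Sum>M=0..int d. bconst (c r (nat M)) * Psi 1 r M (mls_coeff (Tfull A s l) 0))"
proof -
  let ?t = "mls_coeff (Tfull A s l) 0"
  define c where "c r M = (if M + lookup k r \<in> T then w r (M + lookup k r) * zsign k r else 0)" for r M
  \<comment> \<open>The element 0 keeps the maximum defined when T is empty.\<close>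
  define d where "d = nat (Max ({0} \<union> (\<lambda>(r, N). \<bar>N - lookup k r\<bar>) ` ({1..s} \<times> T)))"
  have d: "\<bar>N - lookup k r\<bar> \<le> int d" if "r \<in> {1..s}" "N \<in> T" for r N
  proof -
    have "\<bar>N - lookup k r\<bar> \<le> Max ({0} \<union> (\<lambda>(r, N). \<bar>N - lookup k r\<bar>) ` ({1..s} \<times> T))"
      using assms that by (intro Max_ge) (auto intro!: image_eqI[of _ _ "(r, N)"])
    then show ?thesis unfolding d_def by linarith
  qed
  have "Xop s T w (zpow k * ?t) =
      zpow k * (\<Sum>r=1..s. \<Sum>N\<in>T. bconst (w r N * zsign k r) * Psi 1 r (N - lookup k r) ?t)"
    unfolding Xop_def Psi_zpow_mult by (simp add: sum_distrib_left bconst_mult mult_ac)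
  also have "(\<Sum>r=1..s. \<Sum>N\<in>T. bconst (w r N * zsign k r) * Psi 1 r (N - lookup k r) ?t) =
      (\<Sum>r=1..s. \<Sum>M=0..int d. bconst (c r (int (nat M))) * Psi 1 r M ?t)"
  proof (rule sum.cong[OF refl])
    fix r assume r: "r \<in> {1..s}"
    let ?S = "(\<lambda>N. N - lookup k r) ` T"
    have "(\<Sum>N\<in>T. bconst (w r N * zsign k r) * Psi 1 r (N - lookup k r) ?t) =
        (\<Sum>M\<in>?S. bconst (c r M) * Psi 1 r M ?t)"
      by (subst sum.reindex) (auto simp: inj_on_def c_def)
    also have "\<dots> = (\<Sum>M\<in>?S \<inter> {0..int d}. bconst (c r M) * Psi 1 r M ?t)"
    proof (rule sum.mono_neutral_right)
      have "M < 0" if "M \<in> ?S" "M \<notin> {0..int d}" for M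
        using that d[OF r] by force
      then show "\<forall>M\<in>?S - ?S \<inter> {0..int d}. bconst (c r M) * Psi 1 r M ?t = 0"
        using Psi_Tfull_neg by (metis DiffE IntI mult_zero_right)
    qed (use assms in auto)
    also have "\<dots> = (\<Sum>M=0..int d. bconst (c r M) * Psi 1 r M ?t)"
    proof (rule sum.mono_neutral_left)
      have "M \<in> ?S" if "M + lookup k r \<in> T" for M
        using that by (intro image_eqI[of _ _ "M + lookup k r"]) auto
      then show "\<forall>M\<in>{0..int d} - ?S \<inter> {0..int d}. bconst (c r M) * Psi 1 r M ?t = 0"
        by (auto simp: c_def)
    qed auto
    also have "\<dots> = (\<Sum>M=0..int d. bconst (c r (int (nat M))) * Psi 1 r M ?t)"
      by (rule sum.cong) auto
    finally show "(\<Sum>N\<in>T. bconst (w r N * zsign k r) * Psi 1 r (N - lookup k r) ?t) =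
      (\<Sum>M=0..int d. bconst (c r (int (nat M))) * Psi 1 r M ?t)" .
  qed
  finally show ?thesis by (rule that[where d = d and c = "\<lambda>r n. c r (int n)"])
qed

text \<open>Since at least one variable is required, the vacuum c z^K is obtained from z_1, which is
  \<psi>^+ of component 1 at index 0 applied to 1, and the monomial z^K / z_1. Each further
  combination of modes is appended as a new last row.\<close>

lemma decomposable_imp_Tfull:
  assumes "decomposable s f" "s \<ge> 1"
  shows "\<exists>l A k. l \<ge> 1 \<and> keys k \<subseteq> {1..s} \<and>
    (\<forall>i\<in>{1..l}. \<forall>r\<in>{1..s}. A i r \<noteq> 0 \<and> laurent_polynomial (A i r)) \<and>
    f = zpow k * mls_coeff (Tfull A s l) 0"
  using assms(1)
proof (induction rule: decomposable.induct)
  case (vacuum c K)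
  define A where "A i r = polar_row 0 (\<lambda>_. if r = 1 then c else 0)" for i r :: nat
  have "mls_coeff (Tfull A s 1) 0 = (\<Sum>r=1..s. bconst (if r = 1 then c else 0) * Psi 1 r 0 1)"
    unfolding One_nat_def by (subst Tfull_polar_row[where d = 0 and c = "\<lambda>r _. if r = 1 then c else 0"])
      (simp_all add: A_def Tfull_0)
  also have "\<dots> = (\<Sum>r=1..s. if r = 1 then bconst c * zpow (single 1 1) else 0)"
    by (intro sum.cong refl) (simp add: Psi_1)
  also have "\<dots> = bconst c * zpow (single 1 1)" using assms(2) by (simp add: sum.delta)
  finally have e: "mls_coeff (Tfull A s 1) 0 = bconst c * zpow (single 1 1)" .
  have "bconst c * zpow K = zpow (K - single 1 1) * mls_coeff (Tfull A s 1) 0"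
    unfolding e mult.left_commute[of "zpow (K - single 1 1)"] zpow_mult by simp
  moreover have "keys (K - single 1 1) \<subseteq> {1..s}"
    using vacuum(2) assms(2) keys_diff[of K "single 1 1"] by auto
  moreover have "A i r \<noteq> 0 \<and> laurent_polynomial (A i r)" for i r
    by (simp add: A_def polar_row_nonzero laurent_polynomial_polar_row)
  ultimately show ?case by (intro exI[of _ 1] exI[of _ A] exI[of _ "K - single 1 1"]) simp
next
  case (step g T w)
  then obtain l A k where lA: "l \<ge> 1" "keys k \<subseteq> {1..s}"
    "\<forall>i\<in>{1..l}. \<forall>r\<in>{1..s}. A i r \<noteq> 0 \<and> laurent_polynomial (A i r)"
    "g = zpow k * mls_coeff (Tfull A s l) 0" by blast
  obtain d c where dc: "Xop s T w g =
      zpow k * (\<Sum>r=1..s. \<Sum>M=0..int d. bconst (c r (nat M)) * Psi 1 r M (mls_coeff (Tfull A s l) 0))"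
    using Xop_zpow_Tfull[OF step(2)] unfolding lA(4) by blast
  define A' where "A' i r = (if i = Suc l then polar_row d (c r) else A i r)" for i r
  have "mls_coeff (Tfull A' s l) 0 = mls_coeff (Tfull A s l) 0"
    by (rule Tfull_cong) (auto simp: A'_def)
  then have "Xop s T w g = zpow k * mls_coeff (Tfull A' s (Suc l)) 0"
    unfolding dc by (subst Tfull_polar_row[where d = d and c = c]) (simp_all add: A'_def)
  moreover have "A' i r \<noteq> 0 \<and> laurent_polynomial (A' i r)" if "i \<in> {1..Suc l}" "r \<in> {1..s}" for i r
    using lA(3) that by (auto simp: A'_def polar_row_nonzero laurent_polynomial_polar_row)
  ultimately show ?case using lA(2) by (intro exI[of _ "Suc l"] exI[of _ A'] exI[of _ k]) simp
qed


section \<open>Determinant formulas\<close>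

lemma det_mat_eq:
  "det (mat n n f) = (\<Sum>p\<in>{p. p permutes {0..<n}}. signof p * (\<Prod>i=0..<n. f (i, p i)))"
proof -
  have "det (mat n n f) = (\<Sum>p\<in>{p. p permutes {0..<n}}. signof p * (\<Prod>i=0..<n. mat n n f $$ (i, p i)))"
    by (rule det_def') simp
  also have "\<dots> = (\<Sum>p\<in>{p. p permutes {0..<n}}. signof p * (\<Prod>i=0..<n. f (i, p i)))"
  proof (rule sum.cong[OF refl])
    fix p assume "p \<in> {p. p permutes {0..<n}}"
    then have "p i < n" if "i < n" for i
      using that permutes_in_image[of p "{0..<n}" i] by auto
    then have "(\<Prod>i=0..<n. mat n n f $$ (i, p i)) = (\<Prod>i=0..<n. f (i, p i))"
      by (intro prod.cong refl) auto
    then show "signof p * (\<Prod>i=0..<n. mat n n f $$ (i, p i)) = signof p * (\<Prod>i=0..<n. f (i, p i))"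
      by (simp only:)
  qed
  finally show ?thesis .
qed

lemma det_scale_rows:
  "det (mat n n (\<lambda>(i, j). c i * f i j)) = (\<Prod>i=0..<n. c i) * det (mat n n (\<lambda>(i, j). f i j))"
  unfolding det_mat_eq by (simp add: prod.distrib sum_distrib_left mult.left_commute)

text \<open>Multiplying by the unitriangular matrix U subtracts x_n times the preceding column from
  each column but the first. The last row becomes (1, 0, ..., 0), and expansion along it leaves the
  smaller determinant with rows scaled by x_i - x_n.\<close>

lemma det_vandermonde:
  fixes x :: "nat \<Rightarrow> 'a::comm_ring_1"
  shows "det (mat n n (\<lambda>(i, j). x i ^ j)) = (\<Prod>(i, j)\<in>{(i, j). i < j \<and> j < n}. x j - x i)"
proof (induction n)
  case 0
  have "{(i, j). i < j \<and> j < (0::nat)} = {}" by auto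
  then show ?case by (simp only: prod.empty) (simp add: det_mat_eq)
next
  case (Suc n)
  define y where "y = x n"
  let ?N = "Suc n"
  let ?V = "mat ?N ?N (\<lambda>(i, j). x i ^ j)"
  let ?U = "mat ?N ?N (\<lambda>(i, j). if i = j then 1 else if Suc i = j then - y else 0)"
  let ?M = "mat ?N ?N (\<lambda>(i, j). if j = 0 then 1 else x i ^ (j - 1) * (x i - y))"
  have VU: "?V * ?U = ?M"
  proof (rule eq_matI)
    fix i j assume "i < dim_row ?M" "j < dim_col ?M"
    then have ij: "i < ?N" "j < ?N" by auto
    have "(?V * ?U) $$ (i, j) = (\<Sum>k<?N. x i ^ k * (if k = j then 1 else if Suc k = j then - y else 0))"
      using ij by (simp add: scalar_prod_def atLeast0LessThan)
    also have "\<dots> = (\<Sum>k<?N. (if k = j then x i ^ j else 0) + (if j > 0 \<and> k = j - 1 then - (x i ^ (j - 1) * y) else 0))"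
      by (intro sum.cong refl) auto
    also have "\<dots> = x i ^ j + (if j > 0 then - (x i ^ (j - 1) * y) else 0)"
      using ij by (cases j) (simp_all add: sum.distrib)
    also have "\<dots> = ?M $$ (i, j)"
      using ij by (cases j) (simp_all add: algebra_simps)
    finally show "(?V * ?U) $$ (i, j) = ?M $$ (i, j)" .
  qed auto
  have "det ?U = prod_list (diag_mat ?U)"
    by (rule det_upper_triangular[of _ ?N]) (auto simp: upper_triangular_def)
  also have "\<dots> = 1" by (simp add: prod_list_diag_prod)
  finally have "det ?V = det ?M"
    using det_mult[of ?V ?N ?U] VU by simp
  also have "\<dots> = (\<Sum>j<?N. ?M $$ (n, j) * cofactor ?M n j)"
    by (rule laplace_expansion_row) auto
  also have "\<dots> = (\<Sum>j\<in>{0}. ?M $$ (n, j) * cofactor ?M n j)"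
    by (rule sum.mono_neutral_right) (auto simp: y_def)
  also have "\<dots> = (-1) ^ n * det (mat_delete ?M n 0)"
    by (simp add: cofactor_def)
  also have "mat_delete ?M n 0 = mat n n (\<lambda>(i, j). (x i - y) * x i ^ j)"
    by (rule eq_matI) (auto simp: mat_delete_def mult.commute)
  also have "det \<dots> = (\<Prod>i=0..<n. x i - y) * det (mat n n (\<lambda>(i, j). x i ^ j))"
    by (rule det_scale_rows)
  also have "(-1) ^ n * ((\<Prod>i=0..<n. x i - y) * det (mat n n (\<lambda>(i, j). x i ^ j))) =
      (\<Prod>i=0..<n. - 1 * (x i - y)) * det (mat n n (\<lambda>(i, j). x i ^ j))"
    unfolding prod.distrib by (simp add: mult.assoc)
  also have "\<dots> = (\<Prod>i=0..<n. y - x i) * (\<Prod>(i, j)\<in>{(i, j). i < j \<and> j < n}. x j - x i)"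
    by (simp add: Suc)
  also have "(\<Prod>i=0..<n. y - x i) = (\<Prod>(i, j)\<in>(\<lambda>i. (i, n)) ` {0..<n}. x j - x i)"
    by (subst prod.reindex) (auto simp: inj_on_def y_def)
  also have "\<dots> * (\<Prod>(i, j)\<in>{(i, j). i < j \<and> j < n}. x j - x i) =
      (\<Prod>(i, j)\<in>(\<lambda>i. (i, n)) ` {0..<n} \<union> {(i, j). i < j \<and> j < n}. x j - x i)"
  proof (rule prod.union_disjoint[symmetric])
    show "finite {(i, j). i < j \<and> j < n}"
      by (rule finite_subset[of _ "{..<n} \<times> {..<n}"]) auto
  qed auto
  also have "(\<lambda>i. (i, n)) ` {0..<n} \<union> {(i, j). i < j \<and> j < n} = {(i, j). i < j \<and> j < Suc n}"
    by (auto simp: less_Suc_eq)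
  finally show ?case .
qed

lemma indexed_det_eq:
  "indexed_det I f = (\<Sum>p\<in>{p. p permutes {0..<card I}}. signof p *
     (\<Prod>i=0..<card I. f (sorted_list_of_set I ! i) (Suc (p i))))"
  unfolding indexed_det_def det_mat_eq by simp

lemma bij_betw_sorted_list_nth:
  "finite I \<Longrightarrow> bij_betw (\<lambda>p. sorted_list_of_set I ! p) {0..<card I} I"
  by (rule bij_betw_nth) auto

text \<open>The factors t are pulled out of the rows, and the increasing enumeration of I carries
  pairs of positions p < q bijectively to pairs i < j in I.\<close>

lemma indexed_det_vandermonde:
  fixes x t :: "nat \<Rightarrow> 'a::comm_ring_1"
  assumes I: "finite I"
  shows "indexed_det I (\<lambda>i j. x i ^ (j - 1) * t i) =
    (\<Prod>(i, j)\<in>{(i, j). i \<in> I \<and> j \<in> I \<and> i < j}. x j - x i) * (\<Prod>i\<in>I. t i)"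
proof -
  let ?e = "\<lambda>p. sorted_list_of_set I ! p" and ?m = "card I"
  have bij: "bij_betw ?e {0..<?m} I" by (rule bij_betw_sorted_list_nth[OF I])
  have mono: "?e p < ?e q \<longleftrightarrow> p < q" if "p < ?m" "q < ?m" for p q
  proof -
    have "?e p < ?e q" if "p < q" "q < ?m" for p q
      using sorted_wrt_nth_less[OF strict_sorted_list_of_set that(1), of I] that(2) I by simp
    then show ?thesis using that by (metis less_asym' less_irrefl linorder_neqE_nat)
  qed
  have "indexed_det I (\<lambda>i j. x i ^ (j - 1) * t i) = det (mat ?m ?m (\<lambda>(p, q). t (?e p) * x (?e p) ^ q))"
    unfolding indexed_det_def by (simp add: mult.commute)
  also have "\<dots> = (\<Prod>p=0..<?m. t (?e p)) * det (mat ?m ?m (\<lambda>(p, q). x (?e p) ^ q))"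
    by (rule det_scale_rows)
  also have "(\<Prod>p=0..<?m. t (?e p)) = (\<Prod>i\<in>I. t i)"
    by (rule prod.reindex_bij_betw[OF bij])
  also have "det (mat ?m ?m (\<lambda>(p, q). x (?e p) ^ q)) = (\<Prod>(p, q)\<in>{(p, q). p < q \<and> q < ?m}. x (?e q) - x (?e p))"
    by (rule det_vandermonde)
  also have "\<dots> = (\<Prod>(i, j)\<in>{(i, j). i \<in> I \<and> j \<in> I \<and> i < j}. x j - x i)"
  proof -
    have "bij_betw (map_prod ?e ?e) {(p, q). p < q \<and> q < ?m} {(i, j). i \<in> I \<and> j \<in> I \<and> i < j}"
    proof (rule bij_betwI')
      have inj: "?e p = ?e q \<longleftrightarrow> p = q" if "p < ?m" "q < ?m" for p q
        using bij that by (auto simp: bij_betw_def inj_on_def)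
      fix v w assume "v \<in> {(p, q). p < q \<and> q < ?m}" "w \<in> {(p, q). p < q \<and> q < ?m}"
      then show "map_prod ?e ?e v = map_prod ?e ?e w \<longleftrightarrow> v = w"
        using inj by (cases v, cases w) (auto dest: less_trans)
    next
      fix v assume "v \<in> {(p, q). p < q \<and> q < ?m}"
      then obtain p q where v: "v = (p, q)" "p < q" "q < ?m" "p < ?m" by (cases v) auto
      have "?e p \<in> I" "?e q \<in> I" using bij v by (auto simp: bij_betw_def)
      then show "map_prod ?e ?e v \<in> {(i, j). i \<in> I \<and> j \<in> I \<and> i < j}" using v mono by auto
    next
      fix w assume "w \<in> {(i, j). i \<in> I \<and> j \<in> I \<and> i < j}"
      then obtain i j where w: "w = (i, j)" "i \<in> I" "j \<in> I" "i < j" by (cases w) auto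
      have "i \<in> ?e ` {0..<?m}" "j \<in> ?e ` {0..<?m}"
        unfolding bij_betw_imp_surj_on[OF bij] by (rule w)+
      then obtain p q where "i = ?e p" "j = ?e q" "p < ?m" "q < ?m"
        unfolding image_iff Bex_def atLeastLessThan_iff by blast
      then show "\<exists>v\<in>{(p, q). p < q \<and> q < ?m}. w = map_prod ?e ?e v"
        using w mono by (intro bexI[of _ "(p, q)"]) auto
    qed
    from prod.reindex_bij_betw[OF this, of "\<lambda>(i, j). x j - x i"] show ?thesis
      by (simp add: case_prod_beta)
  qed
  finally show ?thesis by (simp only: mult.commute)
qed

text \<open>Only pairs with a_i = a_j contribute a difference. Grouping them by the common value r
  leaves one Vandermonde product for each set I_r.\<close>

lemma Tcomp_eq_prod_det:
  assumes a: "a \<in> {1..l} \<rightarrow> {1..s}"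
  shows "Tcomp A l a = (\<Prod>r=1..s. indexed_det {i \<in> {1..l}. a i = r}
    (\<lambda>i j. uvar i ^ (j - 1) * mls_of_fls i (Tone A i r)))"
proof -
  let ?I = "\<lambda>r. {i \<in> {1..l}. a i = r}"
  let ?S = "{(i, j). 1 \<le> i \<and> i < j \<and> j \<le> l}"
  let ?S' = "{x \<in> ?S. a (fst x) = a (snd x)}"
  let ?d = "\<lambda>x. uvar (snd x) - uvar (fst x) :: boson mls"
  have fin: "finite ?S" by (rule finite_subset[of _ "{1..l} \<times> {1..l}"]) auto
  have al: "a i \<in> {1..s}" if "i \<in> {1..l}" for i using a that by blast
  have "(\<Prod>(i, j)\<in>?S. (uvar j - uvar i) ^ of_bool (a i = a j)) =
      (\<Prod>x\<in>?S. if a (fst x) = a (snd x) then ?d x else 1)"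
    by (intro prod.cong refl) (auto simp: of_bool_def)
  also have "\<dots> = (\<Prod>x\<in>?S'. ?d x)"
    by (rule prod.inter_filter[OF fin, symmetric])
  also have "\<dots> = (\<Prod>r=1..s. \<Prod>x\<in>{x\<in>?S'. a (fst x) = r}. ?d x)"
  proof (rule prod.group[symmetric])
    show "finite ?S'" using fin by simp
    show "(\<lambda>x. a (fst x)) ` ?S' \<subseteq> {1..s}" using al by fastforce
  qed simp
  also have "\<dots> = (\<Prod>r=1..s. \<Prod>(i, j)\<in>{(i, j). i \<in> ?I r \<and> j \<in> ?I r \<and> i < j}. uvar j - uvar i)"
    by (intro prod.cong) auto
  finally have 1: "(\<Prod>(i, j)\<in>?S. (uvar j - uvar i :: boson mls) ^ of_bool (a i = a j)) =
      (\<Prod>r=1..s. \<Prod>(i, j)\<in>{(i, j). i \<in> ?I r \<and> j \<in> ?I r \<and> i < j}. uvar j - uvar i)" .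
  have "(\<Prod>j=1..l. mls_of_fls j (Tone A j (a j))) = (\<Prod>r=1..s. \<Prod>j\<in>?I r. mls_of_fls j (Tone A j (a j)))"
    by (rule prod.group[symmetric]) (use al in auto)
  also have "\<dots> = (\<Prod>r=1..s. \<Prod>j\<in>?I r. mls_of_fls j (Tone A j r))"
    by (intro prod.cong) auto
  finally have 2: "(\<Prod>j=1..l. mls_of_fls j (Tone A j (a j))) = (\<Prod>r=1..s. \<Prod>j\<in>?I r. mls_of_fls j (Tone A j r))" .
  have "indexed_det (?I r) (\<lambda>i j. uvar i ^ (j - 1) * mls_of_fls i (Tone A i r)) =
      (\<Prod>(i, j)\<in>{(i, j). i \<in> ?I r \<and> j \<in> ?I r \<and> i < j}. uvar j - uvar i) * (\<Prod>j\<in>?I r. mls_of_fls j (Tone A j r))" for r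
    by (rule indexed_det_vandermonde) simp
  then show ?thesis unfolding Tcomp_def 1 2 prod.distrib[symmetric] by simp
qed

section \<open>Coefficients of products in disjoint variables\<close>

definition restrict_vars :: "nat set \<Rightarrow> (nat \<Rightarrow>\<^sub>0 int) \<Rightarrow> nat \<Rightarrow>\<^sub>0 int" where
  "restrict_vars V \<alpha> = (\<Sum>i\<in>keys \<alpha> \<inter> V. single i (lookup \<alpha> i))"

lemma lookup_restrict_vars: "lookup (restrict_vars V \<alpha>) i = (if i \<in> V then lookup \<alpha> i else 0)"
  by (auto simp: restrict_vars_def lookup_sum lookup_single when_def in_keys_iff)

lemma restrict_vars_id: "keys \<alpha> \<subseteq> V \<Longrightarrow> restrict_vars V \<alpha> = \<alpha>"
  by (intro poly_mapping_eqI) (auto simp: lookup_restrict_vars in_keys_iff)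

text \<open>An exponent vector splits uniquely along V and W, so the Cauchy product has a single
  term.\<close>

lemma mls_coeff_mult_disjoint:
  fixes F G :: "'a::comm_ring_1 mls"
  assumes "vars_in V F" "vars_in W G" "V \<inter> W = {}"
  shows "mls_coeff (F * G) (restrict_vars (V \<union> W) \<alpha>) =
    mls_coeff F (restrict_vars V \<alpha>) * mls_coeff G (restrict_vars W \<alpha>)"
proof -
  let ?\<alpha> = "restrict_vars (V \<union> W) \<alpha>"
  have "mls_coeff (F * G) ?\<alpha> = (\<Sum>\<beta>\<in>{restrict_vars V \<alpha>}. mls_coeff F \<beta> * mls_coeff G (?\<alpha> - \<beta>))"
  proof (rule mls_coeff_mult)
    fix \<beta> assume "mls_coeff F \<beta> \<noteq> 0" "mls_coeff G (?\<alpha> - \<beta>) \<noteq> 0"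
    then have k: "keys \<beta> \<subseteq> V" "keys (?\<alpha> - \<beta>) \<subseteq> W" using assms(1,2) by (auto simp: vars_in_def)
    have "lookup \<beta> i = lookup (restrict_vars V \<alpha>) i" for i
    proof (cases "i \<in> V")
      case True
      then have "i \<notin> keys (?\<alpha> - \<beta>)" using k(2) assms(3) by blast
      then show ?thesis using True by (simp add: in_keys_iff lookup_minus lookup_restrict_vars)
    next
      case False
      then have "i \<notin> keys \<beta>" using k(1) by blast
      then show ?thesis using False by (simp add: in_keys_iff lookup_restrict_vars)
    qed
    then show "\<beta> \<in> {restrict_vars V \<alpha>}" by (simp add: poly_mapping_eqI)
  qed simp
  moreover have "?\<alpha> - restrict_vars V \<alpha> = restrict_vars W \<alpha>"
    using assms(3) by (intro poly_mapping_eqI) (auto simp: lookup_minus lookup_restrict_vars)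
  ultimately show ?thesis by simp
qed

lemma mls_coeff_prod_disjoint:
  fixes F :: "'b \<Rightarrow> 'a::comm_ring_1 mls"
  assumes "finite R" "\<And>r. r \<in> R \<Longrightarrow> vars_in (V r) (F r)"
    "\<And>r q. r \<in> R \<Longrightarrow> q \<in> R \<Longrightarrow> r \<noteq> q \<Longrightarrow> V r \<inter> V q = {}"
  shows "mls_coeff (\<Prod>r\<in>R. F r) (restrict_vars (\<Union>r\<in>R. V r) \<alpha>) =
    (\<Prod>r\<in>R. mls_coeff (F r) (restrict_vars (V r) \<alpha>))"
  using assms
proof (induction R rule: finite_induct)
  case empty
  have "restrict_vars {} \<alpha> = 0" by (simp add: restrict_vars_def)
  then show ?case by (simp add: mls_coeff_one)
next
  case (insert q R)
  have "vars_in (\<Union>r\<in>R. V r) (F r)" if "r \<in> R" for r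
    using insert.prems(1)[of r] that unfolding vars_in_def by blast
  then have "vars_in (\<Union>r\<in>R. V r) (\<Prod>r\<in>R. F r)" by (rule vars_in_prod)
  moreover have "V q \<inter> (\<Union>r\<in>R. V r) = {}" using insert.prems(2)[of q] insert.hyps(2) by blast
  ultimately show ?case
    using insert mls_coeff_mult_disjoint[of "V q" "F q" "\<Union>r\<in>R. V r" "\<Prod>r\<in>R. F r" \<alpha>] by simp
qed

lemma vars_in_sum: "(\<And>x. x \<in> X \<Longrightarrow> vars_in V (F x)) \<Longrightarrow> vars_in V (\<Sum>x\<in>X. F x :: 'a::comm_ring_1 mls)"
  unfolding vars_in_def mls_coeff_sum by (metis (no_types, lifting) sum.neutral)

lemma mls_coeff_signof: "mls_coeff (signof p * F) \<alpha> = signof p * mls_coeff F \<alpha>"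
  by (simp add: sign_def uminus_mls.rep_eq)

lemma vars_in_indexed_det:
  assumes "finite I"
  shows "vars_in I (indexed_det I (\<lambda>i j. uvar i ^ (j - 1) * mls_of_fls i (T i)) :: 'a::comm_ring_1 mls)"
  unfolding indexed_det_eq
proof (rule vars_in_sum)
  fix p assume "p \<in> {p. p permutes {0..<card I}}"
  have e: "sorted_list_of_set I ! i \<in> I" if "i \<in> {0..<card I}" for i
    using bij_betw_sorted_list_nth[OF assms] that by (auto simp: bij_betw_def)
  have "vars_in I (\<Prod>i=0..<card I. uvar (sorted_list_of_set I ! i) ^ (Suc (p i) - 1) *
      mls_of_fls (sorted_list_of_set I ! i) (T (sorted_list_of_set I ! i)))"
    by (intro vars_in_prod vars_in_mult vars_in_power vars_in_of_fls e)
  then show "vars_in I (signof p * (\<Prod>i=0..<card I. uvar (sorted_list_of_set I ! i) ^ (Suc (p i) - 1) *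
      mls_of_fls (sorted_list_of_set I ! i) (T (sorted_list_of_set I ! i))))"
    by (simp add: sign_def vars_in_def uminus_mls.rep_eq)
qed

text \<open>In the Leibniz expansion each variable occurs in one row only, so coefficients can be
  taken entry by entry; the factor u_i^(j-1) moves the index from \<alpha>_i to \<alpha>_i + 1 -
  j.\<close>

lemma mls_coeff_indexed_det:
  fixes T :: "nat \<Rightarrow> 'a::comm_ring_1 fls"
  assumes I: "finite I"
  shows "mls_coeff (indexed_det I (\<lambda>i j. uvar i ^ (j - 1) * mls_of_fls i (T i))) (restrict_vars I \<alpha>) =
    indexed_det I (\<lambda>i j. fls_nth (T i) (lookup \<alpha> i + 1 - int j))"
proof -
  let ?e = "\<lambda>i. sorted_list_of_set I ! i"
  have bij: "bij_betw ?e {0..<card I} I" by (rule bij_betw_sorted_list_nth[OF I])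
  have one: "mls_coeff (uvar i ^ n * mls_of_fls i F) (restrict_vars {i} \<alpha>) = fls_nth F (lookup \<alpha> i - int n)"
    for i n and F :: "'a fls"
  proof -
    have "keys (restrict_vars {i} \<alpha> - single i (int n)) \<subseteq> {i}"
      by (auto simp: in_keys_iff lookup_minus lookup_restrict_vars lookup_single when_def split: if_splits)
    then show ?thesis
      by (simp add: mls_coeff_uvar_power_mult mls_of_fls.rep_eq lookup_minus lookup_restrict_vars)
  qed
  have "mls_coeff (\<Prod>i=0..<card I. uvar (?e i) ^ (Suc (p i) - 1) * mls_of_fls (?e i) (T (?e i))) (restrict_vars I \<alpha>) =
      (\<Prod>i=0..<card I. fls_nth (T (?e i)) (lookup \<alpha> (?e i) + 1 - int (Suc (p i))))" for p
  proof -
    have "(\<Union>i\<in>{0..<card I}. {?e i}) = I" using bij by (auto simp: bij_betw_def)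
    moreover have "mls_coeff (\<Prod>i=0..<card I. uvar (?e i) ^ (Suc (p i) - 1) * mls_of_fls (?e i) (T (?e i)))
        (restrict_vars (\<Union>i\<in>{0..<card I}. {?e i}) \<alpha>) =
      (\<Prod>i=0..<card I. mls_coeff (uvar (?e i) ^ (Suc (p i) - 1) * mls_of_fls (?e i) (T (?e i))) (restrict_vars {?e i} \<alpha>))"
    proof (rule mls_coeff_prod_disjoint)
      show "vars_in {?e i} (uvar (?e i) ^ (Suc (p i) - 1) * mls_of_fls (?e i) (T (?e i)))" for i
        by (intro vars_in_mult vars_in_power vars_in_of_fls) simp_all
      show "{?e i} \<inter> {?e j} = {}" if "i \<in> {0..<card I}" "j \<in> {0..<card I}" "i \<noteq> j" for i j
        using bij that by (auto simp: bij_betw_def inj_on_def)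
    qed simp
    ultimately show ?thesis by (simp add: one)
  qed
  then show ?thesis unfolding indexed_det_eq mls_coeff_sum mls_coeff_signof by simp
qed

lemma mls_coeff_Tcomp:
  assumes a: "a \<in> {1..l} \<rightarrow> {1..s}" and \<alpha>: "keys \<alpha> \<subseteq> {1..l}"
  shows "mls_coeff (Tcomp A l a) \<alpha> = (\<Prod>r=1..s. indexed_det {i \<in> {1..l}. a i = r}
    (\<lambda>i j. fls_nth (Tone A i r) (lookup \<alpha> i + 1 - int j)))"
proof -
  let ?I = "\<lambda>r. {i \<in> {1..l}. a i = r}"
  have "(\<Union>r\<in>{1..s}. ?I r) = {1..l}" using a by fastforce
  then have "restrict_vars (\<Union>r\<in>{1..s}. ?I r) \<alpha> = \<alpha>" using \<alpha> by (simp add: restrict_vars_id)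
  moreover have "mls_coeff (\<Prod>r=1..s. indexed_det (?I r) (\<lambda>i j. uvar i ^ (j - 1) * mls_of_fls i (Tone A i r)))
      (restrict_vars (\<Union>r\<in>{1..s}. ?I r) \<alpha>) =
    (\<Prod>r=1..s. mls_coeff (indexed_det (?I r) (\<lambda>i j. uvar i ^ (j - 1) * mls_of_fls i (Tone A i r))) (restrict_vars (?I r) \<alpha>))"
  proof (rule mls_coeff_prod_disjoint)
    show "vars_in (?I r) (indexed_det (?I r) (\<lambda>i j. uvar i ^ (j - 1) * mls_of_fls i (Tone A i r)))" for r
      by (rule vars_in_indexed_det) simp
  qed auto
  moreover have "mls_coeff (indexed_det (?I r) (\<lambda>i j. uvar i ^ (j - 1) * mls_of_fls i (Tone A i r)))
      (restrict_vars (?I r) \<alpha>) = indexed_det (?I r) (\<lambda>i j. fls_nth (Tone A i r) (lookup \<alpha> i + 1 - int j))" for r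
    by (rule mls_coeff_indexed_det) simp
  ultimately show ?thesis by (simp only: Tcomp_eq_prod_det[OF a])
qed

theorem theorem5p1:
  fixes s l :: nat and A :: "nat \<Rightarrow> nat \<Rightarrow> complex fls"
  assumes "s \<ge> 1" and "l \<ge> 1"
    and "\<And>i r. i \<in> {1..l} \<Longrightarrow> r \<in> {1..s} \<Longrightarrow> A i r \<noteq> 0"
  shows
    "(\<forall>a \<in> {1..l} \<rightarrow> {1..s}.
        Tcomp A l a = (\<Prod>r=1..s. indexed_det {i \<in> {1..l}. a i = r}
          (\<lambda>i j. uvar i ^ (j - 1) * mls_of_fls i (Tone A i r))))
   \<and> (\<forall>a \<in> {1..l} \<rightarrow> {1..s}. \<forall>\<alpha>. Poly_Mapping.keys \<alpha> \<subseteq> {1..l} \<longrightarrow>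
        mls_coeff (Tcomp A l a) \<alpha> = (\<Prod>r=1..s. indexed_det {i \<in> {1..l}. a i = r}
          (\<lambda>i j. fls_nth (Tone A i r) (Poly_Mapping.lookup \<alpha> i + 1 - int j))))
   \<and> (\<forall>a \<in> {1..l} \<rightarrow> {1..s}. \<forall>\<alpha>. Poly_Mapping.keys \<alpha> \<subseteq> {1..l} \<longrightarrow>
        mls_coeff (Tcomp A l a) \<alpha> \<noteq> 0 \<longrightarrow>
          tau_function s (Poly_Mapping.lookup (mls_coeff (Tcomp A l a) \<alpha>)) \<and>
          ((\<forall>i\<in>{1..l}. \<forall>r\<in>{1..s}. laurent_polynomial (A i r)) \<longrightarrow>
             polynomial_tau_function s (Poly_Mapping.lookup (mls_coeff (Tcomp A l a) \<alpha>))))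
   \<and> (\<forall>\<alpha>. Poly_Mapping.keys \<alpha> \<subseteq> {1..l} \<longrightarrow> mls_coeff (Tfull A s l) \<alpha> \<noteq> 0 \<longrightarrow>
          tau_function s (Poly_Mapping.lookup (mls_coeff (Tfull A s l) \<alpha>)) \<and>
          ((\<forall>i\<in>{1..l}. \<forall>r\<in>{1..s}. laurent_polynomial (A i r)) \<longrightarrow>
             polynomial_tau_function s (Poly_Mapping.lookup (mls_coeff (Tfull A s l) \<alpha>))))
   \<and> (\<forall>\<tau>. polynomial_tau_function s \<tau> \<longrightarrow>
        (\<exists>l' A' k. l' \<ge> 1 \<and> Poly_Mapping.keys k \<subseteq> {1..s} \<and>
           (\<forall>i\<in>{1..l'}. \<forall>r\<in>{1..s}. A' i r \<noteq> 0 \<and> laurent_polynomial (A' i r)) \<and>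
           \<tau> = Poly_Mapping.lookup (zpow k * mls_coeff (Tfull A' s l') 0)))"
proof (intro conjI ballI allI impI)
  fix a assume a: "a \<in> {1..l} \<rightarrow> {1..s}"
  show "Tcomp A l a = (\<Prod>r=1..s. indexed_det {i \<in> {1..l}. a i = r}
      (\<lambda>i j. uvar i ^ (j - 1) * mls_of_fls i (Tone A i r)))"
    by (rule Tcomp_eq_prod_det[OF a])
  fix \<alpha> :: "nat \<Rightarrow>\<^sub>0 int" assume \<alpha>: "keys \<alpha> \<subseteq> {1..l}"
  show "mls_coeff (Tcomp A l a) \<alpha> = (\<Prod>r=1..s. indexed_det {i \<in> {1..l}. a i = r}
      (\<lambda>i j. fls_nth (Tone A i r) (lookup \<alpha> i + 1 - int j)))"
    by (rule mls_coeff_Tcomp[OF a \<alpha>])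
  assume "mls_coeff (Tcomp A l a) \<alpha> \<noteq> 0"
  then show "tau_function s (lookup (mls_coeff (Tcomp A l a) \<alpha>))"
    "polynomial_tau_function s (lookup (mls_coeff (Tcomp A l a) \<alpha>))"
    unfolding polynomial_tau_function_lookup tau_function_lookup
    using hirota_Tcomp[OF a] fock_Tcomp[OF a] by blast+
next
  fix \<alpha> assume "mls_coeff (Tfull A s l) \<alpha> \<noteq> 0"
  then show "tau_function s (lookup (mls_coeff (Tfull A s l) \<alpha>))"
    "polynomial_tau_function s (lookup (mls_coeff (Tfull A s l) \<alpha>))"
    unfolding polynomial_tau_function_lookup tau_function_lookup
    using hirota_Tfull fock_Tfull by blast+
next
  fix \<tau> assume \<tau>: "polynomial_tau_function s \<tau>"
  then obtain f where f: "\<tau> = lookup f" by (auto simp: polynomial_tau_function_def)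
  then obtain m where "fock s m f" "f \<noteq> 0" "hirota s f"
    using \<tau> by (auto simp: polynomial_tau_function_lookup tau_function_lookup)
  then have "decomposable s f" by (intro hirota_imp_decomposable)
  from decomposable_imp_Tfull[OF this assms(1)]
  show "\<exists>l' A' k. l' \<ge> 1 \<and> keys k \<subseteq> {1..s} \<and>
      (\<forall>i\<in>{1..l'}. \<forall>r\<in>{1..s}. A' i r \<noteq> 0 \<and> laurent_polynomial (A' i r)) \<and>
      \<tau> = lookup (zpow k * mls_coeff (Tfull A' s l') 0)"
    unfolding f by metis
qed

end
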